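(* There is a universal constant $c>0$ such that the following holds. Let $d_1\le d_2$ and $n$ be positive integers, and let $\widehat\Theta_1=\widehat\Theta_1(X)$ be any estimator for $\Theta_1\in\mathrm{PD}(d_1)$ from a tuple $X$ of $n$ independent samples of $\mathcal N(0,\Theta_1^{-1}\otimes\Theta_2^{-1})$, where $\Theta_2\in\mathrm{PD}(d_2)$. Let $B\subset\mathrm{PD}(d_1)$ denote the ball about $I_{d_1}$ of radius $1/2$ in the operator norm. Then: 1. If $\delta^2=c\,\min\left\{1,\frac{d_1^2}{n\min\{nd_1,d_2\}}\right\}$, then $\displaystyle\sup_{\Theta_1\in B,\ \Theta_2\in\mathrm{PD}(d_2)}\Pr\left[d_{\mathrm{FR}}(\widehat\Theta_1,\Theta_1)\ge\delta\right]\ge\frac12$. 2. If $\delta^2=c\,\min\left\{1,\frac{d_1}{n\min\{nd_1,d_2\}}\right\}$, then $\displaystyle\sup_{\Theta_1\in B,\ \Theta_2\in\mathrm{PD}(d_2)}\Pr\left[d_{\mathrm{op}}(\widehat\Theta_1,\Theta_1)\ge\delta\right]\ge\frac12$. As a consequence, there is a universal constant $c'>0$ with $$\sup_{\Theta_1\in B,\,\Theta_2\in\mathrm{PD}(d_2)}\mathbb E\bigl[d_{\mathrm{FR}}(\widehat\Theta_1,\Theta_1)^2\bigr]\ge c'\min\left\{\frac{d_1^2}{n\min\{nd_1,d_2\}},1\right\}$$ and $$\sup_{\Theta_1\in B,\,\Theta_2\in\mathrm{PD}(d_2)}\mathbb E\bigl[d_{\mathrm{op}}(\widehat\Theta_1,\Theta_1)^2\bigr]\ge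 c'\min\left\{\frac{d_1}{n\min\{nd_1,d_2\}},1\right\}.$$
   Context: $\mathrm{PD}(d)$ is the set of real symmetric positive definite $d\times d$ matrices. An estimator for $\Theta_1$ is a (measurable) function of the samples with values in $\mathrm{PD}(d_1)$; it does not have access to $\Theta_1$ or $\Theta_2$. Probabilities and expectations are over the samples drawn from $\mathcal N(0,\Theta_1^{-1}\otimes\Theta_2^{-1})$ on $\mathbb R^{d_1d_2}$. $d_{\mathrm{FR}}(A,B)=\frac1{\sqrt2}\|\log(B^{-1/2}AB^{-1/2})\|_F$ (Fisher-Rao distance) and $d_{\mathrm{op}}(A,B)=\|\log(B^{-1/2}AB^{-1/2})\|_{\mathrm{op}}$ (Thompson distance). *)

theory Defs
  imports "HOL-Probability.Probability" "Jordan_Normal_Form.Gauss_Jordan_Elimination"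
    "Jordan_Normal_Form.Determinant"
begin

hide_const (open) Finite_Cartesian_Product.vec Finite_Cartesian_Product.mat
  Determinants.det
no_notation Finite_Cartesian_Product.vec_nth (infixl "$" 90)
no_notation Inner_Product.real_inner_class.inner (infix "\<bullet>" 70)

definition PD :: "nat \<Rightarrow> real mat set" where
  "PD d = {A \<in> carrier_mat d d. transpose_mat A = A \<and>
     (\<forall>v \<in> carrier_vec d. v \<noteq> 0\<^sub>v d \<longrightarrow> v \<bullet> (A *\<^sub>v v) > 0)}"

text \<open>The library inverse is option valued, and is \<open>Some\<close> exactly on invertible matrices.\<close>

definition inv_mat :: "real mat \<Rightarrow> real mat" where
  "inv_mat A = the (mat_inverse A)"

definition kronecker :: "real mat \<Rightarrow> real mat \<Rightarrow> real mat" where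
  "kronecker A B = mat (dim_row A * dim_row B) (dim_col A * dim_col B)
     (\<lambda>(i, j). A $$ (i div dim_row B, j div dim_col B) * B $$ (i mod dim_row B, j mod dim_col B))"

text \<open>
  Functional calculus for real symmetric matrices:
  if \<open>A = U diag(e) U\<^sup>T\<close> with \<open>U\<close> orthogonal, then \<open>f(A) = U diag(f(e)) U\<^sup>T\<close>.
  The library predicate \<open>orthogonal_mat\<close> only requires orthogonal nonzero columns, hence the
  explicit orthonormality conditions.
\<close>

definition spectral_decomp :: "real mat \<Rightarrow> real mat \<Rightarrow> (nat \<Rightarrow> real) \<Rightarrow> bool" where
  "spectral_decomp A U e \<longleftrightarrow> (let d = dim_row A in
     U \<in> carrier_mat d d \<and> U * transpose_mat U = 1\<^sub>m d \<and> transpose_mat U * U = 1\<^sub>m d \<and>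
     A = U * mat_diag d e * transpose_mat U)"

definition mat_fun :: "(real \<Rightarrow> real) \<Rightarrow> real mat \<Rightarrow> real mat" where
  "mat_fun f A = (THE B. \<exists>U e. spectral_decomp A U e \<and>
     B = U * mat_diag (dim_row A) (\<lambda>i. f (e i)) * transpose_mat U)"

text \<open>The result does not depend on the decomposition.\<close>

lemma mat_fun_unique:
  assumes "spectral_decomp A U e" "spectral_decomp A V g"
  shows "U * mat_diag (dim_row A) (\<lambda>i. f (e i)) * transpose_mat U =
    V * mat_diag (dim_row A) (\<lambda>i. f (g i)) * transpose_mat V"
proof -
  define d where "d = dim_row A"
  note D = mat_diag_dim[of d]
  have U: "U \<in> carrier_mat d d" "transpose_mat U \<in> carrier_mat d d"
      "U * transpose_mat U = 1\<^sub>m d" "transpose_mat U * U = 1\<^sub>m d"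
      "A = U * mat_diag d e * transpose_mat U"
    using assms(1) by (auto simp: spectral_decomp_def Let_def d_def)
  have V: "V \<in> carrier_mat d d" "transpose_mat V \<in> carrier_mat d d"
      "V * transpose_mat V = 1\<^sub>m d" "transpose_mat V * V = 1\<^sub>m d"
      "A = V * mat_diag d g * transpose_mat V"
    using assms(2) by (auto simp: spectral_decomp_def Let_def d_def)
  define W where "W = transpose_mat V * U"
  have W: "W \<in> carrier_mat d d" unfolding W_def using U V by auto
  note assoc = assoc_mult_mat[of _ d d _ d _ d] mult_carrier_mat[of _ d d _ d]
    right_mult_one_mat[of _ d d] left_mult_one_mat[of _ d d]
  have AU: "A * U = U * mat_diag d e"
    by (subst U(5)) (use U D in \<open>simp add: assoc\<close>)
  have VA: "transpose_mat V * A = mat_diag d g * transpose_mat V"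
  proof -
    have "transpose_mat V * A = (transpose_mat V * V) * (mat_diag d g * transpose_mat V)"
      by (subst V(5)) (use V(1,2) D in \<open>simp add: assoc\<close>)
    then show ?thesis using V D by (simp add: assoc)
  qed
  have A: "A \<in> carrier_mat d d" using U D by auto
  have WD: "W * mat_diag d e = mat_diag d g * W"
  proof -
    have "W * mat_diag d e = transpose_mat V * (A * U)"
      unfolding W_def AU using U V D by (simp add: assoc)
    also have "\<dots> = (transpose_mat V * A) * U" using U V A by (simp add: assoc)
    also have "\<dots> = mat_diag d g * W"
      unfolding VA W_def using U V D by (simp add: assoc)
    finally show ?thesis .
  qed
  have We: "W $$ (i, j) * e j = g i * W $$ (i, j)" if "i < d" "j < d" for i j
    using arg_cong[OF WD, of "\<lambda>M. M $$ (i, j)"] that W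
    by (simp add: mat_diag_mult_left[OF W] mat_diag_mult_right[OF W])
  have "W $$ (i, j) * f (e j) = f (g i) * W $$ (i, j)" if "i < d" "j < d" for i j
  proof (cases "W $$ (i, j) = 0")
    case False
    then have "e j = g i" using We[OF that] by (simp add: mult.commute)
    then show ?thesis by (simp add: mult.commute)
  qed simp
  then have WF: "W * mat_diag d (\<lambda>i. f (e i)) = mat_diag d (\<lambda>i. f (g i)) * W"
    by (intro eq_matI) (auto simp: mat_diag_mult_left[OF W] mat_diag_mult_right[OF W])
  have VW: "V * W = U"
  proof -
    have "V * W = (V * transpose_mat V) * U"
      unfolding W_def using U(1) V(1,2) by (simp add: assoc)
    then show ?thesis using U V by (simp add: assoc)
  qed
  have WU: "W * transpose_mat U = transpose_mat V"
    unfolding W_def using U V by (simp add: assoc)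
  have "U * mat_diag d (\<lambda>i. f (e i)) * transpose_mat U
      = V * (W * mat_diag d (\<lambda>i. f (e i))) * transpose_mat U"
    unfolding VW[symmetric] using W V D by (simp add: assoc)
  also have "\<dots> = V * mat_diag d (\<lambda>i. f (g i)) * (W * transpose_mat U)"
    unfolding WF using U V W D by (simp add: assoc)
  finally show ?thesis unfolding WU d_def .
qed

lemma mat_fun_eq:
  assumes "spectral_decomp A U e"
  shows "mat_fun f A = U * mat_diag (dim_row A) (\<lambda>i. f (e i)) * transpose_mat U"
  unfolding mat_fun_def
  by (rule the_equality) (use assms mat_fun_unique in blast)+

definition vec_norm2 :: "real vec \<Rightarrow> real" where
  "vec_norm2 v = sqrt (v \<bullet> v)"

definition frob_norm :: "real mat \<Rightarrow> real" where
  "frob_norm A = sqrt (\<Sum>i<dim_row A. \<Sum>j<dim_col A. (A $$ (i, j))\<^sup>2)"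

definition op_norm :: "real mat \<Rightarrow> real" where
  "op_norm A = (SUP v \<in> {v \<in> carrier_vec (dim_col A). vec_norm2 v = 1}. vec_norm2 (A *\<^sub>v v))"

definition log_ratio :: "real mat \<Rightarrow> real mat \<Rightarrow> real mat" where
  "log_ratio A B = (let R = mat_fun (\<lambda>x. x powr (- 1 / 2)) B in mat_fun ln (R * A * R))"

definition d_FR :: "real mat \<Rightarrow> real mat \<Rightarrow> real" where
  "d_FR A B = 1 / sqrt 2 * frob_norm (log_ratio A B)"

definition d_op :: "real mat \<Rightarrow> real mat \<Rightarrow> real" where
  "d_op A B = op_norm (log_ratio A B)"

definition op_ball :: "nat \<Rightarrow> real mat set" where
  "op_ball d = {A \<in> PD d. op_norm (A - 1\<^sub>m d) < 1 / 2}"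

text \<open>
  The space of \<open>d\<close>-dimensional real vectors is \<open>\<Pi>\<^sub>M i\<in>{..<d}. lborel\<close>, since \<open>d\<close> is a term here;
  \<open>vec d x\<close> turns a point of it into a vector.
  The centred Gaussian with (positive definite) covariance \<open>S\<close> is given by its density.
\<close>

definition gaussian :: "nat \<Rightarrow> real mat \<Rightarrow> (nat \<Rightarrow> real) measure" where
  "gaussian d S = density (\<Pi>\<^sub>M i\<in>{..<d}. lborel)
     (\<lambda>x. ennreal (exp (- (vec d x \<bullet> (inv_mat S *\<^sub>v vec d x)) / 2) / sqrt ((2 * pi) ^ d * det S)))"

definition sample_law :: "nat \<Rightarrow> nat \<Rightarrow> nat \<Rightarrow> real mat \<Rightarrow> real mat \<Rightarrow> (nat \<Rightarrow> nat \<Rightarrow> real) measure" where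
  "sample_law n d1 d2 \<Theta>1 \<Theta>2 =
     (\<Pi>\<^sub>M k\<in>{..<n}. gaussian (d1 * d2) (kronecker (inv_mat \<Theta>1) (inv_mat \<Theta>2)))"

definition sample_space :: "nat \<Rightarrow> nat \<Rightarrow> nat \<Rightarrow> (nat \<Rightarrow> nat \<Rightarrow> real) measure" where
  "sample_space n d1 d2 = (\<Pi>\<^sub>M k\<in>{..<n}. \<Pi>\<^sub>M i\<in>{..<d1 * d2}. borel)"

text \<open>Borel measurability of a matrix-valued map is measurability of each entry.\<close>

definition estimator :: "nat \<Rightarrow> nat \<Rightarrow> nat \<Rightarrow> ((nat \<Rightarrow> nat \<Rightarrow> real) \<Rightarrow> real mat) \<Rightarrow> bool" where
  "estimator n d1 d2 T \<longleftrightarrow>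
     (\<forall>X \<in> space (sample_space n d1 d2). T X \<in> PD d1) \<and>
     (\<forall>i<d1. \<forall>j<d1. (\<lambda>X. T X $$ (i, j)) \<in> borel_measurable (sample_space n d1 d2))"

text \<open>
  \<open>worst_prob\<close> and \<open>worst_risk\<close> are the suprema over \<open>\<Theta>\<^sub>1\<close> in the ball and all \<open>\<Theta>\<^sub>2\<close>;
  the risk takes values in \<^typ>\<open>ennreal\<close> because it may be infinite.
\<close>

definition worst_prob ::
  "(real mat \<Rightarrow> real mat \<Rightarrow> real) \<Rightarrow> nat \<Rightarrow> nat \<Rightarrow> nat \<Rightarrow> ((nat \<Rightarrow> nat \<Rightarrow> real) \<Rightarrow> real mat) \<Rightarrow> real \<Rightarrow> real"
  where "worst_prob \<rho> n d1 d2 T \<delta> =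
    (SUP (\<Theta>1, \<Theta>2) \<in> op_ball d1 \<times> PD d2.
       measure (sample_law n d1 d2 \<Theta>1 \<Theta>2)
         {X \<in> space (sample_law n d1 d2 \<Theta>1 \<Theta>2). \<rho> (T X) \<Theta>1 \<ge> \<delta>})"

definition worst_risk ::
  "(real mat \<Rightarrow> real mat \<Rightarrow> real) \<Rightarrow> nat \<Rightarrow> nat \<Rightarrow> nat \<Rightarrow> ((nat \<Rightarrow> nat \<Rightarrow> real) \<Rightarrow> real mat) \<Rightarrow> ennreal"
  where "worst_risk \<rho> n d1 d2 T =
    (SUP (\<Theta>1, \<Theta>2) \<in> op_ball d1 \<times> PD d2.
       \<integral>\<^sup>+ X. ennreal ((\<rho> (T X) \<Theta>1)\<^sup>2) \<partial>sample_law n d1 d2 \<Theta>1 \<Theta>2)"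

end

theory Submission
  imports Defs "Jordan_Normal_Form.Char_Poly" "HOL-Computational_Algebra.Fundamental_Theorem_Algebra"
begin

text \<open>Lower bounds for the sup over \<open>\<Theta>\<^sub>1\<close> follow from a finite family \<open>\<Theta>\<^sub>\<sigma> = 1 + E\<^sub>\<sigma>\<close> whose free entries range
  over a fine grid. No point of \<open>PD d\<^sub>1\<close> is close to more than a fraction \<open>8\<^sup>-\<^sup>m\<close> of the family, \<open>m\<close> being the
  number of free entries, so an estimator of small error would have to decide among many hypotheses;
  this is impossible as long as the chi-square divergence from the member \<open>\<Theta>\<^sub>1 = 1\<close> is at most \<open>2\<^sup>m\<close>.
  Perturbing all entries gives the Fisher-Rao bound, perturbing one row and column the Thompson bound.

  If \<open>d\<^sub>2 \<le> n d\<^sub>1\<close>, take \<open>\<Theta>\<^sub>2 = 1\<close>: the data are \<open>n d\<^sub>2\<close> Gaussian samples with precision \<open>\<Theta>\<^sub>1\<close>.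
  Otherwise put the prior \<open>\<Theta>\<^sub>2 = W W\<^sup>T\<close> on the nuisance parameter, with \<open>W\<close> a standard Gaussian square matrix
  of size \<open>d\<^sub>2\<close>. Written as an \<open>N \<times> d\<^sub>2\<close> matrix with \<open>N = n d\<^sub>1\<close>, the data are then distributed like \<open>V\<^sup>-\<^sup>1 H\<close>, where
  \<open>H\<close> is standard Gaussian and \<open>V\<close> is an \<open>N \<times> N\<close> matrix with independent Gaussian rows of covariance
  \<open>1 \<otimes> \<Theta>\<^sub>1\<close>. Hence they carry no more information on \<open>\<Theta>\<^sub>1\<close> than the \<open>n N\<close> Gaussian samples forming \<open>V\<close>.\<close>

section \<open>Symmetric matrices\<close>

text \<open>For a known \<open>\<Theta>2\<close> the data amount to \<open>n * d2\<close> Gaussian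
  vectors of dimension \<open>d1\<close>. So when \<open>d2 > n * d1\<close> no fixed nuisance can
  give the claimed rate, and ignorance of \<open>\<Theta>2\<close> has to enter as a prior. With the
  Wishart prior the mixture stays explicit: for fixed data \<open>X\<close> the exponent is
  quadratic in \<open>W\<close>, and integrating \<open>W\<close> out leaves a power of
  \<open>det (1 + X^T B X)\<close>, which Sylvester's identity turns into a determinant of size
  \<open>N\<close>. Chi-square suits Gaussians because \<open>f^2 / f0\<close> is again a multiple
  of a Gaussian density, with precision \<open>2 P - 1\<close>, as long as the eigenvalues stay near
  1. Probability 1/2 is demanded even for \<open>d1 = 1\<close>, where there is a single free entry.
  Two values per entry are then too few: the divergence bound \<open>2^m\<close> and the ball
  fraction \<open>8^-m\<close> are combined through \<open>4 * 2^m * 8^-m \<le> 1\<close>, which is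
  an equality at \<open>m = 1\<close>. The 1000 grid values per entry are ample for the Chernoff
  estimate of that fraction, since \<open>8 * 8 * e < 1000\<close>.\<close>

lemma symmetric_swap:
  fixes A :: "real mat"
  assumes A: "A \<in> carrier_mat n n" and sym: "transpose_mat A = A"
    and v: "v \<in> carrier_vec n" and w: "w \<in> carrier_vec n"
  shows "v \<bullet> (A *\<^sub>v w) = w \<bullet> (A *\<^sub>v v)"
proof -
  have "v \<bullet> (A *\<^sub>v w) = (\<Sum>i<n. \<Sum>j<n. v $ i * A $$ (i,j) * w $ j)"
    using A v w by (simp add: scalar_prod_def sum_distrib_left atLeast0LessThan mult_ac)
  also have "\<dots> = (\<Sum>j<n. \<Sum>i<n. w $ j * A $$ (j,i) * v $ i)"
  proof (subst sum.swap, intro sum.cong refl)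
    fix i j assume "i \<in> {..<n}" "j \<in> {..<n}"
    then have "A $$ (i,j) = A $$ (j,i)"
      using arg_cong[OF sym, of "\<lambda>M. M $$ (j,i)"] A by simp
    then show "v $ i * A $$ (i,j) * w $ j = w $ j * A $$ (j,i) * v $ i" by simp
  qed
  also have "\<dots> = w \<bullet> (A *\<^sub>v v)"
    using A v w by (simp add: scalar_prod_def sum_distrib_left atLeast0LessThan mult_ac)
  finally show ?thesis .
qed

lemma self_scalar_prod_real:
  fixes v :: "real vec"
  assumes "v \<in> carrier_vec n"
  shows "v \<bullet> v = (\<Sum>i<n. (v $ i)\<^sup>2)" "0 \<le> v \<bullet> v" "v \<bullet> v = 0 \<longleftrightarrow> v = 0\<^sub>v n"
proof -
  show *: "v \<bullet> v = (\<Sum>i<n. (v $ i)\<^sup>2)"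
    using assms by (simp add: scalar_prod_def atLeast0LessThan power2_eq_square)
  show "0 \<le> v \<bullet> v" unfolding * by (intro sum_nonneg) auto
  show "v \<bullet> v = 0 \<longleftrightarrow> v = 0\<^sub>v n"
    unfolding * using assms by (subst sum_nonneg_eq_0_iff) (auto intro!: eq_vecI)
qed

text \<open>The complex characteristic polynomial has a root \<open>z\<close>, with eigenvector
  \<open>x + i y\<close>. Evaluating the symmetric form at \<open>x\<close> and \<open>y\<close> in
  both orders gives \<open>Im z * (x \<bullet> x + y \<bullet> y) = 0\<close>, so \<open>z\<close>
  is real, and whichever of \<open>x\<close>, \<open>y\<close> is nonzero is a real
  eigenvector.\<close>

lemma symmetric_has_eigenvector:
  fixes A :: "real mat"
  assumes A: "A \<in> carrier_mat n n" and sym: "transpose_mat A = A" and n: "0 < n"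
  shows "\<exists>v e. v \<in> carrier_vec n \<and> v \<noteq> 0\<^sub>v n \<and> A *\<^sub>v v = e \<cdot>\<^sub>v v"
proof -
  define Ac where "Ac = map_mat complex_of_real A"
  have Ac: "Ac \<in> carrier_mat n n" using A by (simp add: Ac_def)
  have "\<not> constant (poly (char_poly Ac))"
    using degree_monic_char_poly[OF Ac] n by (simp add: constant_degree)
  then obtain z where "poly (char_poly Ac) z = 0"
    using fundamental_theorem_of_algebra by blast
  then obtain u where u: "u \<in> carrier_vec n" "u \<noteq> 0\<^sub>v n" "Ac *\<^sub>v u = z \<cdot>\<^sub>v u"
    using eigenvalue_root_char_poly[OF Ac, of z] Ac
    by (auto simp: eigenvalue_def eigenvector_def)
  define x where "x = map_vec Re u"
  define y where "y = map_vec Im u"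
  have xy: "x \<in> carrier_vec n" "y \<in> carrier_vec n" using u by (auto simp: x_def y_def)
  have comp: "(\<Sum>j<n. complex_of_real (A $$ (i,j)) * u $ j) = z * u $ i" if "i < n" for i
    using arg_cong[OF u(3), of "\<lambda>v. v $ i"] that u(1) A
    by (simp add: Ac_def scalar_prod_def atLeast0LessThan)
  have Ax: "A *\<^sub>v x = Re z \<cdot>\<^sub>v x - Im z \<cdot>\<^sub>v y"
  proof (rule eq_vecI)
    fix i assume "i < dim_vec (Re z \<cdot>\<^sub>v x - Im z \<cdot>\<^sub>v y)"
    then have i: "i < n" using xy by simp
    show "(A *\<^sub>v x) $ i = (Re z \<cdot>\<^sub>v x - Im z \<cdot>\<^sub>v y) $ i"
      using arg_cong[OF comp[OF i], of Re] i u(1) A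
      by (simp add: x_def y_def scalar_prod_def atLeast0LessThan)
  qed (use A xy in auto)
  have Ay: "A *\<^sub>v y = Im z \<cdot>\<^sub>v x + Re z \<cdot>\<^sub>v y"
  proof (rule eq_vecI)
    fix i assume "i < dim_vec (Im z \<cdot>\<^sub>v x + Re z \<cdot>\<^sub>v y)"
    then have i: "i < n" using xy by simp
    show "(A *\<^sub>v y) $ i = (Im z \<cdot>\<^sub>v x + Re z \<cdot>\<^sub>v y) $ i"
      using arg_cong[OF comp[OF i], of Im] i u(1) A
      by (simp add: x_def y_def scalar_prod_def atLeast0LessThan algebra_simps)
  qed (use A xy in auto)
  have "y \<bullet> (A *\<^sub>v x) = Re z * (y \<bullet> x) - Im z * (y \<bullet> y)"
    unfolding Ax using xy by (simp add: scalar_prod_minus_distrib[of _ n])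
  moreover have "x \<bullet> (A *\<^sub>v y) = Im z * (x \<bullet> x) + Re z * (x \<bullet> y)"
    unfolding Ay using xy by (simp add: scalar_prod_add_distrib[of _ n])
  moreover have "x \<bullet> y = y \<bullet> x" using xy by (rule comm_scalar_prod)
  ultimately have "Im z * (x \<bullet> x + y \<bullet> y) = 0"
    using symmetric_swap[OF A sym xy] by (simp add: algebra_simps)
  moreover have "x \<noteq> 0\<^sub>v n \<or> y \<noteq> 0\<^sub>v n"
  proof (rule ccontr)
    assume "\<not> ?thesis"
    then have "x $ i = 0" "y $ i = 0" if "i < n" for i using that by auto
    then have "u = 0\<^sub>v n" using u(1) by (intro eq_vecI) (auto simp: x_def y_def complex_eq_iff)
    then show False using u by simp
  qed
  then have "x \<bullet> x + y \<bullet> y \<noteq> 0"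
    using self_scalar_prod_real[OF xy(1)] self_scalar_prod_real[OF xy(2)]
    by (auto simp: add_nonneg_eq_0_iff)
  ultimately have "Im z = 0" by simp
  then have "A *\<^sub>v x = Re z \<cdot>\<^sub>v x" "A *\<^sub>v y = Re z \<cdot>\<^sub>v y"
    unfolding Ax Ay using xy by (auto intro!: eq_vecI)
  then show ?thesis using \<open>x \<noteq> 0\<^sub>v n \<or> y \<noteq> 0\<^sub>v n\<close> xy by blast
qed

text \<open>The Householder reflection along \<open>w = v - e\<^sub>0\<close>; for \<open>w = 0\<close> the formula gives the
  identity because \<open>2 / 0 = 0\<close>.\<close>

lemma orthogonal_reflection_first_col:
  fixes v :: "real vec"
  assumes v: "v \<in> carrier_vec n" "v \<bullet> v = 1" and n: "0 < n"
  shows "\<exists>H \<in> carrier_mat n n. transpose_mat H = H \<and> H * H = 1\<^sub>m n \<and> col H 0 = v"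
proof -
  define w where "w i = v $ i - (if i = 0 then 1 else 0)" for i
  define s where "s = (\<Sum>i<n. (w i)\<^sup>2)"
  define c where "c = 2 / s"
  define H where "H = mat n n (\<lambda>(i,j). (if i = j then 1 else 0) - c * w i * w j)"
  have H: "H \<in> carrier_mat n n" by (simp add: H_def)
  have s: "s = 2 - 2 * v $ 0"
  proof -
    have "s = (\<Sum>i<n. (v $ i)\<^sup>2) + (\<Sum>i<n. if i = 0 then 1 - 2 * v $ i else 0)"
      unfolding s_def sum.distrib[symmetric]
      by (intro sum.cong) (auto simp: w_def power2_eq_square algebra_simps)
    then show ?thesis using self_scalar_prod_real(1)[OF v(1)] v(2) n by (simp add: sum.delta')
  qed
  \<comment> \<open>Also true for \<open>s = 0\<close>, where \<open>c = 0\<close>. This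
    cancellation is all that \<open>H * H = 1\<close> requires.\<close>
  have cs: "c * c * s = 2 * c" by (simp add: c_def)
  have "transpose_mat H = H" by (rule eq_matI) (auto simp: H_def)
  moreover have "H * H = 1\<^sub>m n"
  proof (rule eq_matI)
    fix i j assume ij: "i < dim_row (1\<^sub>m n :: real mat)" "j < dim_col (1\<^sub>m n :: real mat)"
    have "(H * H) $$ (i,j) = (\<Sum>k<n. ((if i = k then 1 else 0) - c * w i * w k) *
        ((if k = j then 1 else 0) - c * w k * w j))"
      using ij by (simp add: H_def scalar_prod_def atLeast0LessThan)
    also have "\<dots> = (\<Sum>k<n. (if k = i then (if i = j then 1 else 0) - c * w i * w j else 0)
        - (if k = j then c * w i * w j else 0) + c * c * w i * w j * (w k)\<^sup>2)"
      by (intro sum.cong) (auto simp: power2_eq_square algebra_simps)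
    also have "\<dots> = (if i = j then 1 else 0) - 2 * c * w i * w j + (c * c * s) * w i * w j"
      using ij by (simp add: sum.distrib sum_subtractf s_def sum_distrib_left[symmetric] algebra_simps)
    finally show "(H * H) $$ (i,j) = 1\<^sub>m n $$ (i,j)" unfolding cs using ij by simp
  qed (auto simp: H_def)
  moreover have "col H 0 = v"
  proof (rule eq_vecI)
    fix i assume "i < dim_vec v"
    then have i: "i < n" using v by simp
    have "c * w 0 = (if s = 0 then 0 else -1)"
    proof -
      have "w 0 * 2 = - s" unfolding s by (simp add: w_def)
      then show ?thesis by (auto simp: c_def field_simps)
    qed
    moreover have "w i = 0" if "s = 0"
      using that i unfolding s_def by (subst (asm) sum_nonneg_eq_0_iff) auto
    moreover have "c * w i * w 0 = w i * (c * w 0)" by simp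
    ultimately have "c * w i * w 0 = - w i" by (cases "s = 0") simp_all
    then show "col H 0 $ i = v $ i" using i n by (auto simp: H_def w_def split: if_splits)
  qed (use v in \<open>simp add: H_def\<close>)
  ultimately show ?thesis using H by blast
qed

text \<open>Deflation: conjugating by a reflection that carries the first unit vector to an
  eigenvector splits off a 1 by 1 block. The induction hypothesis diagonalises the remaining block,
  and the result is bordered by 1 and conjugated back.\<close>

theorem symmetric_spectral_decomp:
  fixes A :: "real mat"
  assumes "A \<in> carrier_mat n n" "transpose_mat A = A"
  shows "\<exists>U e. spectral_decomp A U e"
  using assms
proof (induction n arbitrary: A)
  case 0
  have "spectral_decomp A (1\<^sub>m 0) (\<lambda>_. 0)"
    using 0 by (auto simp: spectral_decomp_def Let_def intro!: eq_matI)
  then show ?case by blast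
next
  case (Suc n)
  note A = Suc.prems
  note sq = assoc_mult_mat[of _ "Suc n" "Suc n" _ "Suc n" _ "Suc n"]
    mult_carrier_mat[of _ "Suc n" "Suc n" _ "Suc n"]
    right_mult_one_mat[of _ "Suc n" "Suc n"] left_mult_one_mat[of _ "Suc n" "Suc n"]
    transpose_mult[of _ "Suc n" "Suc n" _ "Suc n"]
  obtain v' e0 where v': "v' \<in> carrier_vec (Suc n)" "v' \<noteq> 0\<^sub>v (Suc n)" "A *\<^sub>v v' = e0 \<cdot>\<^sub>v v'"
    using symmetric_has_eigenvector[OF A] by auto
  define r where "r = sqrt (v' \<bullet> v')"
  have r: "r > 0" "r * r = v' \<bullet> v'"
    using self_scalar_prod_real[OF v'(1)] v'(2) by (auto simp: r_def order.strict_iff_order)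
  define v where "v = (1 / r) \<cdot>\<^sub>v v'"
  have v: "v \<in> carrier_vec (Suc n)" using v' by (simp add: v_def)
  have "v \<bullet> v = 1" using v'(1) r by (simp add: v_def r(2)[symmetric])
  then obtain H where H: "H \<in> carrier_mat (Suc n) (Suc n)" "transpose_mat H = H"
      "H * H = 1\<^sub>m (Suc n)" "col H 0 = v"
    using orthogonal_reflection_first_col[OF v] by auto
  have Av: "A *\<^sub>v v = e0 \<cdot>\<^sub>v v"
    using v' A(1) by (simp add: v_def mult_mat_vec smult_smult_assoc mult.commute)
  define B where "B = H * A * H"
  have B: "B \<in> carrier_mat (Suc n) (Suc n)" using H A by (auto simp: B_def)
  have Bsym: "transpose_mat B = B" unfolding B_def using H A by (simp add: sq)
  \<comment> \<open>\<open>H\<close> is an involution with first column \<open>v\<close>, so it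
    sends the eigenvector \<open>v\<close> back to the first unit vector.\<close>
  have Bcol: "B $$ (i,0) = (if i = 0 then e0 else 0)" if i: "i < Suc n" for i
  proof -
    have "col B 0 = H *\<^sub>v (A *\<^sub>v col H 0)"
      unfolding B_def using H(1) A(1) by (simp add: assoc_mult_mat_vec[of _ "Suc n" "Suc n" _ "Suc n"]
        col_mult2[of _ "Suc n" "Suc n" _ "Suc n"] sq)
    also have "\<dots> = e0 \<cdot>\<^sub>v (H *\<^sub>v col H 0)" using H Av v by (simp add: mult_mat_vec)
    also have "H *\<^sub>v col H 0 = col (H * H) 0" using H(1) by (subst col_mult2[of _ "Suc n" "Suc n" _ "Suc n"]) auto
    finally have "col B 0 = e0 \<cdot>\<^sub>v col (1\<^sub>m (Suc n)) 0" by (simp add: H(3))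
    from arg_cong[OF this, of "\<lambda>v. v $ i"] show ?thesis using i B by simp
  qed
  define C where "C = mat n n (\<lambda>(i,j). B $$ (Suc i, Suc j))"
  have C: "C \<in> carrier_mat n n" by (simp add: C_def)
  have Bij: "B $$ (i,j) = B $$ (j,i)" if "i < Suc n" "j < Suc n" for i j
    using arg_cong[OF Bsym, of "\<lambda>M. M $$ (j,i)"] B that by simp
  have "transpose_mat C = C" by (rule eq_matI) (auto simp: C_def Bij)
  from Suc.IH[OF C this] C obtain U e where U: "U \<in> carrier_mat n n"
      "U * transpose_mat U = 1\<^sub>m n" "transpose_mat U * U = 1\<^sub>m n"
      "C = U * mat_diag n e * transpose_mat U"
    by (auto simp: spectral_decomp_def Let_def)
  let ?F = "\<lambda>a M. four_block_mat (mat 1 1 (\<lambda>_. a)) (0\<^sub>m 1 n) (0\<^sub>m n 1) M"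
  have Brow: "B $$ (0,j) = (if j = 0 then e0 else 0)" if "j < Suc n" for j
    using Bij[of 0 j] Bcol[of j] that by simp
  have BF: "B = ?F e0 C"
    using B C Bcol Brow by (intro eq_matI) (auto simp: C_def not_less less_Suc_eq_0_disj)
  have Fmult: "?F a M * ?F b M' = ?F (a * b) (M * M')"
    if "M \<in> carrier_mat n n" "M' \<in> carrier_mat n n" for a b :: real and M M'
    using that by (subst mult_four_block_mat[of _ 1 1 _ n _ n _ _ 1 _ n])
      (auto intro!: cong_four_block_mat eq_matI simp: scalar_prod_def)
  have Fone: "?F 1 (1\<^sub>m n) = (1\<^sub>m (Suc n) :: real mat)" by (intro eq_matI) auto
  have Ftrans: "transpose_mat (?F 1 M) = ?F 1 (transpose_mat M)" if "M \<in> carrier_mat n n" for M :: "real mat"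
    using that by (intro eq_matI) auto
  have Fdiag: "?F e0 (mat_diag n e) = mat_diag (Suc n) (case_nat e0 e)"
    by (intro eq_matI) (auto simp: mat_diag_def split: nat.splits)
  have UT: "transpose_mat U \<in> carrier_mat n n" "mat_diag n e \<in> carrier_mat n n" using U by auto
  define V where "V = H * ?F 1 U"
  have FU: "?F 1 U \<in> carrier_mat (Suc n) (Suc n)"
    "?F 1 (transpose_mat U) \<in> carrier_mat (Suc n) (Suc n)"
    using four_block_carrier_mat[of "mat 1 1 (\<lambda>_. 1)" 1 1 _ n n] U(1) UT by auto
  have FD: "?F e0 (mat_diag n e) \<in> carrier_mat (Suc n) (Suc n)"
    using four_block_carrier_mat[of "mat 1 1 (\<lambda>_. e0)" 1 1 "mat_diag n e" n n] by auto
  have VT: "transpose_mat V = ?F 1 (transpose_mat U) * H"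
    unfolding V_def using U H FU by (simp add: sq Ftrans del: One_nat_def)
  have V: "V \<in> carrier_mat (Suc n) (Suc n)" unfolding V_def using H FU by auto
  have "A = V * mat_diag (Suc n) (case_nat e0 e) * transpose_mat V"
  proof -
    have "A = H * B * H"
    proof -
      have "H * B * H = (H * H) * A * (H * H)" unfolding B_def using H(1) A by (simp add: sq)
      then show ?thesis using H(3) A by (simp add: sq)
    qed
    also have "B = ?F 1 U * ?F e0 (mat_diag n e) * ?F 1 (transpose_mat U)"
      unfolding BF U(4) using U(1) UT by (simp add: Fmult mult_carrier_mat[of _ n n] del: One_nat_def)
    finally show ?thesis unfolding VT unfolding V_def Fdiag[symmetric]
      using H(1) FU FD
      by (simp add: sq del: One_nat_def)
  qed
  moreover have "V * transpose_mat V = 1\<^sub>m (Suc n)"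
  proof -
    have "V * transpose_mat V = H * (?F 1 U * ?F 1 (transpose_mat U)) * H"
      unfolding VT unfolding V_def using H(1) FU by (simp add: sq del: One_nat_def)
    also have "\<dots> = 1\<^sub>m (Suc n)" using U UT Fone H by (simp add: Fmult sq del: One_nat_def)
    finally show ?thesis .
  qed
  moreover have "transpose_mat V * V = 1\<^sub>m (Suc n)"
  proof -
    have "transpose_mat V * V = ?F 1 (transpose_mat U) * (H * H) * ?F 1 U"
      unfolding VT unfolding V_def using H(1) FU by (simp add: sq del: One_nat_def)
    also have "\<dots> = 1\<^sub>m (Suc n)" using U UT Fone H(3) FU by (simp add: Fmult sq del: One_nat_def)
    finally show ?thesis .
  qed
  ultimately have "spectral_decomp A V (case_nat e0 e)"
    using V A by (simp add: spectral_decomp_def Let_def)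
  then show ?case by blast
qed

section \<open>Positive definite matrices\<close>

lemma quadratic_form_sum:
  fixes A :: "real mat"
  assumes "A \<in> carrier_mat n n" "v \<in> carrier_vec n"
  shows "v \<bullet> (A *\<^sub>v v) = (\<Sum>i<n. \<Sum>j<n. v $ i * A $$ (i,j) * v $ j)"
  using assms by (simp add: scalar_prod_def sum_distrib_left atLeast0LessThan mult_ac)

lemma PD_carrier: "A \<in> PD n \<Longrightarrow> A \<in> carrier_mat n n"
  and PD_transpose: "A \<in> PD n \<Longrightarrow> transpose_mat A = A"
  by (auto simp: PD_def)

lemma PD_symmetric_entry: "A \<in> PD n \<Longrightarrow> i < n \<Longrightarrow> j < n \<Longrightarrow> A $$ (i,j) = A $$ (j,i)"
  using arg_cong[OF PD_transpose, of A n "\<lambda>M. M $$ (j,i)"] PD_carrier[of A n] by simp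

lemma quadratic_form_congruence:
  fixes L M :: "real mat"
  assumes "L \<in> carrier_mat m n" "M \<in> carrier_mat m m" "v \<in> carrier_vec n"
  shows "v \<bullet> ((transpose_mat L * M * L) *\<^sub>v v) = (L *\<^sub>v v) \<bullet> (M *\<^sub>v (L *\<^sub>v v))"
proof -
  have Mv: "M *\<^sub>v (L *\<^sub>v v) \<in> carrier_vec m" using assms by auto
  have "v \<bullet> ((transpose_mat L * M * L) *\<^sub>v v) = v \<bullet> (transpose_mat L *\<^sub>v (M *\<^sub>v (L *\<^sub>v v)))"
    using assms by (simp add: assoc_mult_mat_vec[of _ n m _ m] assoc_mult_mat_vec[of _ n m _ n]
      assoc_mult_mat[of _ n m _ m _ n] assoc_mult_mat_vec[of _ m m _ n])
  also have "\<dots> = (transpose_mat L *\<^sub>v (M *\<^sub>v (L *\<^sub>v v))) \<bullet> v"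
    using assms Mv by (intro comm_scalar_prod[of _ n]) auto
  also have "\<dots> = (M *\<^sub>v (L *\<^sub>v v)) \<bullet> (L *\<^sub>v v)"
    using transpose_vec_mult_scalar[OF assms(1,3) Mv] by simp
  also have "\<dots> = (L *\<^sub>v v) \<bullet> (M *\<^sub>v (L *\<^sub>v v))"
    using assms Mv by (intro comm_scalar_prod[of _ m]) auto
  finally show ?thesis .
qed

lemma PD_one: "1\<^sub>m n \<in> PD n"
  using self_scalar_prod_real(2,3) by (auto simp: PD_def order.strict_iff_order)

lemma PD_congruence:
  assumes L: "L \<in> carrier_mat n n" "det L \<noteq> 0" and M: "M \<in> PD n"
  shows "transpose_mat L * M * L \<in> PD n"
proof -
  note MM = PD_carrier[OF M] PD_transpose[OF M]
  have "transpose_mat (transpose_mat L * M * L) = transpose_mat L * M * L"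
    using L MM by (simp add: transpose_mult[of _ n n _ n] assoc_mult_mat[of _ n n _ n _ n])
  moreover have "v \<bullet> ((transpose_mat L * M * L) *\<^sub>v v) > 0" if v: "v \<in> carrier_vec n" "v \<noteq> 0\<^sub>v n" for v
  proof -
    have "L *\<^sub>v v \<noteq> 0\<^sub>v n" using det_0_iff_vec_prod_zero[OF L(1)] L(2) v by auto
    then show ?thesis using M L(1) v
      by (subst quadratic_form_congruence[OF L(1) MM(1) v(1)]) (auto simp: PD_def)
  qed
  ultimately show ?thesis using L MM by (auto simp: PD_def)
qed

lemma PD_gram:
  assumes L: "L \<in> carrier_mat n n" "det L \<noteq> 0"
  shows "transpose_mat L * L \<in> PD n"
  using PD_congruence[OF L PD_one] L by (simp add: right_mult_one_mat[of _ n n])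

text \<open>A Cholesky factor in the order \<open>L^T L\<close> with \<open>L\<close> lower
  triangular. In this order the quadratic form of \<open>A\<close> at \<open>x\<close> is the
  squared norm of \<open>L x\<close>, and \<open>x \<mapsto> L x\<close> is a triangular
  substitution that can be integrated one coordinate at a time.\<close>

definition lower_factor :: "nat \<Rightarrow> real mat \<Rightarrow> real mat \<Rightarrow> bool" where
  "lower_factor n L A \<longleftrightarrow> L \<in> carrier_mat n n \<and> (\<forall>i<n. \<forall>j<n. i < j \<longrightarrow> L $$ (i,j) = 0) \<and>
     (\<forall>i<n. L $$ (i,i) > 0) \<and> A = transpose_mat L * L"

lemma PD_diag_pos:
  assumes "A \<in> PD n" "i < n"
  shows "A $$ (i,i) > 0"
proof -
  have "unit_vec n i \<bullet> (A *\<^sub>v unit_vec n i) > 0"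
    using assms unfolding PD_def by (auto simp: unit_vec_nonzero)
  then show ?thesis using assms PD_carrier[OF assms(1)]
    by (simp add: quadratic_form_sum[of _ n] mult.assoc unit_vec_def sum.delta'
      if_distrib[where f="\<lambda>x. _ * x"] if_distrib[where f="\<lambda>x. x * _"] cong: if_cong)
qed

text \<open>Cholesky factorisation, eliminating the last coordinate via its Schur complement.\<close>

theorem PD_lower_factor_exists:
  assumes "A \<in> PD n"
  shows "\<exists>L. lower_factor n L A"
  using assms
proof (induction n arbitrary: A)
  case 0
  then have "lower_factor 0 (1\<^sub>m 0) A"
    by (auto simp: lower_factor_def PD_def intro!: eq_matI)
  then show ?case by blast
next
  case (Suc n)
  have A: "A \<in> carrier_mat (Suc n) (Suc n)" using Suc.prems by (rule PD_carrier)
  define c where "c = A $$ (n,n)"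
  have c: "c > 0" using PD_diag_pos[OF Suc.prems] by (simp add: c_def)
  have sym: "A $$ (i,j) = A $$ (j,i)" if "i < Suc n" "j < Suc n" for i j
    using PD_symmetric_entry[OF Suc.prems that] .
  define C where "C = mat n n (\<lambda>(i,j). A $$ (i,j) - A $$ (i,n) * A $$ (j,n) / c)"
  have C: "C \<in> carrier_mat n n" by (simp add: C_def)
  have "C \<in> PD n"
  proof -
    have "v \<bullet> (C *\<^sub>v v) > 0" if v: "v \<in> carrier_vec n" "v \<noteq> 0\<^sub>v n" for v
    proof -
      define b where "b = (\<Sum>i<n. A $$ (i,n) * v $ i)"
      have aux: "(\<Sum>i<n. v $ i * A $$ (i,n) * t) = t * b" for t
        unfolding b_def sum_distrib_left by (intro sum.cong) auto
      \<comment> \<open>The last coordinate \<open>- b / c\<close> minimises the form of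
        \<open>A\<close> over all extensions of \<open>v\<close>; the minimum is the value of the
        Schur complement \<open>C\<close> at \<open>v\<close>.\<close>
      define w where "w = vec (Suc n) (\<lambda>i. if i < n then v $ i else - b / c)"
      have "w \<noteq> 0\<^sub>v (Suc n)"
      proof
        assume "w = 0\<^sub>v (Suc n)"
        then have "w $ i = 0" if "i < n" for i using that by simp
        then have "v = 0\<^sub>v n" using v(1) by (intro eq_vecI) (auto simp: w_def)
        then show False using v by simp
      qed
      then have "0 < w \<bullet> (A *\<^sub>v w)" using Suc.prems by (auto simp: PD_def w_def)
      also have "w \<bullet> (A *\<^sub>v w) = (\<Sum>i<Suc n. \<Sum>j<Suc n. w $ i * A $$ (i,j) * w $ j)"
        by (rule quadratic_form_sum[OF A]) (simp add: w_def)
      also have "\<dots> = (\<Sum>i<n. (\<Sum>j<n. v $ i * A $$ (i,j) * v $ j) + v $ i * A $$ (i,n) * (- b / c))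
          + ((\<Sum>j<n. (- b / c) * A $$ (n,j) * v $ j) + (- b / c) * c * (- b / c))"
        by (simp add: w_def c_def)
      also have "(\<Sum>j<n. (- b / c) * A $$ (n,j) * v $ j) = (- b / c) * b"
        unfolding b_def sum_distrib_left by (intro sum.cong) (auto simp: sym)
      also have "(\<Sum>i<n. (\<Sum>j<n. v $ i * A $$ (i,j) * v $ j) + v $ i * A $$ (i,n) * (- b / c))
          = (\<Sum>i<n. \<Sum>j<n. v $ i * A $$ (i,j) * v $ j) + (- b / c) * b"
        by (simp only: sum.distrib aux)
      also have "\<dots> + ((- b / c) * b + (- b / c) * c * (- b / c))
          = (\<Sum>i<n. \<Sum>j<n. v $ i * A $$ (i,j) * v $ j) - b * b / c"
        using c by (simp add: field_simps)
      also have "b * b / c = (\<Sum>i<n. \<Sum>j<n. v $ i * (A $$ (i,n) * A $$ (j,n) / c) * v $ j)"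
        unfolding b_def sum_product sum_divide_distrib by (intro sum.cong) auto
      also have "(\<Sum>i<n. \<Sum>j<n. v $ i * A $$ (i,j) * v $ j) - \<dots> =
            (\<Sum>i<n. \<Sum>j<n. v $ i * (A $$ (i,j) - A $$ (i,n) * A $$ (j,n) / c) * v $ j)"
        by (simp only: sum_subtractf[symmetric] right_diff_distrib left_diff_distrib)
      also have "\<dots> = v \<bullet> (C *\<^sub>v v)"
        unfolding quadratic_form_sum[OF C v(1)] by (simp add: C_def)
      finally show ?thesis .
    qed
    moreover have "transpose_mat C = C" by (rule eq_matI) (auto simp: C_def sym)
    ultimately show ?thesis using C by (auto simp: PD_def)
  qed
  then obtain L where L: "L \<in> carrier_mat n n" "\<And>i j. i < n \<Longrightarrow> j < n \<Longrightarrow> i < j \<Longrightarrow> L $$ (i,j) = 0"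
     "\<And>i. i < n \<Longrightarrow> L $$ (i,i) > 0" "C = transpose_mat L * L"
    using Suc.IH[of C] by (auto simp: lower_factor_def)
  have Cij: "(\<Sum>k<n. L $$ (k,i) * L $$ (k,j)) = A $$ (i,j) - A $$ (i,n) * A $$ (j,n) / c"
    if "i < n" "j < n" for i j
    using arg_cong[OF L(4), of "\<lambda>M. M $$ (i,j)"] that L(1)
    by (simp add: C_def scalar_prod_def atLeast0LessThan)
  \<comment> \<open>The last row puts back the rank-one term that was subtracted in
    \<open>C\<close>.\<close>
  define K where "K = mat (Suc n) (Suc n) (\<lambda>(i,j). if i < n then if j < n then L $$ (i,j) else 0
    else if j < n then A $$ (j,n) / sqrt c else sqrt c)"
  have "A = transpose_mat K * K"
  proof (rule eq_matI)
    fix i j assume "i < dim_row (transpose_mat K * K)" "j < dim_col (transpose_mat K * K)"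
    then have ij: "i < Suc n" "j < Suc n" by (auto simp: K_def)
    have cc: "sqrt c * sqrt c = c" using c by simp
    have "(transpose_mat K * K) $$ (i,j) = (\<Sum>k<Suc n. K $$ (k,i) * K $$ (k,j))"
      using ij by (simp add: K_def scalar_prod_def atLeast0LessThan)
    also have "\<dots> = A $$ (i,j)"
    proof (cases "i < n"; cases "j < n")
      assume "i < n" "j < n"
      then show ?thesis using c by (simp add: K_def Cij cc)
    next
      assume "i < n" "\<not> j < n"
      then show ?thesis using c ij sym[of i n] by (simp add: K_def not_less le_less_Suc_eq)
    next
      assume "\<not> i < n" "j < n"
      then show ?thesis using c ij sym[of j n] by (simp add: K_def not_less le_less_Suc_eq)
    next
      assume "\<not> i < n" "\<not> j < n"
      then show ?thesis using c ij by (simp add: K_def not_less le_less_Suc_eq cc c_def)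
    qed
    finally show "A $$ (i,j) = (transpose_mat K * K) $$ (i,j)" by simp
  qed (use A in \<open>auto simp: K_def\<close>)
  then have "lower_factor (Suc n) K A"
    using L c by (auto simp: lower_factor_def K_def)
  then show ?case by blast
qed

lemma det_lower_factor:
  assumes "lower_factor n L A"
  shows "det L = (\<Prod>i<n. L $$ (i,i))" "det L > 0" "det A = (det L)\<^sup>2"
proof -
  have L: "L \<in> carrier_mat n n" "A = transpose_mat L * L" using assms by (auto simp: lower_factor_def)
  have "det L = prod_list (diag_mat L)"
    using assms by (intro det_lower_triangular[of n]) (auto simp: lower_factor_def)
  then show *: "det L = (\<Prod>i<n. L $$ (i,i))"
    using L(1) by (simp add: diag_mat_def prod.list_conv_set_nth atLeast0LessThan)
  show "det L > 0" unfolding * using assms by (intro prod_pos) (auto simp: lower_factor_def)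
  show "det A = (det L)\<^sup>2"
    unfolding L(2) using L(1) by (simp add: det_mult[of _ n] det_transpose[of _ n] power2_eq_square)
qed

lemma PD_det_pos: "A \<in> PD n \<Longrightarrow> det A > 0"
  using PD_lower_factor_exists[of A n] det_lower_factor[of n _ A] by fastforce

section \<open>Inverses of positive definite matrices\<close>

lemma inv_mat_eqI:
  assumes "A \<in> carrier_mat n n" "B \<in> carrier_mat n n" "A * B = 1\<^sub>m n"
  shows "inv_mat A = B"
proof (cases "mat_inverse A")
  case None
  have "B * A = 1\<^sub>m n" using mat_mult_left_right_inverse[OF assms] .
  then have "A \<in> Units (ring_mat TYPE(real) n undefined)"
    using assms unfolding Units_def by (auto simp: ring_mat_simps)
  then show ?thesis using mat_inverse(1)[OF assms(1) None, of undefined] by blast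
next
  case (Some C)
  then have C: "A * C = 1\<^sub>m n" "C * A = 1\<^sub>m n" "C \<in> carrier_mat n n"
    using mat_inverse(2)[OF assms(1) Some] by auto
  have "C = C * (A * B)" using assms C by simp
  also have "\<dots> = (C * A) * B" using assms C by (intro assoc_mult_mat[symmetric]) auto
  also have "\<dots> = B" using assms C by simp
  finally show ?thesis using Some by (simp add: inv_mat_def)
qed

lemma inv_mat_works:
  assumes "A \<in> carrier_mat n n" "det A \<noteq> 0"
  shows "inv_mat A \<in> carrier_mat n n" "A * inv_mat A = 1\<^sub>m n" "inv_mat A * A = 1\<^sub>m n"
proof -
  obtain B where "B \<in> carrier_mat n n" "A * B = 1\<^sub>m n" "B * A = 1\<^sub>m n"
    using det_non_zero_imp_unit[OF assms] by (auto simp: Units_def ring_mat_simps)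
  then show "inv_mat A \<in> carrier_mat n n" "A * inv_mat A = 1\<^sub>m n" "inv_mat A * A = 1\<^sub>m n"
    using inv_mat_eqI[OF assms(1)] by auto
qed

lemma PD_inv_mat:
  assumes "A \<in> PD n"
  shows "inv_mat A \<in> PD n" "A * inv_mat A = 1\<^sub>m n" "inv_mat A * A = 1\<^sub>m n"
    "inv_mat (inv_mat A) = A" "det (inv_mat A) = 1 / det A"
proof -
  note A = PD_carrier[OF assms] PD_transpose[OF assms] PD_det_pos[OF assms]
  note I = inv_mat_works[OF A(1)]
  show AI: "A * inv_mat A = 1\<^sub>m n" "inv_mat A * A = 1\<^sub>m n" using I A by auto
  have IC: "inv_mat A \<in> carrier_mat n n" using I A by auto
  have IT: "transpose_mat (inv_mat A) = inv_mat A"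
  proof -
    have "A * transpose_mat (inv_mat A) = 1\<^sub>m n"
      using arg_cong[OF AI(2), of transpose_mat] IC A by (simp add: transpose_mult[of _ n n _ n])
    then show ?thesis using inv_mat_eqI[OF A(1), of "transpose_mat (inv_mat A)"] IC by simp
  qed
  have det: "det A * det (inv_mat A) = 1"
    using arg_cong[OF AI(1), of det] IC A by (simp add: det_mult[of _ n])
  then show "det (inv_mat A) = 1 / det A" using A by (simp add: field_simps)
  have "det (inv_mat A) \<noteq> 0" using det by auto
  from PD_congruence[OF IC this assms] show "inv_mat A \<in> PD n"
    using AI IC A IT by (simp add: left_mult_one_mat[of _ n n])
  show "inv_mat (inv_mat A) = A" using inv_mat_eqI[OF IC A(1) AI(2)] .
qed

section \<open>Kronecker products\<close>

lemma div_mod_less: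
  fixes i a b :: nat
  assumes "i < a * b"
  shows "i div b < a" "i mod b < b"
proof -
  have "b > 0" using assms by (cases b) auto
  then show "i div b < a" "i mod b < b"
    using assms by (auto simp: less_mult_imp_div_less)
qed

lemma pair_index_less:
  fixes i j a b :: nat
  assumes "i < a" "j < b"
  shows "i * b + j < a * b"
proof -
  have "i * b + j < Suc i * b" using assms by simp
  also have "\<dots> \<le> a * b" using assms by (intro mult_right_mono) auto
  finally show ?thesis .
qed

lemma sum_div_mod:
  fixes f :: "nat \<Rightarrow> nat \<Rightarrow> 'a::comm_monoid_add"
  shows "(\<Sum>k<a * b. f (k div b) (k mod b)) = (\<Sum>i<a. \<Sum>j<b. f i j)"
proof -
  have "(\<Sum>k<a * b. f (k div b) (k mod b))
      = (\<Sum>i<a. \<Sum>k=i * b..<i * b + b. f (k div b) (k mod b))"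
    by (rule sum.nat_group[symmetric])
  also have "\<dots> = (\<Sum>i<a. \<Sum>j<b. f i j)"
  proof (rule sum.cong[OF refl])
    fix i
    show "(\<Sum>k=i * b..<i * b + b. f (k div b) (k mod b)) = (\<Sum>j<b. f i j)"
      using sum.shift_bounds_nat_ivl[of "\<lambda>k. f (k div b) (k mod b)" 0 "i * b" b]
      by (simp add: add.commute atLeast0LessThan)
  qed
  finally show ?thesis .
qed

lemma prod_div_mod:
  fixes f :: "nat \<Rightarrow> nat \<Rightarrow> 'a::comm_monoid_mult"
  shows "(\<Prod>k<a * b. f (k div b) (k mod b)) = (\<Prod>i<a. \<Prod>j<b. f i j)"
proof -
  have "(\<Prod>k<a * b. f (k div b) (k mod b))
      = (\<Prod>i<a. \<Prod>k=i * b..<i * b + b. f (k div b) (k mod b))"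
    by (rule prod.nat_group[symmetric])
  also have "\<dots> = (\<Prod>i<a. \<Prod>j<b. f i j)"
  proof (rule prod.cong[OF refl])
    fix i
    show "(\<Prod>k=i * b..<i * b + b. f (k div b) (k mod b)) = (\<Prod>j<b. f i j)"
      using prod.shift_bounds_nat_ivl[of "\<lambda>k. f (k div b) (k mod b)" 0 "i * b" b]
      by (simp add: add.commute atLeast0LessThan)
  qed
  finally show ?thesis .
qed

lemma kronecker_dim [simp]: "dim_row (kronecker A B) = dim_row A * dim_row B"
  "dim_col (kronecker A B) = dim_col A * dim_col B"
  by (auto simp: kronecker_def)

lemma kronecker_carrier:
  "A \<in> carrier_mat a b \<Longrightarrow> B \<in> carrier_mat c d \<Longrightarrow> kronecker A B \<in> carrier_mat (a * c) (b * d)"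
  by (metis carrier_matD carrier_matI kronecker_dim)

lemma kronecker_index:
  "i < dim_row A * dim_row B \<Longrightarrow> j < dim_col A * dim_col B \<Longrightarrow> kronecker A B $$ (i,j) =
    A $$ (i div dim_row B, j div dim_col B) * B $$ (i mod dim_row B, j mod dim_col B)"
  by (simp add: kronecker_def)

lemma kronecker_transpose:
  "transpose_mat (kronecker A B) = kronecker (transpose_mat A) (transpose_mat B)"
  by (rule eq_matI) (auto simp: kronecker_index div_mod_less)

lemma kronecker_mult:
  assumes "A \<in> carrier_mat a b" "B \<in> carrier_mat a' b'" "C \<in> carrier_mat b c" "D \<in> carrier_mat b' c'"
  shows "kronecker A B * kronecker C D = kronecker (A * C) (B * D)"
proof (rule eq_matI)
  fix i j assume "i < dim_row (kronecker (A * C) (B * D))" "j < dim_col (kronecker (A * C) (B * D))"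
  then have ij: "i < a * a'" "j < c * c'" using assms by auto
  have "(kronecker A B * kronecker C D) $$ (i,j)
      = (\<Sum>k<b * b'. (A $$ (i div a', k div b') * B $$ (i mod a', k mod b')) *
        (C $$ (k div b', j div c') * D $$ (k mod b', j mod c')))"
    using ij assms by (simp add: scalar_prod_def kronecker_index atLeast0LessThan)
  also have "\<dots> = (\<Sum>k<b. \<Sum>l<b'. (A $$ (i div a', k) * B $$ (i mod a', l)) *
        (C $$ (k, j div c') * D $$ (l, j mod c')))"
    by (rule sum_div_mod)
  also have "\<dots> = (\<Sum>k<b. A $$ (i div a', k) * C $$ (k, j div c')) *
      (\<Sum>l<b'. B $$ (i mod a', l) * D $$ (l, j mod c'))"
    unfolding sum_product by (intro sum.cong) (auto simp: mult_ac)
  also have "\<dots> = kronecker (A * C) (B * D) $$ (i,j)"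
    using ij assms div_mod_less[OF ij(1)] div_mod_less[OF ij(2)]
    by (simp add: kronecker_index scalar_prod_def atLeast0LessThan)
  finally show "(kronecker A B * kronecker C D) $$ (i,j) = kronecker (A * C) (B * D) $$ (i,j)" .
qed (use assms in auto)

lemma kronecker_one: "kronecker (1\<^sub>m a) (1\<^sub>m b) = 1\<^sub>m (a * b)"
proof (rule eq_matI)
  fix i j assume "i < dim_row (1\<^sub>m (a * b) :: real mat)" "j < dim_col (1\<^sub>m (a * b) :: real mat)"
  then have ij: "i < a * b" "j < a * b" by auto
  have "i = j \<longleftrightarrow> i div b = j div b \<and> i mod b = j mod b"
    by (metis div_mult_mod_eq)
  then show "kronecker (1\<^sub>m a) (1\<^sub>m b) $$ (i,j) = 1\<^sub>m (a * b) $$ (i,j)"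
    using ij div_mod_less[OF ij(1)] div_mod_less[OF ij(2)] by (auto simp: kronecker_index)
qed auto

text \<open>\<open>div\<close> and \<open>mod\<close> order index pairs lexicographically, so above
  the diagonal one of the two factors always meets a zero. Triangularity is what later gives the
  determinant of a Kronecker product as a product of diagonal entries.\<close>

lemma kronecker_lower_factor:
  assumes L: "lower_factor a L A" and M: "lower_factor b M B"
  shows "lower_factor (a * b) (kronecker L M) (kronecker A B)"
proof -
  have LM: "L \<in> carrier_mat a a" "M \<in> carrier_mat b b"
    "A = transpose_mat L * L" "B = transpose_mat M * M"
    using L M by (auto simp: lower_factor_def)
  have "kronecker L M $$ (i,j) = 0" if "i < a * b" "j < a * b" "i < j" for i j
  proof -
    have "i div b < j div b \<or> i div b = j div b \<and> i mod b < j mod b"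
      using that by (metis add_less_cancel_left div_le_mono div_mult_mod_eq less_imp_le nat_less_le)
    then show ?thesis
      using that LM div_mod_less[OF that(1)] div_mod_less[OF that(2)] L M
      by (auto simp: kronecker_index lower_factor_def)
  qed
  moreover have "kronecker L M $$ (i,i) > 0" if "i < a * b" for i
    using that LM div_mod_less[OF that] L M by (auto simp: kronecker_index lower_factor_def)
  moreover have "kronecker A B = transpose_mat (kronecker L M) * kronecker L M"
    using LM(1,2) unfolding LM(3,4) kronecker_transpose
    by (subst kronecker_mult[of _ a a _ b b _ a _ b]) auto
  ultimately show ?thesis using kronecker_carrier[OF LM(1,2)] by (auto simp: lower_factor_def)
qed

lemma lower_factor_PD: "lower_factor n L A \<Longrightarrow> A \<in> PD n"
  using PD_gram[of L n] det_lower_factor(2)[of n L A] by (auto simp: lower_factor_def)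

lemma kronecker_PD:
  assumes "A \<in> PD a" "B \<in> PD b"
  shows "kronecker A B \<in> PD (a * b)" "det (kronecker A B) = det A ^ b * det B ^ a"
proof -
  obtain L M where LM: "lower_factor a L A" "lower_factor b M B"
    using PD_lower_factor_exists assms by meson
  note K = kronecker_lower_factor[OF LM]
  show "kronecker A B \<in> PD (a * b)" using K by (rule lower_factor_PD)
  have c: "dim_row L = a" "dim_col L = a" "dim_row M = b" "dim_col M = b"
    using LM by (auto simp: lower_factor_def)
  have "det (kronecker L M) = (\<Prod>k<a * b. L $$ (k div b, k div b) * M $$ (k mod b, k mod b))"
    unfolding det_lower_factor(1)[OF K] using c by (intro prod.cong) (auto simp: kronecker_index)
  also have "\<dots> = (\<Prod>i<a. \<Prod>j<b. L $$ (i,i) * M $$ (j,j))" by (rule prod_div_mod)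
  also have "\<dots> = det L ^ b * det M ^ a"
    by (simp add: prod.distrib
      det_lower_factor(1)[OF LM(1)] det_lower_factor(1)[OF LM(2)] prod_power_distrib)
  finally show "det (kronecker A B) = det A ^ b * det B ^ a"
    unfolding det_lower_factor(3)[OF K] det_lower_factor(3)[OF LM(1)] det_lower_factor(3)[OF LM(2)]
    by (simp add: power_mult_distrib power_mult[symmetric] mult.commute)
qed

lemma kronecker_inv_mat:
  assumes "A \<in> PD a" "B \<in> PD b"
  shows "inv_mat (kronecker (inv_mat A) (inv_mat B)) = kronecker A B"
proof -
  note c = PD_carrier[OF assms(1)] PD_carrier[OF assms(2)] PD_carrier[OF PD_inv_mat(1)[OF assms(1)]]
    PD_carrier[OF PD_inv_mat(1)[OF assms(2)]]
  show ?thesis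
    using c PD_inv_mat[OF assms(1)] PD_inv_mat[OF assms(2)]
    by (intro inv_mat_eqI[of _ "a * b"])
       (auto simp: kronecker_mult[of _ a a _ b b _ a _ b] kronecker_one intro!: kronecker_carrier)
qed

text \<open>Needed to regroup the precision
  \<open>1 \<otimes> (\<Theta>1 \<otimes> \<Theta>2)\<close> of the whole sample as
  \<open>(1 \<otimes> \<Theta>1) \<otimes> \<Theta>2\<close>, that is, to view the data as one
  matrix with \<open>n * d1\<close> rows and \<open>d2\<close> columns.\<close>

lemma kronecker_assoc: "kronecker (kronecker A B) C = kronecker A (kronecker B C)"
proof (rule eq_matI)
  fix i j assume "i < dim_row (kronecker A (kronecker B C))" "j < dim_col (kronecker A (kronecker B C))"
  then have ij: "i < dim_row A * dim_row B * dim_row C" "j < dim_col A * dim_col B * dim_col C"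
    by (auto simp: mult.assoc)
  note [simp] = div_mod_less[OF ij(1)] div_mod_less[OF ij(2)]
  have ij': "i < dim_row A * (dim_row B * dim_row C)" "j < dim_col A * (dim_col B * dim_col C)"
    using ij by (auto simp: mult.assoc)
  note [simp] = div_mod_less[OF ij'(1)] div_mod_less[OF ij'(2)]
  have aux: "k mod (b * c) div c = k div c mod b" "k mod (b * c) mod c = k mod c"
    "k div (b * c) = k div c div b" for k b c :: nat
    using mod_mult2_eq[of k c b] div_mult2_eq[of k c b]
    by (cases "c = 0"; simp add: mult.commute)+
  show "kronecker (kronecker A B) C $$ (i,j) = kronecker A (kronecker B C) $$ (i,j)"
    using ij ij' by (simp add: kronecker_index aux)
qed (auto simp: mult.assoc)

section \<open>Gaussian integrals on coordinate spaces\<close>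

abbreviation lborel_pi :: "nat \<Rightarrow> (nat \<Rightarrow> real) measure" where
  "lborel_pi K \<equiv> \<Pi>\<^sub>M i\<in>{..<K}. lborel"

interpretation lborel_pi: product_sigma_finite "\<lambda>_::nat. lborel :: real measure"
  by standard

lemma sigma_finite_lborel_pi: "sigma_finite_measure (lborel_pi K)"
  by (rule lborel_pi.sigma_finite) simp

lemma product_sigma_finite_lborel_pi: "product_sigma_finite (\<lambda>_::nat. lborel_pi D)"
  using sigma_finite_lborel_pi by (simp add: product_sigma_finite_def)

lemma measurable_component_lborel_pi:
  "i < K \<Longrightarrow> (\<lambda>x. x i) \<in> borel_measurable (lborel_pi K)"
  using measurable_component_singleton[of i "{..<K}" "\<lambda>_. lborel :: real measure"] by simp

text \<open>Induction on the last coordinate: with the others fixed it undergoes an affine map of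
  slope \<open>l K K\<close>, so the one-dimensional substitution rule extracts that factor, and
  Tonelli leaves the transformation of the first \<open>K\<close> coordinates.\<close>

lemma nn_integral_lower_triangular:
  fixes l :: "nat \<Rightarrow> nat \<Rightarrow> real"
  assumes "f \<in> borel_measurable (lborel_pi K)" "\<And>i. i < K \<Longrightarrow> l i i > 0"
  shows "ennreal (\<Prod>i<K. l i i) * (\<integral>\<^sup>+x. f (\<lambda>i\<in>{..<K}. \<Sum>j\<le>i. l i j * x j) \<partial>lborel_pi K)
    = (\<integral>\<^sup>+x. f x \<partial>lborel_pi K)"
  using assms
proof (induction K arbitrary: f)
  case 0
  have "(\<integral>\<^sup>+x. f (\<lambda>i\<in>{..<0}. \<Sum>j\<le>i. l i j * x j) \<partial>lborel_pi 0) = (\<integral>\<^sup>+x. f x \<partial>lborel_pi 0)"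
    by (intro nn_integral_cong arg_cong[where f=f]) (auto simp: space_PiM fun_eq_iff)
  then show ?case by (simp only: lessThan_0 prod.empty ennreal_1 mult_1)
next
  case (Suc K)
  let ?T = "\<lambda>x. \<lambda>i\<in>{..<K}. \<Sum>j\<le>i. l i j * x j"
  let ?T' = "\<lambda>x. \<lambda>i\<in>{..<Suc K}. \<Sum>j\<le>i. l i j * x j"
  have ins: "{..<Suc K} = insert K {..<K}" by (rule lessThan_Suc)
  note f[measurable] = Suc.prems(1)
  have f'[measurable]: "f \<in> borel_measurable (Pi\<^sub>M (insert K {..<K}) (\<lambda>_. lborel))"
    using f by (simp add: ins)
  have T[measurable]: "?T \<in> measurable (lborel_pi K) (lborel_pi K)"
    by (intro measurable_restrict) (auto intro!: borel_measurable_sum borel_measurable_times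
        measurable_component_singleton simp: measurable_lborel1)
  have T'[measurable]: "?T' \<in> measurable (lborel_pi (Suc K)) (lborel_pi (Suc K))"
    by (intro measurable_restrict) (auto intro!: borel_measurable_sum borel_measurable_times
        measurable_component_singleton simp: measurable_lborel1)
  have upd[measurable]: "(\<lambda>(x, y). x(K := y)) \<in> measurable (lborel_pi K \<Otimes>\<^sub>M lborel) (lborel_pi (Suc K))"
    unfolding ins by (rule measurable_add_dim)
  define g where "g x = (\<integral>\<^sup>+y. f (x(K := y)) \<partial>lborel)" for x
  interpret lK: sigma_finite_measure "lborel_pi K" by (rule sigma_finite_lborel_pi)
  have g[measurable]: "g \<in> borel_measurable (lborel_pi K)"
  proof -
    have "(\<lambda>(x, y). f (x(K := y))) \<in> borel_measurable (lborel_pi K \<Otimes>\<^sub>M lborel)"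
      using measurable_compose[OF upd f] by (simp add: case_prod_beta' split_beta')
    then show ?thesis unfolding g_def by (rule lborel.borel_measurable_nn_integral)
  qed
  have l: "l K K > 0" using Suc.prems by simp
  have inner: "ennreal (l K K) * (\<integral>\<^sup>+y. f (?T' (x(K := y))) \<partial>lborel) = g (?T x)"
    if x: "x \<in> space (lborel_pi K)" for x
  proof -
    define c where "c = (\<Sum>j<K. l K j * x j)"
    have eq: "?T' (x(K := y)) = (?T x)(K := c + l K K * y)" for y
    proof
      fix i
      have "(\<Sum>j\<le>i. l i j * (x(K := y)) j) = (\<Sum>j\<le>i. l i j * x j)" if "i < K"
        using that by (intro sum.cong) auto
      moreover have "(\<Sum>j\<le>K. l K j * (x(K := y)) j) = c + l K K * y"
        unfolding c_def by (simp add: lessThan_Suc_atMost[symmetric])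
      ultimately show "?T' (x(K := y)) i = ((?T x)(K := c + l K K * y)) i"
        by (cases "i < K"; cases "i = K") auto
    qed
    have Tx: "?T x \<in> space (lborel_pi K)" using T x by (rule measurable_space)
    have "(\<lambda>y. f ((?T x)(K := y))) \<in> borel_measurable lborel"
      using measurable_compose[OF _ f, of "\<lambda>y. (?T x)(K := y)" lborel] Tx
        measurable_component_update[of "?T x" "{..<K}" "\<lambda>_. lborel" K] by (simp add: ins)
    then have "g (?T x) = \<bar>l K K\<bar> * (\<integral>\<^sup>+y. f ((?T x)(K := c + l K K * y)) \<partial>lborel)"
      unfolding g_def using l by (intro nn_integral_real_affine) auto
    then show ?thesis unfolding eq using l by simp
  qed
  have "ennreal (\<Prod>i<Suc K. l i i) * (\<integral>\<^sup>+x. f (?T' x) \<partial>lborel_pi (Suc K))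
    = ennreal (\<Prod>i<K. l i i) * (ennreal (l K K) * (\<integral>\<^sup>+x. (\<integral>\<^sup>+y. f (?T' (x(K := y))) \<partial>lborel) \<partial>lborel_pi K))"
  proof -
    have m: "(\<lambda>x. f (?T' x)) \<in> borel_measurable (Pi\<^sub>M (insert K {..<K}) (\<lambda>_. lborel))"
      using measurable_compose[OF T' f] by (simp only: ins)
    have "(\<integral>\<^sup>+x. f (?T' x) \<partial>lborel_pi (Suc K)) = (\<integral>\<^sup>+x. (\<integral>\<^sup>+y. f (?T' (x(K := y))) \<partial>lborel) \<partial>lborel_pi K)"
      using lborel_pi.product_nn_integral_insert[OF _ _ m] by (simp only: ins) simp
    moreover have "ennreal (\<Prod>i<Suc K. l i i) = ennreal (\<Prod>i<K. l i i) * ennreal (l K K)"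
      using l by (simp add: ennreal_mult'')
    ultimately show ?thesis by (simp add: mult.assoc)
  qed
  also have "ennreal (l K K) * (\<integral>\<^sup>+x. (\<integral>\<^sup>+y. f (?T' (x(K := y))) \<partial>lborel) \<partial>lborel_pi K)
     = (\<integral>\<^sup>+x. ennreal (l K K) * (\<integral>\<^sup>+y. f (?T' (x(K := y))) \<partial>lborel) \<partial>lborel_pi K)"
  proof (rule nn_integral_cmult[symmetric])
    have "(\<lambda>(x, y). f (?T' (x(K := y)))) \<in> borel_measurable (lborel_pi K \<Otimes>\<^sub>M lborel)"
      using measurable_compose[OF measurable_compose[OF upd T'] f] by (simp only: split_beta')
    then show "(\<lambda>x. \<integral>\<^sup>+y. f (?T' (x(K := y))) \<partial>lborel) \<in> borel_measurable (lborel_pi K)"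
      by (rule lborel.borel_measurable_nn_integral)
  qed
  also have "\<dots> = (\<integral>\<^sup>+x. g (?T x) \<partial>lborel_pi K)"
    by (intro nn_integral_cong inner)
  also have "ennreal (\<Prod>i<K. l i i) * \<dots> = (\<integral>\<^sup>+x. g x \<partial>lborel_pi K)"
    using Suc.prems by (intro Suc.IH g) auto
  also have "\<dots> = (\<integral>\<^sup>+x. f x \<partial>lborel_pi (Suc K))"
    unfolding g_def ins using f' by (intro lborel_pi.product_nn_integral_insert[symmetric]) auto
  finally show ?case .
qed

lemma nn_integral_lower_factor:
  assumes f: "f \<in> borel_measurable (lborel_pi K)" and L: "lower_factor K L P"
  shows "ennreal (det L) * (\<integral>\<^sup>+x. f (\<lambda>i\<in>{..<K}. (L *\<^sub>v vec K x) $ i) \<partial>lborel_pi K)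
    = (\<integral>\<^sup>+x. f x \<partial>lborel_pi K)"
proof -
  have "(\<lambda>i\<in>{..<K}. (L *\<^sub>v vec K x) $ i) = (\<lambda>i\<in>{..<K}. \<Sum>j\<le>i. L $$ (i,j) * x j)" for x
  proof (rule restrict_ext)
    fix i assume i: "i \<in> {..<K}"
    have "(L *\<^sub>v vec K x) $ i = (\<Sum>j<K. L $$ (i,j) * x j)"
      using L i by (auto simp: lower_factor_def scalar_prod_def atLeast0LessThan)
    also have "\<dots> = (\<Sum>j\<le>i. L $$ (i,j) * x j)"
      using L i by (intro sum.mono_neutral_right) (auto simp: lower_factor_def)
    finally show "(L *\<^sub>v vec K x) $ i = (\<Sum>j\<le>i. L $$ (i,j) * x j)" .
  qed
  then show ?thesis
    using nn_integral_lower_triangular[OF f, of "\<lambda>i j. L $$ (i,j)"] L det_lower_factor(1)[OF L]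
    by (simp add: lower_factor_def)
qed

section \<open>Quadratic forms and Gaussian densities\<close>

definition qform :: "nat \<Rightarrow> real mat \<Rightarrow> (nat \<Rightarrow> real) \<Rightarrow> real" where
  "qform K P x = vec K x \<bullet> (P *\<^sub>v vec K x)"

lemma qform_sum: "P \<in> carrier_mat K K \<Longrightarrow> qform K P x = (\<Sum>i<K. \<Sum>j<K. x i * P $$ (i,j) * x j)"
  by (simp add: qform_def quadratic_form_sum[of _ K])

lemma qform_one: "qform K (1\<^sub>m K) x = (\<Sum>i<K. (x i)\<^sup>2)"
  by (simp add: qform_def self_scalar_prod_real(1)[of _ K])

lemma measurable_qform [measurable]:
  assumes "\<And>i. i < K \<Longrightarrow> (\<lambda>z. x z i) \<in> borel_measurable M" "P \<in> carrier_mat K K"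
  shows "(\<lambda>z. qform K P (x z)) \<in> borel_measurable M"
  unfolding qform_sum[OF assms(2)]
  by (intro borel_measurable_sum borel_measurable_times assms) auto

lemma measurable_qform_lborel_pi [measurable]:
  "P \<in> carrier_mat K K \<Longrightarrow> qform K P \<in> borel_measurable (lborel_pi K)"
  by (rule measurable_qform) (auto intro!: measurable_component_lborel_pi)

lemma qform_lower_factor:
  assumes L: "lower_factor K L P"
  shows "qform K P x = qform K (1\<^sub>m K) (\<lambda>i\<in>{..<K}. (L *\<^sub>v vec K x) $ i)"
proof -
  have LP: "L \<in> carrier_mat K K" "P = transpose_mat L * L" using L by (auto simp: lower_factor_def)
  have "qform K P x = (L *\<^sub>v vec K x) \<bullet> (L *\<^sub>v vec K x)"
    using quadratic_form_congruence[OF LP(1), of "1\<^sub>m K" "vec K x"] LP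
    by (simp add: qform_def right_mult_one_mat[of _ K K])
  also have "L *\<^sub>v vec K x = vec K (\<lambda>i\<in>{..<K}. (L *\<^sub>v vec K x) $ i)"
    using LP by (intro eq_vecI) auto
  finally show ?thesis by (simp add: qform_def)
qed

lemma nn_integral_std_gaussian:
  "(\<integral>\<^sup>+x. ennreal (exp (- qform K (1\<^sub>m K) x / 2)) \<partial>lborel_pi K) = ennreal (sqrt ((2 * pi) ^ K))"
proof -
  have one: "(\<integral>\<^sup>+y. ennreal (exp (- (y::real)\<^sup>2 / 2)) \<partial>lborel) = ennreal (sqrt (2 * pi))"
  proof -
    have "(\<integral>\<^sup>+y. ennreal (exp (- (y::real)\<^sup>2 / 2)) \<partial>lborel)
        = (\<integral>\<^sup>+y. ennreal (sqrt (2 * pi)) * ennreal (std_normal_density y) \<partial>lborel)"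
      by (intro nn_integral_cong) (simp add: std_normal_density_def ennreal_mult''[symmetric])
    also have "\<dots> = ennreal (sqrt (2 * pi)) * (\<integral>\<^sup>+y. ennreal (std_normal_density y) \<partial>lborel)"
      by (intro nn_integral_cmult) simp
    also have "(\<integral>\<^sup>+y. ennreal (std_normal_density y) \<partial>lborel) = 1"
      by (simp add: nn_integral_eq_integral integrable_normal_density)
    finally show ?thesis by simp
  qed
  have "(\<integral>\<^sup>+x. ennreal (exp (- qform K (1\<^sub>m K) x / 2)) \<partial>lborel_pi K)
      = (\<integral>\<^sup>+x. (\<Prod>i<K. ennreal (exp (- (x i)\<^sup>2 / 2))) \<partial>lborel_pi K)"
    by (intro nn_integral_cong)
       (simp add: qform_one prod_ennreal exp_sum[symmetric] sum_negf sum_divide_distrib)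
  also have "\<dots> = (\<Prod>i<K. ennreal (sqrt (2 * pi)))"
    by (subst lborel_pi.product_nn_integral_prod) (simp_all only: one, auto)
  also have "\<dots> = ennreal (sqrt ((2 * pi) ^ K))"
    by (simp only: prod_constant card_lessThan real_sqrt_power) (simp add: ennreal_power)
  finally show ?thesis .
qed

text \<open>Substituting \<open>y = L x\<close> for a triangular factor \<open>L\<close> of
  \<open>P\<close> reduces to the standard Gaussian; the Jacobian \<open>det L\<close> is the square
  root of \<open>det P\<close>.\<close>

lemma nn_integral_gaussian:
  assumes P: "P \<in> PD K"
  shows "(\<integral>\<^sup>+x. ennreal (exp (- qform K P x / 2)) \<partial>lborel_pi K) = ennreal (sqrt ((2 * pi) ^ K / det P))"
proof -
  obtain L where L: "lower_factor K L P" using PD_lower_factor_exists[OF P] by auto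
  note d = det_lower_factor(2,3)[OF L]
  have "ennreal (det L) * (\<integral>\<^sup>+x. ennreal (exp (- qform K P x / 2)) \<partial>lborel_pi K)
      = ennreal (sqrt ((2 * pi) ^ K))"
    unfolding nn_integral_std_gaussian[symmetric] qform_lower_factor[OF L]
    by (rule nn_integral_lower_factor[OF _ L]) measurable
  also have "\<dots> = ennreal (det L) * ennreal (sqrt ((2 * pi) ^ K / det P))"
    using d by (simp add: ennreal_mult''[symmetric] real_sqrt_divide)
  finally show ?thesis using d(1)
    by (subst (asm) ennreal_mult_cancel_left) auto
qed

text \<open>The Gaussian density, parametrised by the precision matrix.\<close>

definition gdens :: "nat \<Rightarrow> real mat \<Rightarrow> (nat \<Rightarrow> real) \<Rightarrow> real" where
  "gdens K P x = sqrt (det P / (2 * pi) ^ K) * exp (- qform K P x / 2)"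

lemma gdens_nonneg: "P \<in> PD K \<Longrightarrow> gdens K P x \<ge> 0"
  using PD_det_pos[of P K] by (simp add: gdens_def)

lemma measurable_gdens [measurable]:
  assumes "\<And>i. i < K \<Longrightarrow> (\<lambda>z. x z i) \<in> borel_measurable M" "P \<in> carrier_mat K K"
  shows "(\<lambda>z. gdens K P (x z)) \<in> borel_measurable M"
  unfolding gdens_def using assms by measurable

lemma measurable_gdens_lborel_pi [measurable]:
  "P \<in> carrier_mat K K \<Longrightarrow> gdens K P \<in> borel_measurable (lborel_pi K)"
  unfolding gdens_def by measurable

lemma nn_integral_gdens:
  assumes P: "P \<in> PD K"
  shows "(\<integral>\<^sup>+x. ennreal (gdens K P x) \<partial>lborel_pi K) = 1"
proof -
  have d: "det P > 0" using PD_det_pos[OF P] .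
  have [measurable]: "P \<in> carrier_mat K K" using PD_carrier[OF P] .
  have "(\<integral>\<^sup>+x. ennreal (gdens K P x) \<partial>lborel_pi K)
     = (\<integral>\<^sup>+x. ennreal (sqrt (det P / (2 * pi) ^ K)) * ennreal (exp (- qform K P x / 2)) \<partial>lborel_pi K)"
    using d by (simp add: gdens_def ennreal_mult')
  also have "\<dots> = ennreal (sqrt (det P / (2 * pi) ^ K)) * ennreal (sqrt ((2 * pi) ^ K / det P))"
    by (subst nn_integral_cmult) (measurable, simp only: nn_integral_gaussian[OF P])
  also have "\<dots> = 1"
    using d by (simp add: ennreal_mult''[symmetric] real_sqrt_mult[symmetric])
  finally show ?thesis .
qed

lemma gaussian_eq_density_gdens:
  assumes "S \<in> PD K"
  shows "gaussian K S = density (lborel_pi K) (\<lambda>x. ennreal (gdens K (inv_mat S) x))"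
proof -
  have "1 / det S / (2 * pi) ^ K = 1 / ((2 * pi) ^ K * det S)" by (simp add: mult.commute)
  then show ?thesis
    unfolding gaussian_def gdens_def qform_def PD_inv_mat(5)[OF assms]
    by (simp only: real_sqrt_divide real_sqrt_one) simp
qed

lemma prob_space_gaussian: "S \<in> PD K \<Longrightarrow> prob_space (gaussian K S)"
proof
  assume S: "S \<in> PD K"
  note P = PD_inv_mat(1)[OF S]
  have [measurable]: "inv_mat S \<in> carrier_mat K K" using PD_carrier[OF P] .
  show "emeasure (gaussian K S) (space (gaussian K S)) = 1"
    unfolding gaussian_eq_density_gdens[OF S]
    by (subst emeasure_density) (auto simp: nn_integral_gdens[OF P] cong: nn_integral_cong)
qed

lemma sets_gaussian [measurable_cong]: "sets (gaussian K S) = sets (lborel_pi K)"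
  by (simp add: gaussian_def)

section \<open>Several samples as one long vector\<close>

definition unflat :: "nat \<Rightarrow> nat \<Rightarrow> (nat \<Rightarrow> real) \<Rightarrow> nat \<Rightarrow> nat \<Rightarrow> real" where
  "unflat n D x = (\<lambda>k\<in>{..<n}. \<lambda>i\<in>{..<D}. x (k * D + i))"

definition flat :: "nat \<Rightarrow> nat \<Rightarrow> (nat \<Rightarrow> nat \<Rightarrow> real) \<Rightarrow> nat \<Rightarrow> real" where
  "flat n D X = (\<lambda>p\<in>{..<n * D}. X (p div D) (p mod D))"

lemma unflat_flat:
  assumes "X \<in> space (\<Pi>\<^sub>M k\<in>{..<n}. lborel_pi D)"
  shows "unflat n D (flat n D X) = X"
proof -
  have "X = (\<lambda>k\<in>{..<n}. \<lambda>i\<in>{..<D}. X k i)"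
    using assms by (auto simp: space_PiM PiE_def extensional_def Pi_def fun_eq_iff restrict_def)
  moreover have "unflat n D (flat n D X) = (\<lambda>k\<in>{..<n}. \<lambda>i\<in>{..<D}. X k i)"
    by (auto simp: unflat_def flat_def pair_index_less fun_eq_iff)
  ultimately show ?thesis by simp
qed

lemma measurable_flat [measurable]:
  "flat n D \<in> measurable (\<Pi>\<^sub>M k\<in>{..<n}. lborel_pi D) (lborel_pi (n * D))"
  unfolding flat_def
proof (rule measurable_restrict)
  fix p assume "p \<in> {..<n * D}"
  then have "p div D < n" "p mod D < D" using div_mod_less[of p n D] by auto
  then have "(\<lambda>X. X (p div D)) \<in> measurable (\<Pi>\<^sub>M k\<in>{..<n}. lborel_pi D) (lborel_pi D)"
    "(\<lambda>x. x (p mod D)) \<in> measurable (lborel_pi D) lborel"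
    by (auto intro!: measurable_component_singleton measurable_component_lborel_pi)
  then show "(\<lambda>X. X (p div D) (p mod D)) \<in> measurable (\<Pi>\<^sub>M k\<in>{..<n}. lborel_pi D) lborel"
    by (rule measurable_compose)
qed

lemma measurable_unflat [measurable]:
  "unflat n D \<in> measurable (lborel_pi (n * D)) (\<Pi>\<^sub>M k\<in>{..<n}. lborel_pi D)"
  unfolding unflat_def
  by (intro measurable_restrict measurable_component_singleton) (auto simp: pair_index_less)

text \<open>It suffices to look at boxes: the preimage of a box is a box of boxes with the same
  sides, regrouped by \<open>div\<close> and \<open>mod\<close>, and the two products of side
  lengths agree.\<close>

lemma distr_flat: "distr (\<Pi>\<^sub>M k\<in>{..<n}. lborel_pi D) (lborel_pi (n * D)) (flat n D) = lborel_pi (n * D)"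
proof (rule lborel_pi.PiM_eqI)
  fix A :: "nat \<Rightarrow> real set" assume A: "\<And>i. i \<in> {..<n * D} \<Longrightarrow> A i \<in> sets lborel"
  interpret D: product_sigma_finite "\<lambda>_::nat. lborel_pi D" by (rule product_sigma_finite_lborel_pi)
  have "emeasure (distr (\<Pi>\<^sub>M k\<in>{..<n}. lborel_pi D) (lborel_pi (n * D)) (flat n D)) (Pi\<^sub>E {..<n * D} A)
      = emeasure (\<Pi>\<^sub>M k\<in>{..<n}. lborel_pi D)
         (flat n D -` Pi\<^sub>E {..<n * D} A \<inter> space (\<Pi>\<^sub>M k\<in>{..<n}. lborel_pi D))"
    using A by (intro emeasure_distr) (auto intro!: sets_PiM_I_finite)
  also have "flat n D -` Pi\<^sub>E {..<n * D} A \<inter> space (\<Pi>\<^sub>M k\<in>{..<n}. lborel_pi D)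
      = (\<Pi>\<^sub>E k\<in>{..<n}. \<Pi>\<^sub>E i\<in>{..<D}. A (k * D + i))" (is "?l = ?r")
  proof (intro equalityI subsetI)
    fix X assume X: "X \<in> ?l"
    have "X k i \<in> A (k * D + i)" if "k < n" "i < D" for k i
    proof -
      have "flat n D X (k * D + i) \<in> A (k * D + i)"
        using X pair_index_less[OF that] by (auto simp: PiE_def)
      then show ?thesis using that pair_index_less[OF that] by (simp add: flat_def)
    qed
    then show "X \<in> ?r" using X by (auto simp: space_PiM PiE_def)
  next
    fix X assume X: "X \<in> ?r"
    have "X (p div D) (p mod D) \<in> A p" if "p < n * D" for p
    proof -
      have "X k i \<in> A (k * D + i)" if "k < n" "i < D" for k i
        using X that by (auto simp: PiE_def Pi_def)
      from this[OF div_mod_less[OF that]] show ?thesis by simp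
    qed
    then show "X \<in> ?l" using X by (auto simp: space_PiM PiE_def flat_def Pi_def)
  qed
  also have "emeasure (\<Pi>\<^sub>M k\<in>{..<n}. lborel_pi D) ?r
     = (\<Prod>k<n. emeasure (lborel_pi D) (\<Pi>\<^sub>E i\<in>{..<D}. A (k * D + i)))"
    using A by (intro D.emeasure_PiM) (auto intro!: sets_PiM_I_finite simp: pair_index_less)
  also have "\<dots> = (\<Prod>k<n. \<Prod>i<D. emeasure lborel (A (k * D + i)))"
    using A by (intro prod.cong refl lborel_pi.emeasure_PiM) (auto simp: pair_index_less)
  also have "\<dots> = (\<Prod>p<n * D. emeasure lborel (A p))"
    by (subst prod_div_mod[symmetric]) simp
  finally show "emeasure (distr (\<Pi>\<^sub>M k\<in>{..<n}. lborel_pi D) (lborel_pi (n * D)) (flat n D)) (Pi\<^sub>E {..<n * D} A)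
    = (\<Prod>p\<in>{..<n * D}. emeasure lborel (A p))" .
qed auto

lemma nn_integral_unflat:
  assumes F: "F \<in> borel_measurable (\<Pi>\<^sub>M k\<in>{..<n}. lborel_pi D)"
  shows "(\<integral>\<^sup>+x. F (unflat n D x) \<partial>lborel_pi (n * D)) = (\<integral>\<^sup>+X. F X \<partial>(\<Pi>\<^sub>M k\<in>{..<n}. lborel_pi D))"
proof -
  have "(\<integral>\<^sup>+x. F (unflat n D x) \<partial>lborel_pi (n * D))
    = (\<integral>\<^sup>+x. F (unflat n D x) \<partial>distr (\<Pi>\<^sub>M k\<in>{..<n}. lborel_pi D) (lborel_pi (n * D)) (flat n D))"
    by (simp add: distr_flat)
  also have "\<dots> = (\<integral>\<^sup>+X. F (unflat n D (flat n D X)) \<partial>(\<Pi>\<^sub>M k\<in>{..<n}. lborel_pi D))"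
    using F by (intro nn_integral_distr) auto
  also have "\<dots> = (\<integral>\<^sup>+X. F X \<partial>(\<Pi>\<^sub>M k\<in>{..<n}. lborel_pi D))"
    by (intro nn_integral_cong) (simp add: unflat_flat)
  finally show ?thesis .
qed

text \<open>The factor \<open>1\<^sub>m n\<close> annihilates every product of coordinates from
  different samples; this is independence of the samples, read off the exponent.\<close>

lemma qform_kronecker_one:
  assumes P: "P \<in> carrier_mat D D"
  shows "qform (n * D) (kronecker (1\<^sub>m n) P) x = (\<Sum>k<n. qform D P (unflat n D x k))"
proof -
  have "qform (n * D) (kronecker (1\<^sub>m n) P) x = (\<Sum>p<n * D. \<Sum>q<n * D.
      x (p div D * D + p mod D) * ((if p div D = q div D then 1 else 0) * P $$ (p mod D, q mod D))
        * x (q div D * D + q mod D))"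
    unfolding qform_sum[OF kronecker_carrier[OF one_carrier_mat P]]
    by (intro sum.cong refl) (use P in \<open>simp add: kronecker_index div_mod_less\<close>)
  also have "\<dots> = (\<Sum>k<n. \<Sum>i<D. \<Sum>l<n. \<Sum>j<D.
      x (k * D + i) * ((if k = l then 1 else 0) * P $$ (i, j)) * x (l * D + j))"
    unfolding sum_div_mod[of "\<lambda>l j. x (_ * D + _) * ((if _ = l then 1 else 0) * P $$ (_, j)) * x (l * D + j)"]
    by (rule sum_div_mod)
  also have "\<dots> = (\<Sum>k<n. \<Sum>i<D. \<Sum>l<n. if l = k then \<Sum>j<D. x (k * D + i) * P $$ (i, j) * x (k * D + j) else 0)"
    by (intro sum.cong refl) (auto intro!: sum.neutral)
  also have "\<dots> = (\<Sum>k<n. \<Sum>i<D. \<Sum>j<D. x (k * D + i) * P $$ (i, j) * x (k * D + j))"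
    by (simp add: sum.delta')
  also have "\<dots> = (\<Sum>k<n. qform D P (unflat n D x k))"
    by (intro sum.cong refl) (simp add: qform_sum[OF P] unflat_def)
  finally show ?thesis .
qed

lemma gdens_kronecker_one:
  assumes P: "P \<in> PD D"
  shows "gdens (n * D) (kronecker (1\<^sub>m n) P) x = (\<Prod>k<n. gdens D P (unflat n D x k))"
proof -
  have "det (kronecker (1\<^sub>m n) P) / (2 * pi) ^ (n * D) = (det P / (2 * pi) ^ D) ^ n"
    unfolding kronecker_PD(2)[OF PD_one P] power_divide power_mult[symmetric] mult.commute[of D n]
    by simp
  then show ?thesis
    unfolding gdens_def qform_kronecker_one[OF PD_carrier[OF P]]
    by (simp add: prod.distrib exp_sum[symmetric] real_sqrt_power sum_negf sum_divide_distrib)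
qed

section \<open>The law of the sample as a density\<close>

lemma sets_sample_law: "sets (sample_law n d1 d2 \<Theta>1 \<Theta>2) = sets (sample_space n d1 d2)"
  "sets (\<Pi>\<^sub>M k\<in>{..<n}. lborel_pi (d1 * d2)) = sets (sample_space n d1 d2)"
  unfolding sample_law_def sample_space_def
  by (intro sets_PiM_cong refl; simp add: sets_gaussian; intro sets_PiM_cong refl; simp)+

lemma space_sample_law: "space (sample_law n d1 d2 \<Theta>1 \<Theta>2) = space (sample_space n d1 d2)"
  "space (\<Pi>\<^sub>M k\<in>{..<n}. lborel_pi (d1 * d2)) = space (sample_space n d1 d2)"
  by (rule sets_eq_imp_space_eq[OF sets_sample_law(1)], rule sets_eq_imp_space_eq[OF sets_sample_law(2)])

lemma prob_space_sample_law:
  assumes "\<Theta>1 \<in> PD d1" "\<Theta>2 \<in> PD d2"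
  shows "prob_space (sample_law n d1 d2 \<Theta>1 \<Theta>2)"
  unfolding sample_law_def
  by (intro prob_space_PiM prob_space_gaussian kronecker_PD PD_inv_mat assms)

text \<open>Turns a product of Gaussian measures into a single Lebesgue integral with a single
  Gaussian density, the form in which mixtures over \<open>\<Theta>2\<close> can be computed. The
  product measure is identified with its density on measurable boxes.\<close>

lemma emeasure_sample_law:
  assumes T1: "\<Theta>1 \<in> PD d1" and T2: "\<Theta>2 \<in> PD d2" and B: "B \<in> sets (sample_space n d1 d2)"
  shows "emeasure (sample_law n d1 d2 \<Theta>1 \<Theta>2) B = (\<integral>\<^sup>+x. indicator B (unflat n (d1 * d2) x) *
    ennreal (gdens (n * (d1 * d2)) (kronecker (1\<^sub>m n) (kronecker \<Theta>1 \<Theta>2)) x) \<partial>lborel_pi (n * (d1 * d2)))"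
proof -
  define D where "D = d1 * d2"
  define P where "P = kronecker \<Theta>1 \<Theta>2"
  define S where "S = kronecker (inv_mat \<Theta>1) (inv_mat \<Theta>2)"
  have P: "P \<in> PD D" using kronecker_PD[OF T1 T2] by (simp add: P_def D_def)
  have S: "S \<in> PD D" using kronecker_PD(1)[OF PD_inv_mat(1)[OF T1] PD_inv_mat(1)[OF T2]]
    by (simp add: S_def D_def)
  have SP: "inv_mat S = P" using kronecker_inv_mat[OF T1 T2] by (simp add: S_def P_def)
  have [measurable]: "P \<in> carrier_mat D D" using PD_carrier[OF P] .
  let ?N = "\<Pi>\<^sub>M k\<in>{..<n}. lborel_pi D"
  let ?g = "\<lambda>X. \<Prod>k<n. ennreal (gdens D P (X k))"
  interpret D: product_sigma_finite "\<lambda>_::nat. lborel_pi D" by (rule product_sigma_finite_lborel_pi)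
  interpret G: prob_space "gaussian D S" by (rule prob_space_gaussian[OF S])
  interpret G: product_sigma_finite "\<lambda>_::nat. gaussian D S" ..
  have gk: "(\<lambda>X. gdens D P (X k)) \<in> borel_measurable ?N" if "k < n" for k
  proof -
    have "(\<lambda>X. X k) \<in> measurable ?N (lborel_pi D)"
      using that by (intro measurable_component_singleton) auto
    from measurable_compose[OF this measurable_gdens_lborel_pi[OF PD_carrier[OF P]]] show ?thesis .
  qed
  have g[measurable]: "?g \<in> borel_measurable ?N"
    using gk by (intro borel_measurable_prod_ennreal) (auto intro!: measurable_compose[OF gk measurable_ennreal])
  have sets_N: "sets ?N = sets (sample_space n d1 d2)" unfolding D_def by (rule sets_sample_law)
  have "density ?N ?g = (\<Pi>\<^sub>M k\<in>{..<n}. gaussian D S)"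
  proof (rule G.PiM_eqI)
    show "sets (density ?N ?g) = sets (\<Pi>\<^sub>M k\<in>{..<n}. gaussian D S)"
      by (simp, intro sets_PiM_cong refl) (simp add: sets_gaussian)
    fix A :: "nat \<Rightarrow> (nat \<Rightarrow> real) set" assume "\<And>k. k \<in> {..<n} \<Longrightarrow> A k \<in> sets (gaussian D S)"
    then have A: "\<And>k. k < n \<Longrightarrow> A k \<in> sets (lborel_pi D)" by (simp add: sets_gaussian)
    have "emeasure (density ?N ?g) (Pi\<^sub>E {..<n} A) = (\<integral>\<^sup>+X. ?g X * indicator (Pi\<^sub>E {..<n} A) X \<partial>?N)"
      using A by (intro emeasure_density g sets_PiM_I_finite) auto
    also have "\<dots> = (\<integral>\<^sup>+X. (\<Prod>k<n. ennreal (gdens D P (X k)) * indicator (A k) (X k)) \<partial>?N)"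
    proof (rule nn_integral_cong)
      fix X assume X: "X \<in> space ?N"
      have "indicator (Pi\<^sub>E {..<n} A) X = (\<Prod>k<n. indicator (A k) (X k) :: ennreal)"
      proof (cases "\<forall>k<n. X k \<in> A k")
        case True
        then show ?thesis using X by (auto simp: space_PiM PiE_def)
      next
        case False
        then obtain k where k: "k < n" "X k \<notin> A k" by auto
        then have "(\<Prod>k<n. indicator (A k) (X k) :: ennreal) = 0"
          by (intro prod_zero) (auto intro!: bexI[of _ k])
        moreover have "X \<notin> Pi\<^sub>E {..<n} A" using k by (auto dest: PiE_mem)
        ultimately show ?thesis by simp
      qed
      then show "?g X * indicator (Pi\<^sub>E {..<n} A) X = (\<Prod>k<n. ennreal (gdens D P (X k)) * indicator (A k) (X k))"
        by (simp add: prod.distrib)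
    qed
    also have "\<dots> = (\<Prod>k<n. \<integral>\<^sup>+x. ennreal (gdens D P x) * indicator (A k) x \<partial>lborel_pi D)"
      using A by (intro D.product_nn_integral_prod) auto
    also have "\<dots> = (\<Prod>k<n. emeasure (gaussian D S) (A k))"
      unfolding gaussian_eq_density_gdens[OF S] SP using A
      by (intro prod.cong refl emeasure_density[symmetric]) auto
    finally show "emeasure (density ?N ?g) (Pi\<^sub>E {..<n} A) = (\<Prod>k\<in>{..<n}. emeasure (gaussian D S) (A k))" .
  qed simp
  then have "emeasure (sample_law n d1 d2 \<Theta>1 \<Theta>2) B = emeasure (density ?N ?g) B"
    by (simp add: sample_law_def S_def D_def)
  also have "\<dots> = (\<integral>\<^sup>+X. ?g X * indicator B X \<partial>?N)"
    using B by (intro emeasure_density g) (simp add: sets_N)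
  also have "\<dots> = (\<integral>\<^sup>+x. ?g (unflat n D x) * indicator B (unflat n D x) \<partial>lborel_pi (n * D))"
    using B by (intro nn_integral_unflat[symmetric] borel_measurable_times_ennreal g
        borel_measurable_indicator) (simp add: sets_N)
  also have "\<dots> = (\<integral>\<^sup>+x. indicator B (unflat n D x) * ennreal (gdens (n * D) (kronecker (1\<^sub>m n) P) x) \<partial>lborel_pi (n * D))"
    unfolding gdens_kronecker_one[OF P]
    by (intro nn_integral_cong) (simp add: prod_ennreal gdens_nonneg[OF P] mult.commute)
  finally show ?thesis by (simp add: D_def P_def)
qed

section \<open>Random square matrices\<close>

lemma measurable_det [measurable]:
  assumes "\<And>i j. i < p \<Longrightarrow> j < p \<Longrightarrow> (\<lambda>z. f z i j) \<in> borel_measurable M"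
  shows "(\<lambda>z. det (mat p p (\<lambda>(i,j). f z i j)) :: real) \<in> borel_measurable M"
proof -
  have "det (mat p p (\<lambda>(i,j). f z i j))
      = (\<Sum>\<pi> \<in> {\<pi>. \<pi> permutes {0..<p}}. signof \<pi> * (\<Prod>i=0..<p. f z i (\<pi> i)))" for z
  proof -
    have "\<pi> i < p" if "\<pi> permutes {0..<p}" "i < p" for \<pi> i
      using permutes_in_image[OF that(1), of i] that(2) by simp
    then show ?thesis by (subst det_def'[of _ p]) (auto intro!: sum.cong prod.cong)
  qed
  moreover have "\<pi> i < p" if "\<pi> permutes {0..<p}" "i \<in> {0..<p}" for \<pi> i
    using permutes_in_image[OF that(1), of i] that(2) by simp
  ultimately show ?thesis
    by (simp only:) (intro borel_measurable_sum borel_measurable_times borel_measurable_prod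
        borel_measurable_const assms; auto)
qed

text \<open>Filled column by column, so that multiplying the matrix by \<open>L\<close> from the
  left is the action of \<open>1 \<otimes> L\<close> on the vector \<open>w\<close>. Under a
  Gaussian with precision \<open>1 \<otimes> Q\<close> the columns are then independent.\<close>

definition sqmat :: "nat \<Rightarrow> (nat \<Rightarrow> real) \<Rightarrow> real mat" where
  "sqmat p w = mat p p (\<lambda>(i,l). w (l * p + i))"

lemma sqmat_carrier [simp]: "sqmat p w \<in> carrier_mat p p"
  by (simp add: sqmat_def)

lemma measurable_det_sqmat [measurable]:
  assumes "\<And>i. i < p * p \<Longrightarrow> (\<lambda>z. w z i) \<in> borel_measurable M"
  shows "(\<lambda>z. det (sqmat p (w z))) \<in> borel_measurable M"
  unfolding sqmat_def by (rule measurable_det) (auto intro!: assms pair_index_less)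

lemma distr_lborel_pi_translate:
  "distr (lborel_pi K) (lborel_pi K) (\<lambda>x. \<lambda>i\<in>{..<K}. c i + x i) = lborel_pi K"
proof (rule lborel_pi.PiM_eqI)
  fix A :: "nat \<Rightarrow> real set" assume A: "\<And>i. i \<in> {..<K} \<Longrightarrow> A i \<in> sets lborel"
  let ?T = "\<lambda>x. \<lambda>i\<in>{..<K}. c i + x i"
  have T: "?T \<in> measurable (lborel_pi K) (lborel_pi K)"
    by (intro measurable_restrict) (auto intro!: measurable_component_lborel_pi borel_measurable_add)
  have m: "(\<lambda>y. c i + y) \<in> measurable lborel borel" for i by simp
  have "emeasure (distr (lborel_pi K) (lborel_pi K) ?T) (Pi\<^sub>E {..<K} A)
      = emeasure (lborel_pi K) (?T -` Pi\<^sub>E {..<K} A \<inter> space (lborel_pi K))"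
    using A T by (intro emeasure_distr) (auto intro!: sets_PiM_I_finite)
  also have "?T -` Pi\<^sub>E {..<K} A \<inter> space (lborel_pi K) = (\<Pi>\<^sub>E i\<in>{..<K}. (\<lambda>y. c i + y) -` A i \<inter> space lborel)"
    by (auto simp: space_PiM PiE_def Pi_def)
  also have "emeasure (lborel_pi K) \<dots> = (\<Prod>i<K. emeasure lborel ((\<lambda>y. c i + y) -` A i \<inter> space lborel))"
  proof (rule lborel_pi.emeasure_PiM)
    fix i assume "i \<in> {..<K}"
    then have "A i \<in> sets borel" using A by simp
    then show "(\<lambda>y. c i + y) -` A i \<inter> space lborel \<in> sets lborel"
      using measurable_sets[OF m] by simp
  qed simp
  also have "\<dots> = (\<Prod>i<K. emeasure lborel (A i))"
  proof (rule prod.cong[OF refl])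
    fix i assume "i \<in> {..<K}"
    then have "A i \<in> sets borel" using A by simp
    then have "emeasure lborel ((\<lambda>y. c i + y) -` A i \<inter> space lborel) = emeasure (distr lborel borel ((+) (c i))) (A i)"
      using m by (intro emeasure_distr[symmetric]) auto
    then show "emeasure lborel ((\<lambda>y. c i + y) -` A i \<inter> space lborel) = emeasure lborel (A i)"
      by (simp only: lborel_distr_plus)
  qed
  finally show "emeasure (distr (lborel_pi K) (lborel_pi K) ?T) (Pi\<^sub>E {..<K} A) = (\<Prod>i\<in>{..<K}. emeasure lborel (A i))" .
qed auto

text \<open>Averaging over the translates \<open>W + t 1\<close>, \<open>t \<in> [0,1]\<close>: for each \<open>W\<close> only the finitely many
  roots \<open>t\<close> of a characteristic polynomial give a singular matrix.\<close>

lemma AE_det_sqmat_nonzero: "AE w in lborel_pi (p * p). det (sqmat p w) \<noteq> 0"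
proof -
  define K where "K = p * p"
  define e where "e i = (if i div p = i mod p then 1 else 0 :: real)" for i
  define T where "T t w = (\<lambda>i\<in>{..<K}. t * e i + w i)" for t and w :: "nat \<Rightarrow> real"
  define S where "S = {w \<in> space (lborel_pi K). det (sqmat p w) = 0}"
  have mdet: "(\<lambda>w. det (sqmat p w)) \<in> borel_measurable (lborel_pi K)"
    by (rule measurable_det_sqmat) (auto simp: K_def intro!: measurable_component_lborel_pi)
  have S[measurable]: "S \<in> sets (lborel_pi K)"
    unfolding S_def using mdet by measurable
  have Tm: "(\<lambda>(t, w). T t w) \<in> measurable (lborel \<Otimes>\<^sub>M lborel_pi K) (lborel_pi K)"
    unfolding T_def split_beta'
    by (intro measurable_restrict) (auto intro!: borel_measurable_add borel_measurable_times
        measurable_compose[OF measurable_snd measurable_component_lborel_pi])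
  have Tm1: "T t \<in> measurable (lborel_pi K) (lborel_pi K)" for t
    unfolding T_def
    by (intro measurable_restrict) (auto intro!: measurable_component_lborel_pi borel_measurable_add)
  have trans: "(\<integral>\<^sup>+w. indicator S (T t w) \<partial>lborel_pi K) = emeasure (lborel_pi K) S" for t
  proof -
    have "(\<integral>\<^sup>+w. indicator S (T t w) \<partial>lborel_pi K) = (\<integral>\<^sup>+w. indicator S w \<partial>distr (lborel_pi K) (lborel_pi K) (T t))"
      by (subst nn_integral_distr[OF Tm1]) auto
    also have "distr (lborel_pi K) (lborel_pi K) (T t) = lborel_pi K"
      unfolding T_def by (rule distr_lborel_pi_translate)
    finally show ?thesis by simp
  qed
  have finite_t: "(\<integral>\<^sup>+t. indicator {0..1} t * indicator S (T t w) \<partial>lborel) = 0" for w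
  proof -
    define F where "F = {t. det (sqmat p (T t w)) = 0}"
    have "sqmat p (T t w) = char_matrix (sqmat p w) (- t)" for t
    proof (rule eq_matI)
      fix i j assume "i < dim_row (char_matrix (sqmat p w) (- t))" "j < dim_col (char_matrix (sqmat p w) (- t))"
      then have "i < p" "j < p" by (auto simp: char_matrix_def sqmat_def)
      then show "sqmat p (T t w) $$ (i,j) = char_matrix (sqmat p w) (- t) $$ (i,j)"
        using pair_index_less[of j p i p]
        by (auto simp: char_matrix_def sqmat_def T_def e_def K_def)
    qed (auto simp: char_matrix_def sqmat_def)
    then have "F = {t. poly (char_poly (sqmat p w)) (- t) = 0}"
      unfolding F_def using eigenvalue_det[OF sqmat_carrier] eigenvalue_root_char_poly[OF sqmat_carrier]
      by simp
    also have "\<dots> = uminus ` {t. poly (char_poly (sqmat p w)) t = 0}"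
      by (auto intro: image_eqI[of _ _ "- _"])
    also have "finite \<dots>"
      using degree_monic_char_poly[OF sqmat_carrier[of p w]]
      by (intro finite_imageI poly_roots_finite) auto
    finally have "finite F" .
    then have "AE t in lborel. t \<notin> F"
      by (intro AE_not_in finite_imp_null_set_lborel)
    then have "(\<integral>\<^sup>+t. indicator {0..1} t * indicator S (T t w) \<partial>lborel) = (\<integral>\<^sup>+t. 0 \<partial>(lborel :: real measure))"
      by (intro nn_integral_cong_AE) (auto simp: S_def F_def indicator_def)
    then show ?thesis by simp
  qed
  interpret lK: sigma_finite_measure "lborel_pi K" by (rule sigma_finite_lborel_pi)
  interpret pair_sigma_finite "lborel :: real measure" "lborel_pi K" ..
  have "emeasure (lborel_pi K) S = (\<integral>\<^sup>+t. indicator {0..1::real} t * emeasure (lborel_pi K) S \<partial>lborel)"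
    by (subst nn_integral_multc) auto
  also have "\<dots> = (\<integral>\<^sup>+t. (\<integral>\<^sup>+w. indicator {0..1} t * indicator S (T t w) \<partial>lborel_pi K) \<partial>lborel)"
  proof (rule nn_integral_cong)
    fix t :: real
    have "(\<lambda>w. indicator S (T t w) :: ennreal) \<in> borel_measurable (lborel_pi K)"
      by (rule measurable_compose[OF Tm1]) simp
    then show "indicator {0..1} t * emeasure (lborel_pi K) S
        = (\<integral>\<^sup>+w. indicator {0..1} t * indicator S (T t w) \<partial>lborel_pi K)"
      by (simp add: nn_integral_cmult trans)
  qed
  also have "\<dots> = (\<integral>\<^sup>+w. (\<integral>\<^sup>+t. indicator {0..1} t * indicator S (T t w) \<partial>lborel) \<partial>lborel_pi K)"
  proof (rule Fubini'[symmetric])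
    have "(\<lambda>z. indicator S (T (fst z) (snd z)) :: ennreal) \<in> borel_measurable (lborel \<Otimes>\<^sub>M lborel_pi K)"
      by (rule measurable_compose[OF Tm[unfolded split_beta'] borel_measurable_indicator[OF S]])
    then show "(\<lambda>(t, w). indicator {0..1} t * indicator S (T t w) :: ennreal) \<in> borel_measurable (lborel \<Otimes>\<^sub>M lborel_pi K)"
      unfolding split_beta'
      by (intro borel_measurable_times_ennreal measurable_compose[OF measurable_fst] borel_measurable_indicator) auto
  qed
  also have "\<dots> = 0" by (simp add: finite_t)
  finally have "S \<in> null_sets (lborel_pi K)" by (auto simp: null_sets_def)
  then have "AE w in lborel_pi K. w \<notin> S" by (rule AE_not_in)
  then show ?thesis unfolding K_def[symmetric]
    by (rule AE_mp) (auto intro!: AE_I2 simp: S_def)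
qed

text \<open>For \<open>Q = 1\<close> this is, up to normalisation, an absolute moment of the
  determinant of a standard Gaussian matrix. Its value is never computed; only its dependence on
  \<open>Q\<close> matters.\<close>

definition det_gauss_integral :: "nat \<Rightarrow> nat \<Rightarrow> real mat \<Rightarrow> ennreal" where
  "det_gauss_integral p a Q = (\<integral>\<^sup>+w. ennreal (\<bar>det (sqmat p w)\<bar> ^ a *
     exp (- qform (p * p) (kronecker (1\<^sub>m p) Q) w / 2)) \<partial>lborel_pi (p * p))"

text \<open>Replace \<open>W\<close> by \<open>L W\<close> where \<open>Q = L^T L\<close>: each of
  the \<open>p\<close> columns contributes a Jacobian factor \<open>det L\<close>, and the
  determinant in the integrand contributes \<open>a\<close> more.\<close>

lemma det_gauss_integral_scaling:
  assumes Q: "Q \<in> PD p"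
  shows "ennreal (sqrt (det Q) ^ (p + a)) * det_gauss_integral p a Q = det_gauss_integral p a (1\<^sub>m p)"
proof -
  obtain L where L: "lower_factor p L Q" using PD_lower_factor_exists[OF Q] by auto
  have LC: "L \<in> carrier_mat p p" using L by (simp add: lower_factor_def)
  have "lower_factor p (1\<^sub>m p) (1\<^sub>m p)" by (auto simp: lower_factor_def)
  note KL = kronecker_lower_factor[OF this L]
  note d = det_lower_factor(2,3)[OF L]
  define f where "f w = ennreal (\<bar>det (sqmat p w)\<bar> ^ a * exp (- qform (p * p) (1\<^sub>m (p * p)) w / 2))" for w
  have "f \<in> borel_measurable (lborel_pi (p * p))"
    unfolding f_def
    by (intro measurable_compose[OF _ measurable_ennreal] borel_measurable_times borel_measurable_power
      borel_measurable_abs measurable_det_sqmat measurable_component_lborel_pi) measurable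
  note int = nn_integral_lower_factor[OF this KL]
  have detK: "det (kronecker (1\<^sub>m p) L) = det L ^ p"
  proof (rule power2_eq_imp_eq)
    show "(det (kronecker (1\<^sub>m p) L))\<^sup>2 = (det L ^ p)\<^sup>2"
      using det_lower_factor(3)[OF KL] kronecker_PD(2)[OF PD_one Q, of p] d(2)
      by (simp add: power_mult[symmetric] mult.commute)
  qed (use d det_lower_factor(2)[OF KL] in auto)
  have fT: "f (\<lambda>i\<in>{..<p * p}. (kronecker (1\<^sub>m p) L *\<^sub>v vec (p * p) w) $ i)
     = ennreal (det L ^ a) * ennreal (\<bar>det (sqmat p w)\<bar> ^ a * exp (- qform (p * p) (kronecker (1\<^sub>m p) Q) w / 2))"
    (is "f ?Tw = _") for w
  proof -
    have "sqmat p ?Tw = L * sqmat p w"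
    proof (rule eq_matI)
      fix i l assume "i < dim_row (L * sqmat p w)" "l < dim_col (L * sqmat p w)"
      then have il: "i < p" "l < p" using LC by (auto simp: sqmat_def)
      note li = pair_index_less[OF il(2,1)]
      have "sqmat p ?Tw $$ (i,l) = (\<Sum>k<p * p. (if l = k div p then 1 else 0) * L $$ (i, k mod p) * w (k div p * p + k mod p))"
        using il li LC div_mod_less[of _ p p]
        by (simp add: sqmat_def scalar_prod_def atLeast0LessThan kronecker_index)
      also have "\<dots> = (\<Sum>l'<p. \<Sum>k<p. (if l = l' then 1 else 0) * L $$ (i, k) * w (l' * p + k))"
        by (rule sum_div_mod)
      also have "\<dots> = (\<Sum>l'<p. if l' = l then \<Sum>k<p. L $$ (i, k) * w (l * p + k) else 0)"
        by (intro sum.cong) auto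
      also have "\<dots> = (L * sqmat p w) $$ (i,l)"
        using il LC by (simp add: sqmat_def scalar_prod_def atLeast0LessThan)
      finally show "sqmat p ?Tw $$ (i,l) = (L * sqmat p w) $$ (i,l)" .
    qed (use LC in \<open>auto simp: sqmat_def\<close>)
    then have "\<bar>det (sqmat p ?Tw)\<bar> ^ a = det L ^ a * \<bar>det (sqmat p w)\<bar> ^ a"
      using LC d(1) by (simp add: det_mult[of _ p] abs_mult power_mult_distrib)
    then show ?thesis
      unfolding f_def qform_lower_factor[OF KL, symmetric] using d(1)
      by (simp add: ennreal_mult'[symmetric] mult.assoc)
  qed
  have "det_gauss_integral p a (1\<^sub>m p) = (\<integral>\<^sup>+w. f w \<partial>lborel_pi (p * p))"
    by (simp add: det_gauss_integral_def f_def kronecker_one)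
  also have "\<dots> = ennreal (det L ^ p) * (\<integral>\<^sup>+w. ennreal (det L ^ a) * ennreal (\<bar>det (sqmat p w)\<bar> ^ a *
      exp (- qform (p * p) (kronecker (1\<^sub>m p) Q) w / 2)) \<partial>lborel_pi (p * p))"
    unfolding int[symmetric] detK fT ..
  also have "\<dots> = ennreal (det L ^ p) * (ennreal (det L ^ a) * det_gauss_integral p a Q)"
    unfolding det_gauss_integral_def using PD_carrier[OF Q]
    by (subst nn_integral_cmult)
       (auto intro!: measurable_compose[OF _ measurable_ennreal] borel_measurable_times borel_measurable_power
      borel_measurable_abs measurable_det_sqmat measurable_component_lborel_pi
      measurable_compose[OF measurable_qform_lborel_pi] kronecker_carrier)
  also have "\<dots> = ennreal (sqrt (det Q) ^ (p + a)) * det_gauss_integral p a Q"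
    using d by (simp add: mult.assoc[symmetric] ennreal_mult'[symmetric] power_add)
  finally show ?thesis ..
qed

text \<open>Both sides come from the block matrix \<open>M\<close> with rows
  \<open>(B^-1, - X)\<close> and \<open>(X^T, 1)\<close>: clearing the lower left block by column
  operations exposes the determinant of size \<open>N\<close>, clearing it by row operations the one
  of size \<open>m\<close>.\<close>

lemma det_sylvester:
  assumes B: "B \<in> PD N" and X: "X \<in> carrier_mat N m"
  shows "det (1\<^sub>m m + transpose_mat X * B * X) = det B * det (inv_mat B + X * transpose_mat X)"
proof -
  note BC = PD_carrier[OF B] and I = PD_inv_mat[OF B]
  have IC: "inv_mat B \<in> carrier_mat N N" using PD_carrier[OF I(1)] .
  let ?T = "transpose_mat X"
  have T: "?T \<in> carrier_mat m N" "- X \<in> carrier_mat N m" "- ?T \<in> carrier_mat m N" using X by auto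
  define M where "M = four_block_mat (inv_mat B) (- X) ?T (1\<^sub>m m)"
  have MC: "M \<in> carrier_mat (N + m) (N + m)" unfolding M_def using IC by auto
  have TB: "?T * B \<in> carrier_mat m N" using T BC by auto
  have TBX: "?T * B * X \<in> carrier_mat m m" using TB X by auto
  have "M * four_block_mat (1\<^sub>m N) (0\<^sub>m N m) (- ?T) (1\<^sub>m m)
      = four_block_mat (inv_mat B + X * ?T) (- X) (0\<^sub>m m N) (1\<^sub>m m)"
    unfolding M_def using IC T X
    by (subst mult_four_block_mat[of _ N N _ m _ m _ _ N _ m])
       (auto intro!: cong_four_block_mat eq_matI simp: scalar_prod_def sum_negf)
  moreover have "det (four_block_mat (1\<^sub>m N) (0\<^sub>m N m) (- ?T) (1\<^sub>m m)) = 1"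
    using T by (subst det_four_block_mat_upper_right_zero[of _ N _ m]) auto
  moreover have "det (four_block_mat (inv_mat B + X * ?T) (- X) (0\<^sub>m m N) (1\<^sub>m m)) = det (inv_mat B + X * ?T)"
    using IC T X by (subst det_four_block_mat_lower_left_zero[of _ N _ m]) auto
  ultimately have 1: "det M = det (inv_mat B + X * ?T)"
    using det_mult[OF MC, of "four_block_mat (1\<^sub>m N) (0\<^sub>m N m) (- ?T) (1\<^sub>m m)"] by auto
  have TBI: "(- (?T * B)) * inv_mat B = - ?T"
  proof -
    have "(?T * B) * inv_mat B = ?T" using T BC IC I by (simp add: assoc_mult_mat[of _ m N _ N _ N])
    moreover have "(- (?T * B)) * inv_mat B = - (?T * B * inv_mat B)"
      using TB IC by (intro eq_matI) (auto simp: scalar_prod_def sum_negf)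
    ultimately show ?thesis by simp
  qed
  have TBmX: "(- (?T * B)) * (- X) = ?T * B * X"
    using TB X by (intro eq_matI) (auto simp: scalar_prod_def sum_negf)
  have "four_block_mat (1\<^sub>m N) (0\<^sub>m N m) (- (?T * B)) (1\<^sub>m m) * M
      = four_block_mat (inv_mat B) (- X) (0\<^sub>m m N) (1\<^sub>m m + ?T * B * X)"
    unfolding M_def using IC T X TB TBX
    by (subst mult_four_block_mat[of _ N N _ m _ m _ _ N _ m])
       (auto intro!: cong_four_block_mat simp: TBI TBmX uminus_l_inv_mat[of _ m N] comm_add_mat[of _ m m])
  moreover have "det (four_block_mat (1\<^sub>m N) (0\<^sub>m N m) (- (?T * B)) (1\<^sub>m m)) = 1"
    using TB by (subst det_four_block_mat_upper_right_zero[of _ N _ m]) auto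
  moreover have "det (four_block_mat (inv_mat B) (- X) (0\<^sub>m m N) (1\<^sub>m m + ?T * B * X))
      = det (inv_mat B) * det (1\<^sub>m m + ?T * B * X)"
    using IC T TBX by (subst det_four_block_mat_lower_left_zero[of _ N _ m]) auto
  ultimately have 2: "det M = det (inv_mat B) * det (1\<^sub>m m + ?T * B * X)"
    using det_mult[of "four_block_mat (1\<^sub>m N) (0\<^sub>m N m) (- (?T * B)) (1\<^sub>m m)" "N + m" M] MC by auto
  show ?thesis using 1 2 I(5) PD_det_pos[OF B] by (simp add: field_simps)
qed

lemma PD_add_congruence:
  assumes A: "A \<in> PD m" and M: "M \<in> PD N" and X: "X \<in> carrier_mat N m"
  shows "A + transpose_mat X * M * X \<in> PD m"
proof -
  note c = PD_carrier[OF A] PD_carrier[OF M] X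
  have C: "transpose_mat X * M * X \<in> carrier_mat m m" using c by auto
  have "transpose_mat (transpose_mat X * M * X) = transpose_mat X * M * X"
    using c PD_transpose[OF M]
    by (simp add: transpose_mult[of _ m N _ m] transpose_mult[of _ N N _ m] assoc_mult_mat[of _ m N _ N _ m])
  then have "transpose_mat (A + transpose_mat X * M * X) = A + transpose_mat X * M * X"
    using c C PD_transpose[OF A] by (simp add: transpose_add[of _ m m])
  moreover have "v \<bullet> ((A + transpose_mat X * M * X) *\<^sub>v v) > 0" if v: "v \<in> carrier_vec m" "v \<noteq> 0\<^sub>v m" for v
  proof -
    have Xv: "X *\<^sub>v v \<in> carrier_vec N" using X v by auto
    have "v \<bullet> ((A + transpose_mat X * M * X) *\<^sub>v v) = v \<bullet> (A *\<^sub>v v) + v \<bullet> ((transpose_mat X * M * X) *\<^sub>v v)"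
      unfolding add_mult_distrib_mat_vec[OF c(1) C v(1)]
      using c(1) C v by (intro scalar_prod_add_distrib[of _ m]) (auto intro: mult_mat_vec_carrier)
    moreover have "v \<bullet> (A *\<^sub>v v) > 0" using A v by (auto simp: PD_def)
    moreover have "v \<bullet> ((transpose_mat X * M * X) *\<^sub>v v) \<ge> 0"
      unfolding quadratic_form_congruence[OF X PD_carrier[OF M] v(1)]
      using M Xv by (cases "X *\<^sub>v v = 0\<^sub>v N") (auto simp: PD_def less_imp_le)
    ultimately show ?thesis by simp
  qed
  ultimately show ?thesis using c C by (auto simp: PD_def)
qed

section \<open>Wishart mixtures over the second factor\<close>

text \<open>The expanded exponent runs over two row indices, two column indices and the index
  \<open>l\<close> of a column of the mixing matrix. With \<open>l\<close> outermost it becomes a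
  sum of quadratic forms, in the column indices for \<open>W\<close> and in the row indices for
  \<open>V\<close>.\<close>

lemma sum_rotate:
  fixes f :: "'a \<Rightarrow> 'b \<Rightarrow> 'c \<Rightarrow> 'd \<Rightarrow> 'e \<Rightarrow> real"
  shows "(\<Sum>r\<in>R. \<Sum>j\<in>J. \<Sum>r'\<in>R'. \<Sum>j'\<in>J'. \<Sum>l\<in>L. f r j r' j' l)
      = (\<Sum>l\<in>L. \<Sum>j\<in>J. \<Sum>j'\<in>J'. \<Sum>r\<in>R. \<Sum>r'\<in>R'. f r j r' j' l)"
    "(\<Sum>r\<in>R. \<Sum>j\<in>J. \<Sum>r'\<in>R'. \<Sum>j'\<in>J'. \<Sum>l\<in>L. f r j r' j' l)
      = (\<Sum>l\<in>L. \<Sum>r\<in>R. \<Sum>r'\<in>R'. \<Sum>j\<in>J. \<Sum>j'\<in>J'. f r j r' j' l)"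
  by (simp only: sum.cartesian_product split_beta',
      rule sum.reindex_bij_witness[of _ "\<lambda>(l,j,j',r,r'). (r,j,r',j',l)" "\<lambda>(r,j,r',j',l). (l,j,j',r,r')"]; auto)
     (simp only: sum.cartesian_product split_beta',
      rule sum.reindex_bij_witness[of _ "\<lambda>(l,r,r',j,j'). (r,j,r',j',l)" "\<lambda>(r,j,r',j',l). (l,r,r',j,j')"]; auto)

lemma qform_kronecker:
  assumes A: "A \<in> carrier_mat N N" and C: "C \<in> carrier_mat m m"
  shows "qform (N * m) (kronecker A C) x
    = (\<Sum>r<N. \<Sum>j<m. \<Sum>r'<N. \<Sum>j'<m. x (r * m + j) * (A $$ (r,r') * C $$ (j,j')) * x (r' * m + j'))"
proof -
  have "qform (N * m) (kronecker A C) x = (\<Sum>p<N * m. \<Sum>q<N * m.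
      x (p div m * m + p mod m) * (A $$ (p div m, q div m) * C $$ (p mod m, q mod m)) * x (q div m * m + q mod m))"
    unfolding qform_sum[OF kronecker_carrier[OF A C]]
    by (intro sum.cong refl) (use A C in \<open>simp add: kronecker_index div_mod_less\<close>)
  also have "\<dots> = (\<Sum>r<N. \<Sum>j<m. \<Sum>r'<N. \<Sum>j'<m.
      x (r * m + j) * (A $$ (r,r') * C $$ (j,j')) * x (r' * m + j'))"
    unfolding sum_div_mod[of "\<lambda>r' j'. x (_ * m + _) * (A $$ (_, r') * C $$ (_, j')) * x (r' * m + j')"]
    by (rule sum_div_mod)
  finally show ?thesis .
qed

lemma qform_add:
  "P \<in> carrier_mat K K \<Longrightarrow> R \<in> carrier_mat K K \<Longrightarrow> qform K (P + R) x = qform K P x + qform K R x"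
  by (simp add: qform_sum sum.distrib[symmetric] algebra_simps)

lemma measurable_qform_kronecker:
  assumes "\<And>i. i < N * m \<Longrightarrow> (\<lambda>z. x z i) \<in> borel_measurable M"
    "\<And>z. A z \<in> carrier_mat N N" "\<And>z. C z \<in> carrier_mat m m"
    "\<And>r r'. r < N \<Longrightarrow> r' < N \<Longrightarrow> (\<lambda>z. A z $$ (r,r')) \<in> borel_measurable M"
    "\<And>j j'. j < m \<Longrightarrow> j' < m \<Longrightarrow> (\<lambda>z. C z $$ (j,j')) \<in> borel_measurable M"
  shows "(\<lambda>z. qform (N * m) (kronecker (A z) (C z)) (x z)) \<in> borel_measurable M"
  unfolding qform_kronecker[OF assms(2,3)]
  by (intro borel_measurable_sum borel_measurable_times assms) (auto simp: pair_index_less)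

lemma sqmat_gram_index:
  "i < p \<Longrightarrow> j < p \<Longrightarrow> (sqmat p w * transpose_mat (sqmat p w)) $$ (i,j) = (\<Sum>l<p. w (l * p + i) * w (l * p + j))"
  by (simp add: sqmat_def scalar_prod_def atLeast0LessThan)

lemma sqmat_gram_carrier [simp]: "sqmat p w * transpose_mat (sqmat p w) \<in> carrier_mat p p"
  by (rule mult_carrier_mat[of _ p p]) (auto simp: sqmat_def)

lemma sqmat_gram_PD:
  assumes "det (sqmat p w) \<noteq> 0"
  shows "sqmat p w * transpose_mat (sqmat p w) \<in> PD p"
    "det (sqmat p w * transpose_mat (sqmat p w)) = (det (sqmat p w))\<^sup>2"
proof -
  have "transpose_mat (sqmat p w) \<in> carrier_mat p p" by simp
  from PD_gram[OF this] show "sqmat p w * transpose_mat (sqmat p w) \<in> PD p"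
    using assms by (simp add: det_transpose[of _ p])
  show "det (sqmat p w * transpose_mat (sqmat p w)) = (det (sqmat p w))\<^sup>2"
    by (simp add: det_mult[of _ p] det_transpose[of _ p] power2_eq_square)
qed

text \<open>The data as a matrix, filled row by row to match the index order of
  \<open>kronecker\<close>.\<close>

definition xmat :: "nat \<Rightarrow> nat \<Rightarrow> (nat \<Rightarrow> real) \<Rightarrow> real mat" where
  "xmat N m x = mat N m (\<lambda>(r,j). x (r * m + j))"

lemma xmat_carrier [simp]: "xmat N m x \<in> carrier_mat N m"
  by (simp add: xmat_def)

text \<open>The data exponent is the trace of \<open>W^T X^T B X W\<close>, hence as much a
  quadratic form in \<open>W\<close> as in \<open>X\<close>. Together with the prior it makes the
  columns of \<open>W\<close> Gaussian with precision \<open>1 + X^T B X\<close>.\<close>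

lemma qform_mixture_right:
  assumes B: "B \<in> carrier_mat N N"
  shows "qform (N * m) (kronecker B (sqmat m w * transpose_mat (sqmat m w))) x + qform (m * m) (1\<^sub>m (m * m)) w
    = qform (m * m) (kronecker (1\<^sub>m m) (1\<^sub>m m + transpose_mat (xmat N m x) * B * xmat N m x)) w"
proof -
  define C where "C = transpose_mat (xmat N m x) * B * xmat N m x"
  have C: "C \<in> carrier_mat m m" unfolding C_def using B by (auto simp: xmat_def)
  have Cij: "C $$ (j,j') = (\<Sum>r<N. \<Sum>r'<N. x (r * m + j) * B $$ (r,r') * x (r' * m + j'))"
    if "j < m" "j' < m" for j j'
  proof -
    have "C $$ (j,j') = (\<Sum>r'<N. (\<Sum>r<N. x (r * m + j) * B $$ (r,r')) * x (r' * m + j'))"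
      using that B by (simp add: C_def xmat_def scalar_prod_def atLeast0LessThan)
    also have "\<dots> = (\<Sum>r<N. \<Sum>r'<N. x (r * m + j) * B $$ (r,r') * x (r' * m + j'))"
      unfolding sum_distrib_right by (rule sum.swap)
    finally show ?thesis .
  qed
  have "qform (N * m) (kronecker B (sqmat m w * transpose_mat (sqmat m w))) x
    = (\<Sum>r<N. \<Sum>j<m. \<Sum>r'<N. \<Sum>j'<m. \<Sum>l<m.
        x (r * m + j) * (B $$ (r,r') * (w (l * m + j) * w (l * m + j'))) * x (r' * m + j'))"
    unfolding qform_kronecker[OF B sqmat_gram_carrier]
    by (intro sum.cong refl) (simp add: sqmat_gram_index sum_distrib_left sum_distrib_right)
  also have "\<dots> = (\<Sum>l<m. \<Sum>j<m. \<Sum>j'<m. \<Sum>r<N. \<Sum>r'<N.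
        x (r * m + j) * (B $$ (r,r') * (w (l * m + j) * w (l * m + j'))) * x (r' * m + j'))"
    by (rule sum_rotate)
  also have "\<dots> = (\<Sum>l<m. \<Sum>j<m. \<Sum>j'<m. w (l * m + j) * C $$ (j,j') * w (l * m + j'))"
    by (intro sum.cong refl) (simp add: Cij sum_distrib_left sum_distrib_right mult_ac)
  finally have 1: "qform (N * m) (kronecker B (sqmat m w * transpose_mat (sqmat m w))) x
     = (\<Sum>l<m. qform m C (unflat m m w l))" by (simp add: qform_sum[OF C] unflat_def)
  have 2: "qform (m * m) (1\<^sub>m (m * m)) w = (\<Sum>l<m. qform m (1\<^sub>m m) (unflat m m w l))"
    using qform_kronecker_one[of "1\<^sub>m m" m m w] by (simp add: kronecker_one)
  show ?thesis
    unfolding 1 2 C_def[symmetric] using C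
    by (subst qform_kronecker_one[of _ m]) (auto simp: qform_add sum.distrib)
qed

text \<open>The same exchange of roles for the other representation: the data exponent is the trace
  of \<open>S^T X X^T S\<close> with \<open>S = sqmat N v\<close>, which adds \<open>X X^T\<close>
  to the precision \<open>R\<close> of each column of \<open>S\<close>.\<close>

lemma qform_mixture_left:
  assumes R: "R \<in> carrier_mat N N"
  shows "qform (N * m) (kronecker (sqmat N v * transpose_mat (sqmat N v)) (1\<^sub>m m)) x
      + qform (N * N) (kronecker (1\<^sub>m N) R) v
    = qform (N * N) (kronecker (1\<^sub>m N) (R + xmat N m x * transpose_mat (xmat N m x))) v"
proof -
  define C where "C = xmat N m x * transpose_mat (xmat N m x)"
  have C: "C \<in> carrier_mat N N" unfolding C_def by (auto simp: xmat_def)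
  have Cij: "C $$ (r,r') = (\<Sum>j<m. \<Sum>j'<m. x (r * m + j) * (1\<^sub>m m $$ (j,j') * x (r' * m + j')))"
    if "r < N" "r' < N" for r r'
  proof -
    have "(\<Sum>j'<m. x (r * m + j) * (1\<^sub>m m $$ (j,j') * x (r' * m + j'))) = x (r * m + j) * x (r' * m + j)"
      if "j < m" for j
    proof -
      have "(\<Sum>j'<m. x (r * m + j) * (1\<^sub>m m $$ (j,j') * x (r' * m + j')))
          = (\<Sum>j'<m. if j' = j then x (r * m + j) * x (r' * m + j) else 0)"
        using that by (intro sum.cong) auto
      then show ?thesis using that by simp
    qed
    then show ?thesis using that by (simp add: C_def xmat_def scalar_prod_def atLeast0LessThan)
  qed
  have "qform (N * m) (kronecker (sqmat N v * transpose_mat (sqmat N v)) (1\<^sub>m m)) x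
    = (\<Sum>r<N. \<Sum>j<m. \<Sum>r'<N. \<Sum>j'<m. \<Sum>l<N.
        x (r * m + j) * ((v (l * N + r) * v (l * N + r')) * 1\<^sub>m m $$ (j,j')) * x (r' * m + j'))"
    unfolding qform_kronecker[OF sqmat_gram_carrier one_carrier_mat]
    by (intro sum.cong refl) (simp add: sqmat_gram_index sum_distrib_left sum_distrib_right del: index_one_mat)
  also have "\<dots> = (\<Sum>l<N. \<Sum>r<N. \<Sum>r'<N. \<Sum>j<m. \<Sum>j'<m.
        x (r * m + j) * ((v (l * N + r) * v (l * N + r')) * 1\<^sub>m m $$ (j,j')) * x (r' * m + j'))"
    by (rule sum_rotate)
  also have "\<dots> = (\<Sum>l<N. \<Sum>r<N. \<Sum>r'<N. v (l * N + r) * C $$ (r,r') * v (l * N + r'))"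
    by (intro sum.cong refl) (simp add: Cij sum_distrib_left sum_distrib_right mult_ac del: index_one_mat)
  finally have 1: "qform (N * m) (kronecker (sqmat N v * transpose_mat (sqmat N v)) (1\<^sub>m m)) x
     = (\<Sum>l<N. qform N C (unflat N N v l))" by (simp add: qform_sum[OF C] unflat_def)
  show ?thesis
    unfolding 1 C_def[symmetric] using C R
    by (subst (1 2) qform_kronecker_one[of _ N]) (auto simp: qform_add sum.distrib)
qed

text \<open>The density at \<open>x\<close> of a Gaussian with precision \<open>B \<otimes> W W\<^sup>T\<close>, respectively \<open>S S\<^sup>T \<otimes> 1\<close>, in a
  form that is also defined (as \<open>0\<close>) at singular \<open>W\<close> and \<open>S\<close>.\<close>

definition right_kernel :: "nat \<Rightarrow> nat \<Rightarrow> real mat \<Rightarrow> (nat \<Rightarrow> real) \<Rightarrow> (nat \<Rightarrow> real) \<Rightarrow> real" where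
  "right_kernel N m B w x = sqrt (det B ^ m / (2 * pi) ^ (N * m)) * \<bar>det (sqmat m w)\<bar> ^ N *
     exp (- qform (N * m) (kronecker B (sqmat m w * transpose_mat (sqmat m w))) x / 2)"

definition left_kernel :: "nat \<Rightarrow> nat \<Rightarrow> (nat \<Rightarrow> real) \<Rightarrow> (nat \<Rightarrow> real) \<Rightarrow> real" where
  "left_kernel N m v x = sqrt (1 / (2 * pi) ^ (N * m)) * \<bar>det (sqmat N v)\<bar> ^ m *
     exp (- qform (N * m) (kronecker (sqmat N v * transpose_mat (sqmat N v)) (1\<^sub>m m)) x / 2)"

lemma right_kernel_eq_gdens:
  assumes B: "B \<in> PD N" and W: "det (sqmat m w) \<noteq> 0"
  shows "right_kernel N m B w x = gdens (N * m) (kronecker B (sqmat m w * transpose_mat (sqmat m w))) x"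
proof -
  note G = sqmat_gram_PD[OF W]
  have "sqrt (det (kronecker B (sqmat m w * transpose_mat (sqmat m w))) / (2 * pi) ^ (N * m))
     = sqrt (det B ^ m / (2 * pi) ^ (N * m) * (det (sqmat m w) ^ N)\<^sup>2)"
    unfolding kronecker_PD(2)[OF B G(1)] G(2) by (simp add: power_mult[symmetric] mult.commute)
  also have "\<dots> = sqrt (det B ^ m / (2 * pi) ^ (N * m)) * \<bar>det (sqmat m w)\<bar> ^ N"
    by (simp only: real_sqrt_mult real_sqrt_abs power_abs)
  finally show ?thesis by (simp add: right_kernel_def gdens_def)
qed

lemma left_kernel_eq_gdens:
  assumes S: "det (sqmat N v) \<noteq> 0"
  shows "left_kernel N m v x = gdens (N * m) (kronecker (sqmat N v * transpose_mat (sqmat N v)) (1\<^sub>m m)) x"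
proof -
  note G = sqmat_gram_PD[OF S]
  have "sqrt (det (kronecker (sqmat N v * transpose_mat (sqmat N v)) (1\<^sub>m m)) / (2 * pi) ^ (N * m))
     = sqrt (1 / (2 * pi) ^ (N * m) * (det (sqmat N v) ^ m)\<^sup>2)"
    unfolding kronecker_PD(2)[OF G(1) PD_one] G(2) by (simp add: power_mult[symmetric] mult.commute)
  also have "\<dots> = sqrt (1 / (2 * pi) ^ (N * m)) * \<bar>det (sqmat N v)\<bar> ^ m"
    by (simp only: real_sqrt_mult real_sqrt_abs power_abs)
  finally show ?thesis by (simp add: left_kernel_def gdens_def)
qed

lemma right_kernel_nonneg: "B \<in> PD N \<Longrightarrow> right_kernel N m B w x \<ge> 0"
  using PD_det_pos[of B N] by (simp add: right_kernel_def)

lemma left_kernel_nonneg: "left_kernel N m v x \<ge> 0"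
  by (simp add: left_kernel_def)

section \<open>Measurability, total mass and mixtures of the kernels\<close>

lemma measurable_sqmat_gram:
  assumes "\<And>i. i < p * p \<Longrightarrow> (\<lambda>z. w z i) \<in> borel_measurable M" "i < p" "j < p"
  shows "(\<lambda>z. (sqmat p (w z) * transpose_mat (sqmat p (w z))) $$ (i,j)) \<in> borel_measurable M"
  unfolding sqmat_gram_index[OF assms(2,3)]
  by (intro borel_measurable_sum borel_measurable_times assms(1))
     (use assms in \<open>auto simp: pair_index_less\<close>)

lemma measurable_right_kernel:
  assumes B: "B \<in> carrier_mat N N"
  shows "(\<lambda>z. ennreal (right_kernel N m B (fst z) (snd z))) \<in> borel_measurable (lborel_pi (m * m) \<Otimes>\<^sub>M lborel_pi (N * m))"
proof -
  have f: "(\<lambda>z. fst z i) \<in> borel_measurable (lborel_pi (m * m) \<Otimes>\<^sub>M lborel_pi (N * m))" if "i < m * m" for i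
    by (rule measurable_compose[OF measurable_fst measurable_component_lborel_pi[OF that]])
  have s: "(\<lambda>z. snd z i) \<in> borel_measurable (lborel_pi (m * m) \<Otimes>\<^sub>M lborel_pi (N * m))" if "i < N * m" for i
    by (rule measurable_compose[OF measurable_snd measurable_component_lborel_pi[OF that]])
  have "(\<lambda>z. qform (N * m) (kronecker B (sqmat m (fst z) * transpose_mat (sqmat m (fst z)))) (snd z))
      \<in> borel_measurable (lborel_pi (m * m) \<Otimes>\<^sub>M lborel_pi (N * m))"
    using B by (intro measurable_qform_kronecker s measurable_sqmat_gram f) auto
  note q = this and d = measurable_det_sqmat[OF f]
  show ?thesis unfolding right_kernel_def
    by (intro measurable_compose[OF _ measurable_ennreal] borel_measurable_times borel_measurable_const
      borel_measurable_power borel_measurable_abs d measurable_compose[OF _ borel_measurable_exp]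
      borel_measurable_divide borel_measurable_uminus q)
qed

lemma measurable_left_kernel:
  "(\<lambda>z. ennreal (left_kernel N m (fst z) (snd z))) \<in> borel_measurable (lborel_pi (N * N) \<Otimes>\<^sub>M lborel_pi (N * m))"
proof -
  have f: "(\<lambda>z. fst z i) \<in> borel_measurable (lborel_pi (N * N) \<Otimes>\<^sub>M lborel_pi (N * m))" if "i < N * N" for i
    by (rule measurable_compose[OF measurable_fst measurable_component_lborel_pi[OF that]])
  have s: "(\<lambda>z. snd z i) \<in> borel_measurable (lborel_pi (N * N) \<Otimes>\<^sub>M lborel_pi (N * m))" if "i < N * m" for i
    by (rule measurable_compose[OF measurable_snd measurable_component_lborel_pi[OF that]])
  have "(\<lambda>z. qform (N * m) (kronecker (sqmat N (fst z) * transpose_mat (sqmat N (fst z))) (1\<^sub>m m)) (snd z))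
      \<in> borel_measurable (lborel_pi (N * N) \<Otimes>\<^sub>M lborel_pi (N * m))"
    by (intro measurable_qform_kronecker s measurable_sqmat_gram f) auto
  note q = this and d = measurable_det_sqmat[OF f]
  show ?thesis unfolding left_kernel_def
    by (intro measurable_compose[OF _ measurable_ennreal] borel_measurable_times borel_measurable_const
      borel_measurable_power borel_measurable_abs d measurable_compose[OF _ borel_measurable_exp]
      borel_measurable_divide borel_measurable_uminus q)
qed

lemma nn_integral_left_kernel:
  "AE v in lborel_pi (N * N). (\<integral>\<^sup>+x. ennreal (left_kernel N m v x) \<partial>lborel_pi (N * m)) = 1"
  using AE_det_sqmat_nonzero[of N]
  by (rule AE_mp) (auto intro!: AE_I2 nn_integral_gdens kronecker_PD sqmat_gram_PD PD_one simp: left_kernel_eq_gdens)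

lemma nn_integral_right_kernel:
  assumes B: "B \<in> PD N"
  shows "AE w in lborel_pi (m * m). (\<integral>\<^sup>+x. ennreal (right_kernel N m B w x) \<partial>lborel_pi (N * m)) = 1"
  using AE_det_sqmat_nonzero[of m]
  by (rule AE_mp) (auto intro!: AE_I2 nn_integral_gdens kronecker_PD sqmat_gram_PD B simp: right_kernel_eq_gdens[OF B])

text \<open>Tonelli for a kernel: averaging the test values over the mixing law is the same as
  testing against the mixed density.\<close>

lemma nn_integral_mixture:
  assumes f: "f \<in> borel_measurable (lborel_pi K)" and k: "(\<lambda>z. k (fst z) (snd z)) \<in> borel_measurable (lborel_pi K \<Otimes>\<^sub>M lborel_pi K')"
    and F: "F \<in> borel_measurable (lborel_pi K')"
  shows "(\<integral>\<^sup>+w. f w * (\<integral>\<^sup>+x. F x * k w x \<partial>lborel_pi K') \<partial>lborel_pi K)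
    = (\<integral>\<^sup>+x. F x * (\<integral>\<^sup>+w. f w * k w x \<partial>lborel_pi K) \<partial>lborel_pi K')"
    "(\<lambda>x. \<integral>\<^sup>+w. f w * k w x \<partial>lborel_pi K) \<in> borel_measurable (lborel_pi K')"
    "(\<lambda>w. \<integral>\<^sup>+x. F x * k w x \<partial>lborel_pi K') \<in> borel_measurable (lborel_pi K)"
proof -
  interpret A: sigma_finite_measure "lborel_pi K" by (rule sigma_finite_lborel_pi)
  interpret B: sigma_finite_measure "lborel_pi K'" by (rule sigma_finite_lborel_pi)
  interpret pair_sigma_finite "lborel_pi K" "lborel_pi K'" ..
  have kw: "(\<lambda>x. k w x) \<in> borel_measurable (lborel_pi K')" if "w \<in> space (lborel_pi K)" for w
    using measurable_compose[OF measurable_Pair1'[OF that] k] by simp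
  have kx: "(\<lambda>w. k w x) \<in> borel_measurable (lborel_pi K)" if "x \<in> space (lborel_pi K')" for x
    using measurable_compose[OF measurable_Pair2'[OF that] k] by simp
  have m: "(\<lambda>(w, x). f w * (F x * k w x)) \<in> borel_measurable (lborel_pi K \<Otimes>\<^sub>M lborel_pi K')"
    unfolding split_beta' using f F k by (intro borel_measurable_times_ennreal) auto
  have "(\<integral>\<^sup>+w. f w * (\<integral>\<^sup>+x. F x * k w x \<partial>lborel_pi K') \<partial>lborel_pi K)
     = (\<integral>\<^sup>+w. (\<integral>\<^sup>+x. f w * (F x * k w x) \<partial>lborel_pi K') \<partial>lborel_pi K)"
    by (intro nn_integral_cong nn_integral_cmult[symmetric] borel_measurable_times_ennreal F kw)
  also have "\<dots> = (\<integral>\<^sup>+x. (\<integral>\<^sup>+w. f w * (F x * k w x) \<partial>lborel_pi K) \<partial>lborel_pi K')"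
    by (rule Fubini'[OF m, symmetric])
  also have "\<dots> = (\<integral>\<^sup>+x. F x * (\<integral>\<^sup>+w. f w * k w x \<partial>lborel_pi K) \<partial>lborel_pi K')"
  proof (rule nn_integral_cong)
    fix x assume x: "x \<in> space (lborel_pi K')"
    have "(\<integral>\<^sup>+w. f w * (F x * k w x) \<partial>lborel_pi K) = (\<integral>\<^sup>+w. F x * (f w * k w x) \<partial>lborel_pi K)"
      by (simp add: mult_ac)
    also have "\<dots> = F x * (\<integral>\<^sup>+w. f w * k w x \<partial>lborel_pi K)"
      by (intro nn_integral_cmult borel_measurable_times_ennreal f kx x)
    finally show "(\<integral>\<^sup>+w. f w * (F x * k w x) \<partial>lborel_pi K) = F x * (\<integral>\<^sup>+w. f w * k w x \<partial>lborel_pi K)" .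
  qed
  finally show "(\<integral>\<^sup>+w. f w * (\<integral>\<^sup>+x. F x * k w x \<partial>lborel_pi K') \<partial>lborel_pi K)
    = (\<integral>\<^sup>+x. F x * (\<integral>\<^sup>+w. f w * k w x \<partial>lborel_pi K) \<partial>lborel_pi K')" .
  have "(\<lambda>(w, x). F x * k w x) \<in> borel_measurable (lborel_pi K \<Otimes>\<^sub>M lborel_pi K')"
    unfolding split_beta' using F k by (intro borel_measurable_times_ennreal) auto
  then show "(\<lambda>w. \<integral>\<^sup>+x. F x * k w x \<partial>lborel_pi K') \<in> borel_measurable (lborel_pi K)"
    by (rule B.borel_measurable_nn_integral)
  have "(\<lambda>(x, w). f w * k w x) \<in> borel_measurable (lborel_pi K' \<Otimes>\<^sub>M lborel_pi K)"
    unfolding split_beta' using f measurable_compose[OF measurable_pair_swap' k]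
    by (intro borel_measurable_times_ennreal) (auto simp: split_beta')
  then show "(\<lambda>x. \<integral>\<^sup>+w. f w * k w x \<partial>lborel_pi K) \<in> borel_measurable (lborel_pi K')"
    by (rule A.borel_measurable_nn_integral)
qed

text \<open>Both sides are the density of \<open>Y W\<^sup>-\<^sup>1\<close> for a Gaussian \<open>N \<times> m\<close> matrix \<open>Y\<close> whose columns have
  precision \<open>B\<close> and a standard Gaussian \<open>m \<times> m\<close> matrix \<open>W\<close>. On the right it is written as that of
  \<open>V\<^sup>-\<^sup>1 H\<close> with \<open>V\<close> of size only \<open>N \<times> N\<close>; this is what limits the information on \<open>B\<close> when
  \<open>N < m\<close>. Each side is a constant multiple of \<open>det (1 + X\<^sup>T B X)\<close> to the power \<open>- (N + m) / 2\<close>, and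
  the constants agree because both sides have total mass one.\<close>

theorem mixture_densities_eq:
  assumes B: "B \<in> PD N" and x: "x \<in> space (lborel_pi (N * m))"
  shows "(\<integral>\<^sup>+w. ennreal (gdens (m * m) (1\<^sub>m (m * m)) w) * ennreal (right_kernel N m B w x) \<partial>lborel_pi (m * m))
    = (\<integral>\<^sup>+v. ennreal (gdens (N * N) (kronecker (1\<^sub>m N) (inv_mat B)) v) * ennreal (left_kernel N m v x) \<partial>lborel_pi (N * N))"
proof -
  define q where "q x = (\<integral>\<^sup>+w. ennreal (gdens (m * m) (1\<^sub>m (m * m)) w) * ennreal (right_kernel N m B w x) \<partial>lborel_pi (m * m))" for x
  define h where "h x = (\<integral>\<^sup>+v. ennreal (gdens (N * N) (kronecker (1\<^sub>m N) (inv_mat B)) v) * ennreal (left_kernel N m v x) \<partial>lborel_pi (N * N))" for x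
  note BC = PD_carrier[OF B] and I = PD_inv_mat[OF B] and dB = PD_det_pos[OF B]
  note IC = PD_carrier[OF I(1)]
  note KI = kronecker_PD[OF PD_one I(1), of N]
  have gm: "(\<lambda>w. ennreal (gdens (m * m) (1\<^sub>m (m * m)) w)) \<in> borel_measurable (lborel_pi (m * m))"
    by measurable
  have gv: "(\<lambda>v. ennreal (gdens (N * N) (kronecker (1\<^sub>m N) (inv_mat B)) v)) \<in> borel_measurable (lborel_pi (N * N))"
    using PD_carrier[OF KI(1)] by measurable
  have one: "(\<lambda>_. 1 :: ennreal) \<in> borel_measurable (lborel_pi (N * m))" by simp
  note Q = nn_integral_mixture[OF gm measurable_right_kernel[OF BC] one]
  note H = nn_integral_mixture[OF gv measurable_left_kernel one]
  have q_meas: "q \<in> borel_measurable (lborel_pi (N * m))" unfolding q_def by (rule Q(2))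
  have h_meas: "h \<in> borel_measurable (lborel_pi (N * m))" unfolding h_def by (rule H(2))
  have q_total: "(\<integral>\<^sup>+x. q x \<partial>lborel_pi (N * m)) = 1"
  proof -
    have "(\<integral>\<^sup>+x. q x \<partial>lborel_pi (N * m)) = (\<integral>\<^sup>+w. ennreal (gdens (m * m) (1\<^sub>m (m * m)) w) *
        (\<integral>\<^sup>+x. ennreal (right_kernel N m B w x) \<partial>lborel_pi (N * m)) \<partial>lborel_pi (m * m))"
      using Q(1) by (simp add: q_def)
    also have "\<dots> = (\<integral>\<^sup>+w. ennreal (gdens (m * m) (1\<^sub>m (m * m)) w) \<partial>lborel_pi (m * m))"
      using nn_integral_right_kernel[OF B, of m] by (intro nn_integral_cong_AE) auto
    finally show ?thesis using nn_integral_gdens[OF PD_one, of "m * m"] by simp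
  qed
  have h_total: "(\<integral>\<^sup>+x. h x \<partial>lborel_pi (N * m)) = 1"
  proof -
    have "(\<integral>\<^sup>+x. h x \<partial>lborel_pi (N * m)) = (\<integral>\<^sup>+v. ennreal (gdens (N * N) (kronecker (1\<^sub>m N) (inv_mat B)) v) *
        (\<integral>\<^sup>+x. ennreal (left_kernel N m v x) \<partial>lborel_pi (N * m)) \<partial>lborel_pi (N * N))"
      using H(1) by (simp add: h_def)
    also have "\<dots> = (\<integral>\<^sup>+v. ennreal (gdens (N * N) (kronecker (1\<^sub>m N) (inv_mat B)) v) \<partial>lborel_pi (N * N))"
      using nn_integral_left_kernel[of N m] by (intro nn_integral_cong_AE) auto
    finally show ?thesis using nn_integral_gdens[OF KI(1)] by simp
  qed
  \<comment> \<open>The common dependence on the data: each of the two mixtures will be a constant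
    divided by \<open>s x\<close>.\<close>
  define s where "s x = sqrt (det (1\<^sub>m m + transpose_mat (xmat N m x) * B * xmat N m x)) ^ (N + m)" for x
  define c1 where "c1 = sqrt (1 / (2 * pi) ^ (m * m)) * sqrt (det B ^ m / (2 * pi) ^ (N * m))"
  define c2 where "c2 = sqrt ((1 / det B) ^ N / (2 * pi) ^ (N * N)) * sqrt (1 / (2 * pi) ^ (N * m)) * sqrt (det B) ^ (N + m)"
  define \<alpha> where "\<alpha> = ennreal c1 * det_gauss_integral m N (1\<^sub>m m)"
  define \<beta> where "\<beta> = ennreal c2 * det_gauss_integral N m (1\<^sub>m N)"
  have s_pos: "s x > 0" for x
    using PD_det_pos[OF PD_add_congruence[OF PD_one B xmat_carrier]] by (simp add: s_def)
  have sq: "ennreal (s x) * q x = \<alpha>" for x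
  proof -
    define X where "X = xmat N m x"
    define Q where "Q = 1\<^sub>m m + transpose_mat X * B * X"
    have Q: "Q \<in> PD m" unfolding Q_def X_def by (rule PD_add_congruence[OF PD_one B xmat_carrier])
    have "ennreal (gdens (m * m) (1\<^sub>m (m * m)) w) * ennreal (right_kernel N m B w x)
      = ennreal c1 * ennreal (\<bar>det (sqmat m w)\<bar> ^ N * exp (- qform (m * m) (kronecker (1\<^sub>m m) Q) w / 2))" for w
    proof -
      have "exp (- qform (m * m) (kronecker (1\<^sub>m m) Q) w / 2) = exp (- qform (m * m) (1\<^sub>m (m * m)) w / 2) *
         exp (- qform (N * m) (kronecker B (sqmat m w * transpose_mat (sqmat m w))) x / 2)"
        unfolding Q_def X_def qform_mixture_right[OF BC, symmetric] exp_add[symmetric] by (simp add: add_divide_distrib)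
      then have "gdens (m * m) (1\<^sub>m (m * m)) w * right_kernel N m B w x
        = c1 * (\<bar>det (sqmat m w)\<bar> ^ N * exp (- qform (m * m) (kronecker (1\<^sub>m m) Q) w / 2))"
        by (simp add: gdens_def right_kernel_def c1_def mult_ac)
      then show ?thesis
        using gdens_nonneg[OF PD_one, of "m * m" w] right_kernel_nonneg[OF B, of m w x]
        by (simp add: ennreal_mult''[symmetric] ennreal_mult'[symmetric])
    qed
    then have "q x = ennreal c1 * det_gauss_integral m N Q"
      unfolding q_def det_gauss_integral_def using PD_carrier[OF Q]
      by (simp only:, intro nn_integral_cmult)
         (auto intro!: measurable_compose[OF _ measurable_ennreal] borel_measurable_times borel_measurable_power
      borel_measurable_abs measurable_det_sqmat measurable_component_lborel_pi
      measurable_compose[OF measurable_qform_lborel_pi] kronecker_carrier)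
    then have "ennreal (s x) * q x = ennreal c1 * (ennreal (sqrt (det Q) ^ (m + N)) * det_gauss_integral m N Q)"
      by (simp add: s_def Q_def X_def mult_ac add.commute)
    then show ?thesis unfolding det_gauss_integral_scaling[OF Q] \<alpha>_def .
  qed
  have sh: "ennreal (s x) * h x = \<beta>" for x
  proof -
    define X where "X = xmat N m x"
    define Q where "Q = inv_mat B + X * transpose_mat X"
    have XT: "transpose_mat X \<in> carrier_mat m N" "X \<in> carrier_mat N m" by (auto simp: X_def)
    have Q: "Q \<in> PD N"
      using PD_add_congruence[OF I(1) PD_one XT(1)] XT
      by (simp add: Q_def right_mult_one_mat[of _ N m])
    define c where "c = sqrt ((1 / det B) ^ N / (2 * pi) ^ (N * N)) * sqrt (1 / (2 * pi) ^ (N * m))"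
    have "ennreal (gdens (N * N) (kronecker (1\<^sub>m N) (inv_mat B)) v) * ennreal (left_kernel N m v x)
      = ennreal c * ennreal (\<bar>det (sqmat N v)\<bar> ^ m * exp (- qform (N * N) (kronecker (1\<^sub>m N) Q) v / 2))" for v
    proof -
      have "exp (- qform (N * N) (kronecker (1\<^sub>m N) Q) v / 2) = exp (- qform (N * N) (kronecker (1\<^sub>m N) (inv_mat B)) v / 2) *
         exp (- qform (N * m) (kronecker (sqmat N v * transpose_mat (sqmat N v)) (1\<^sub>m m)) x / 2)"
        unfolding Q_def X_def qform_mixture_left[OF IC, symmetric] exp_add[symmetric] by (simp add: add_divide_distrib)
      then have "gdens (N * N) (kronecker (1\<^sub>m N) (inv_mat B)) v * left_kernel N m v x
        = c * (\<bar>det (sqmat N v)\<bar> ^ m * exp (- qform (N * N) (kronecker (1\<^sub>m N) Q) v / 2))"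
        by (simp add: gdens_def left_kernel_def c_def mult_ac KI(2) I(5))
      then show ?thesis
        using gdens_nonneg[OF KI(1), of v] left_kernel_nonneg[of N m v x]
        by (simp add: ennreal_mult''[symmetric] ennreal_mult'[symmetric])
    qed
    then have hx: "h x = ennreal c * det_gauss_integral N m Q"
      unfolding h_def det_gauss_integral_def using PD_carrier[OF Q]
      by (simp only:, intro nn_integral_cmult)
         (auto intro!: measurable_compose[OF _ measurable_ennreal] borel_measurable_times borel_measurable_power
      borel_measurable_abs measurable_det_sqmat measurable_component_lborel_pi
      measurable_compose[OF measurable_qform_lborel_pi] kronecker_carrier)
    \<comment> \<open>Sylvester's identity converts the determinant of size \<open>m\<close> into
      one of size \<open>N\<close>; the power of \<open>det B\<close> that it produces is absorbed
      into \<open>c2\<close>.\<close>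
    have sx: "s x = sqrt (det B) ^ (N + m) * sqrt (det Q) ^ (N + m)"
      unfolding s_def det_sylvester[OF B xmat_carrier] Q_def X_def
      by (simp add: real_sqrt_mult power_mult_distrib)
    have "ennreal (s x) * h x = ennreal c2 * (ennreal (sqrt (det Q) ^ (N + m)) * det_gauss_integral N m Q)"
      unfolding hx sx c2_def c_def[symmetric] using dB PD_det_pos[OF Q] by (simp add: ennreal_mult' mult_ac c_def)
    then show ?thesis unfolding det_gauss_integral_scaling[OF Q] \<beta>_def .
  qed
  have eq: "\<beta> * q x = \<alpha> * h x" for x
    unfolding sq[of x, symmetric] sh[of x, symmetric] by (simp add: mult_ac)
  \<comment> \<open>\<open>\<alpha>\<close> and \<open>\<beta>\<close> contain moments of
    determinants of different sizes. Comparing the total masses of \<open>q\<close> and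
    \<open>h\<close>, both equal to 1, shows that they agree without evaluating either.\<close>
  have "\<beta> * (\<integral>\<^sup>+x. q x \<partial>lborel_pi (N * m)) = \<alpha> * (\<integral>\<^sup>+x. h x \<partial>lborel_pi (N * m))"
    unfolding nn_integral_cmult[OF q_meas, symmetric] nn_integral_cmult[OF h_meas, symmetric] eq ..
  then have "\<alpha> = \<beta>" using q_total h_total by simp
  then have "ennreal (s x) * q x = ennreal (s x) * h x" by (simp add: sq sh)
  then have "q x = h x" using s_pos[of x] by (subst (asm) ennreal_mult_cancel_left) auto
  then show ?thesis by (simp add: q_def h_def)
qed

section \<open>Functional calculus and the two distances\<close>

definition orthonormal_mat :: "nat \<Rightarrow> real mat \<Rightarrow> bool" where
  "orthonormal_mat d U \<longleftrightarrow> U \<in> carrier_mat d d \<and> U * transpose_mat U = 1\<^sub>m d \<and> transpose_mat U * U = 1\<^sub>m d"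

text \<open>For a fixed orthonormal \<open>U\<close> these matrices multiply, add and invert like
  functions on the index set, so functional calculus becomes arithmetic with eigenvalues.\<close>

definition spec_mat :: "nat \<Rightarrow> real mat \<Rightarrow> (nat \<Rightarrow> real) \<Rightarrow> real mat" where
  "spec_mat d U f = U * mat_diag d f * transpose_mat U"

lemma spectral_decomp_spec_mat:
  assumes "orthonormal_mat d U"
  shows "spectral_decomp (spec_mat d U f) U f"
proof -
  have "dim_row (spec_mat d U f) = d" using assms by (auto simp: spec_mat_def orthonormal_mat_def)
  then show ?thesis using assms by (simp add: spectral_decomp_def Let_def orthonormal_mat_def) (simp add: spec_mat_def)
qed

lemma symmetric_eq_spec_mat:
  assumes "A \<in> carrier_mat d d" "transpose_mat A = A"
  obtains U f where "orthonormal_mat d U" "A = spec_mat d U f"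
  using symmetric_spectral_decomp[OF assms] assms(1) that
  by (auto simp: spectral_decomp_def Let_def orthonormal_mat_def spec_mat_def)

context
  fixes d :: nat and U :: "real mat"
  assumes U: "orthonormal_mat d U"
begin

lemma orthonormal_carrier: "U \<in> carrier_mat d d" "transpose_mat U \<in> carrier_mat d d"
  using U by (auto simp: orthonormal_mat_def)

lemma orthonormal_index:
  assumes "i < d" "j < d"
  shows "(\<Sum>k<d. U $$ (k,i) * U $$ (k,j)) = (if i = j then 1 else 0)"
    "(\<Sum>k<d. U $$ (i,k) * U $$ (j,k)) = (if i = j then 1 else 0)"
proof -
  have "(transpose_mat U * U) $$ (i,j) = (if i = j then 1 else 0)"
    "(U * transpose_mat U) $$ (i,j) = (if i = j then 1 else 0)"
    using U assms by (auto simp: orthonormal_mat_def)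
  then show "(\<Sum>k<d. U $$ (k,i) * U $$ (k,j)) = (if i = j then 1 else 0)"
    "(\<Sum>k<d. U $$ (i,k) * U $$ (j,k)) = (if i = j then 1 else 0)"
    using orthonormal_carrier assms by (simp_all add: scalar_prod_def atLeast0LessThan)
qed

lemma spec_mat_carrier: "spec_mat d U f \<in> carrier_mat d d"
  unfolding spec_mat_def using orthonormal_carrier by auto

lemma spec_mat_dim [simp]: "dim_row (spec_mat d U f) = d" "dim_col (spec_mat d U f) = d"
  using spec_mat_carrier[of f] by auto

lemma spec_mat_index:
  assumes "i < d" "j < d"
  shows "spec_mat d U f $$ (i,j) = (\<Sum>k<d. U $$ (i,k) * f k * U $$ (j,k))"
  unfolding spec_mat_def using assms orthonormal_carrier
  by (simp add: mat_diag_mult_right[of _ d] scalar_prod_def atLeast0LessThan)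

lemma spec_mat_cong: "(\<And>k. k < d \<Longrightarrow> f k = g k) \<Longrightarrow> spec_mat d U f = spec_mat d U g"
  using spec_mat_carrier by (intro eq_matI) (auto simp: spec_mat_index intro!: sum.cong)

lemma spec_mat_mult: "spec_mat d U f * spec_mat d U g = spec_mat d U (\<lambda>k. f k * g k)"
proof -
  note c = orthonormal_carrier mat_diag_dim[of d]
  have "spec_mat d U f * spec_mat d U g
      = U * (mat_diag d f * ((transpose_mat U * U) * (mat_diag d g * transpose_mat U)))"
    unfolding spec_mat_def using c
    by (simp add: assoc_mult_mat[of _ d d _ d _ d] mult_carrier_mat[of _ d d _ d])
  also have "\<dots> = U * ((mat_diag d f * mat_diag d g) * transpose_mat U)"
    using c U by (simp add: orthonormal_mat_def left_mult_one_mat[of _ d d] assoc_mult_mat[of _ d d _ d _ d] mult_carrier_mat[of _ d d _ d] del: mat_diag_diag)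
  finally show ?thesis
    unfolding spec_mat_def using c by (simp add: assoc_mult_mat[of _ d d _ d _ d] mult_carrier_mat[of _ d d _ d])
qed

lemma spec_mat_one: "spec_mat d U (\<lambda>_. 1) = 1\<^sub>m d"
  using U by (simp add: spec_mat_def orthonormal_mat_def right_mult_one_mat[of _ d d])

lemma spec_mat_transpose: "transpose_mat (spec_mat d U f) = spec_mat d U f"
  using spec_mat_carrier by (intro eq_matI) (auto simp: spec_mat_index mult_ac)

lemma spec_mat_lincomb:
  "a \<cdot>\<^sub>m spec_mat d U f + b \<cdot>\<^sub>m spec_mat d U g = spec_mat d U (\<lambda>k. a * f k + b * g k)"
  using spec_mat_carrier
  by (intro eq_matI) (auto simp: spec_mat_index sum_distrib_left sum.distrib[symmetric] algebra_simps)

lemma spec_mat_minus: "spec_mat d U f - spec_mat d U g = spec_mat d U (\<lambda>k. f k - g k)"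
  using spec_mat_carrier
  by (intro eq_matI) (auto simp: spec_mat_index sum_subtractf[symmetric] algebra_simps)

lemma spec_mat_add: "spec_mat d U f + spec_mat d U g = spec_mat d U (\<lambda>k. f k + g k)"
  using spec_mat_carrier
  by (intro eq_matI) (auto simp: spec_mat_index sum.distrib[symmetric] algebra_simps)

lemma det_spec_mat: "det (spec_mat d U f) = (\<Prod>k<d. f k)"
proof -
  note c = orthonormal_carrier mat_diag_dim[of d f]
  have "det U * det (transpose_mat U) = 1"
    using c U by (simp add: orthonormal_mat_def det_mult[of _ d, symmetric])
  moreover have "det (mat_diag d f) = (\<Prod>k<d. f k)"
    by (subst det_upper_triangular[of _ d])
       (auto simp: mat_diag_def diag_mat_def prod.list_conv_set_nth atLeast0LessThan)
  moreover have "det (spec_mat d U f) = det U * det (mat_diag d f) * det (transpose_mat U)"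
    unfolding spec_mat_def using c by (simp add: det_mult[of _ d])
  ultimately show ?thesis by (simp add: mult_ac)
qed

lemma spec_mat_quadratic:
  assumes v: "v \<in> carrier_vec d"
  shows "v \<bullet> (spec_mat d U f *\<^sub>v v) = (\<Sum>k<d. f k * ((transpose_mat U *\<^sub>v v) $ k)\<^sup>2)"
proof -
  have Tv: "transpose_mat U *\<^sub>v v \<in> carrier_vec d" using orthonormal_carrier v by auto
  have "v \<bullet> (spec_mat d U f *\<^sub>v v) = (transpose_mat U *\<^sub>v v) \<bullet> (mat_diag d f *\<^sub>v (transpose_mat U *\<^sub>v v))"
    using quadratic_form_congruence[OF orthonormal_carrier(2) mat_diag_dim v] by (simp add: spec_mat_def)
  also have "\<dots> = (\<Sum>i<d. \<Sum>j<d. if j = i then f j * ((transpose_mat U *\<^sub>v v) $ j)\<^sup>2 else 0)"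
    unfolding quadratic_form_sum[OF mat_diag_dim Tv]
    by (intro sum.cong refl) (auto simp: mat_diag_def power2_eq_square)
  finally show ?thesis by simp
qed

lemma norm_spec_mat_le:
  assumes v: "v \<in> carrier_vec d" and c: "\<And>k. k < d \<Longrightarrow> \<bar>f k\<bar> \<le> c"
  shows "(spec_mat d U f *\<^sub>v v) \<bullet> (spec_mat d U f *\<^sub>v v) \<le> c\<^sup>2 * (v \<bullet> v)"
proof -
  have "(spec_mat d U f *\<^sub>v v) \<bullet> (spec_mat d U f *\<^sub>v v) = v \<bullet> ((spec_mat d U f * spec_mat d U f) *\<^sub>v v)"
    using quadratic_form_congruence[OF spec_mat_carrier one_carrier_mat v, of f] spec_mat_carrier[of f] v
    by (simp add: spec_mat_transpose right_mult_one_mat[of _ d d] one_mult_mat_vec[of _ d])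
  also have "\<dots> = (\<Sum>k<d. (f k)\<^sup>2 * ((transpose_mat U *\<^sub>v v) $ k)\<^sup>2)"
    by (simp add: spec_mat_mult spec_mat_quadratic[OF v] power2_eq_square)
  also have "\<dots> \<le> (\<Sum>k<d. c\<^sup>2 * (1 * ((transpose_mat U *\<^sub>v v) $ k)\<^sup>2))"
  proof (rule sum_mono)
    fix k assume "k \<in> {..<d}"
    then have "(f k)\<^sup>2 \<le> c\<^sup>2" using c[of k] by (simp add: abs_le_square_iff[symmetric])
    then show "(f k)\<^sup>2 * ((transpose_mat U *\<^sub>v v) $ k)\<^sup>2 \<le> c\<^sup>2 * (1 * ((transpose_mat U *\<^sub>v v) $ k)\<^sup>2)"
      by (simp add: mult_right_mono)
  qed
  also have "\<dots> = c\<^sup>2 * (v \<bullet> (spec_mat d U (\<lambda>_. 1) *\<^sub>v v))"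
    by (simp add: spec_mat_quadratic[OF v] sum_distrib_left)
  finally show ?thesis using v by (simp add: spec_mat_one)
qed

text \<open>For a symmetric matrix the sum of squared entries is the trace of the square, which does
  not depend on the basis.\<close>

lemma frob_norm_spec_mat: "(\<Sum>i<d. \<Sum>j<d. (spec_mat d U f $$ (i,j))\<^sup>2) = (\<Sum>k<d. (f k)\<^sup>2)"
proof -
  have "(\<Sum>i<d. \<Sum>j<d. (spec_mat d U f $$ (i,j))\<^sup>2) = (\<Sum>i<d. (spec_mat d U f * spec_mat d U f) $$ (i,i))"
  proof (intro sum.cong refl)
    fix i assume "i \<in> {..<d}"
    then have i: "i < d" by simp
    have "(spec_mat d U f * spec_mat d U f) $$ (i,i) = (\<Sum>j<d. spec_mat d U f $$ (i,j) * spec_mat d U f $$ (j,i))"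
      using i spec_mat_carrier[of f] by (simp add: scalar_prod_def atLeast0LessThan)
    also have "\<dots> = (\<Sum>j<d. (spec_mat d U f $$ (i,j))\<^sup>2)"
      using i by (intro sum.cong refl) (simp add: spec_mat_index power2_eq_square mult_ac)
    finally show "(\<Sum>j<d. (spec_mat d U f $$ (i,j))\<^sup>2) = (spec_mat d U f * spec_mat d U f) $$ (i,i)" ..
  qed
  also have "\<dots> = (\<Sum>i<d. \<Sum>k<d. (f k)\<^sup>2 * (U $$ (i,k) * U $$ (i,k)))"
    by (simp add: spec_mat_mult spec_mat_index power2_eq_square mult_ac)
  also have "\<dots> = (\<Sum>k<d. (f k)\<^sup>2 * (\<Sum>i<d. U $$ (i,k) * U $$ (i,k)))"
    unfolding sum_distrib_left by (rule sum.swap)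
  finally show ?thesis by (simp add: orthonormal_index)
qed

lemma spec_mat_PD_iff: "spec_mat d U f \<in> PD d \<longleftrightarrow> (\<forall>k<d. f k > 0)"
proof
  assume P: "spec_mat d U f \<in> PD d"
  show "\<forall>k<d. f k > 0"
  proof (intro allI impI)
    fix k assume k: "k < d"
    have "det U * det (transpose_mat U) = 1"
      using orthonormal_carrier U by (simp add: orthonormal_mat_def det_mult[of _ d, symmetric])
    then have "det U \<noteq> 0" by auto
    from PD_congruence[OF orthonormal_carrier(1) this P]
    have "transpose_mat U * spec_mat d U f * U \<in> PD d" .
    also have "transpose_mat U * spec_mat d U f * U = (transpose_mat U * U) * mat_diag d f * (transpose_mat U * U)"
      unfolding spec_mat_def using orthonormal_carrier mat_diag_dim[of d f]
      by (simp add: assoc_mult_mat[of _ d d _ d _ d] mult_carrier_mat[of _ d d _ d])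
    also have "\<dots> = mat_diag d f" using U by (simp add: orthonormal_mat_def right_mult_one_mat[of _ d d] left_mult_one_mat[of _ d d])
    finally show "f k > 0" using PD_diag_pos[of "mat_diag d f" d k] k by (simp add: mat_diag_def)
  qed
next
  assume f: "\<forall>k<d. f k > 0"
  have "v \<bullet> (spec_mat d U f *\<^sub>v v) > 0" if v: "v \<in> carrier_vec d" "v \<noteq> 0\<^sub>v d" for v
  proof -
    have "v \<bullet> v = (\<Sum>k<d. ((transpose_mat U *\<^sub>v v) $ k)\<^sup>2)"
      using spec_mat_quadratic[OF v(1), of "\<lambda>_. 1"] v by (simp add: spec_mat_one)
    moreover have "v \<bullet> v \<noteq> 0" using self_scalar_prod_real(3)[OF v(1)] v by simp
    ultimately have "\<exists>k<d. ((transpose_mat U *\<^sub>v v) $ k)\<^sup>2 \<noteq> 0"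
      by (metis (no_types, lifting) lessThan_iff sum.neutral)
    then obtain k where k: "k < d" "(transpose_mat U *\<^sub>v v) $ k \<noteq> 0" by auto
    have "0 < f k * ((transpose_mat U *\<^sub>v v) $ k)\<^sup>2" using f k by simp
    also have "\<dots> \<le> (\<Sum>k<d. f k * ((transpose_mat U *\<^sub>v v) $ k)\<^sup>2)"
      using f k by (intro member_le_sum) (auto simp: less_imp_le)
    finally show ?thesis by (simp add: spec_mat_quadratic[OF v(1)])
  qed
  then show "spec_mat d U f \<in> PD d" using spec_mat_carrier spec_mat_transpose by (auto simp: PD_def)
qed

lemma mat_fun_spec_mat: "mat_fun g (spec_mat d U f) = spec_mat d U (\<lambda>k. g (f k))"
  using mat_fun_eq[OF spectral_decomp_spec_mat[OF U], of g f] by (simp add: spec_mat_def[of d U "\<lambda>k. g (f k)"])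

lemma spec_mat_eq_0_iff: "(\<forall>i<d. \<forall>j<d. spec_mat d U f $$ (i,j) = 0) \<longleftrightarrow> (\<forall>k<d. f k = 0)"
proof
  assume "\<forall>i<d. \<forall>j<d. spec_mat d U f $$ (i,j) = 0"
  then have "(\<Sum>k<d. (f k)\<^sup>2) = 0" using frob_norm_spec_mat[of f] by simp
  then show "\<forall>k<d. f k = 0" by (subst (asm) sum_nonneg_eq_0_iff) auto
qed (simp add: spec_mat_index)

text \<open>The columns of \<open>U\<close> are unit vectors with image norms
  \<open>\<bar>f k\<bar>\<close>, and no unit vector exceeds the largest of these. Positive
  dimension keeps the set under the supremum nonempty. As an equivalence it serves both the
  estimates and the measurability of \<open>d_op\<close>.\<close>

lemma op_norm_spec_mat_le_iff:
  assumes d: "0 < d"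
  shows "op_norm (spec_mat d U f) \<le> t \<longleftrightarrow> (\<forall>k<d. \<bar>f k\<bar> \<le> t)"
proof -
  let ?S = "spec_mat d U f"
  let ?V = "{v \<in> carrier_vec (dim_col ?S). vec_norm2 v = 1}"
  have dc: "dim_col ?S = d" using spec_mat_carrier[of f] by simp
  have bound: "vec_norm2 (?S *\<^sub>v v) \<le> c" if v: "v \<in> ?V" and c: "\<And>k. k < d \<Longrightarrow> \<bar>f k\<bar> \<le> c" "0 \<le> c" for v c
  proof -
    have v': "v \<in> carrier_vec d" "v \<bullet> v = 1" using v dc by (auto simp: vec_norm2_def)
    have "(?S *\<^sub>v v) \<bullet> (?S *\<^sub>v v) \<le> c\<^sup>2" using norm_spec_mat_le[OF v'(1) c(1)] v'(2) by simp
    then show ?thesis unfolding vec_norm2_def using c(2) by (simp add: real_le_lsqrt)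
  qed
  have col: "col U k \<in> ?V" "vec_norm2 (?S *\<^sub>v col U k) = \<bar>f k\<bar>" if k: "k < d" for k
  proof -
    note c = orthonormal_carrier
    have cc: "col U k \<in> carrier_vec d" using c by auto
    have "col U k \<bullet> col U k = 1"
      using orthonormal_index(1)[OF k k] c k by (simp add: scalar_prod_def atLeast0LessThan)
    then show "col U k \<in> ?V" using cc dc by (simp add: vec_norm2_def)
    have "?S *\<^sub>v col U k = f k \<cdot>\<^sub>v col U k"
    proof (rule eq_vecI)
      fix i assume "i < dim_vec (f k \<cdot>\<^sub>v col U k)"
      then have i: "i < d" using c by simp
      have "(?S *\<^sub>v col U k) $ i = (\<Sum>j<d. (\<Sum>l<d. U $$ (i,l) * f l * U $$ (j,l)) * U $$ (j,k))"
        using i k c spec_mat_carrier[of f] by (simp add: scalar_prod_def atLeast0LessThan spec_mat_index)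
      also have "\<dots> = (\<Sum>l<d. U $$ (i,l) * f l * (\<Sum>j<d. U $$ (j,l) * U $$ (j,k)))"
        unfolding sum_distrib_left sum_distrib_right by (subst sum.swap) (simp add: mult_ac)
      also have "\<dots> = (\<Sum>l<d. if l = k then U $$ (i,k) * f k else 0)"
        using k by (intro sum.cong) (auto simp: orthonormal_index)
      finally show "(?S *\<^sub>v col U k) $ i = (f k \<cdot>\<^sub>v col U k) $ i" using i k c by (simp add: mult.commute)
    qed (use spec_mat_carrier[of f] c in auto)
    then show "vec_norm2 (?S *\<^sub>v col U k) = \<bar>f k\<bar>"
      using \<open>col U k \<bullet> col U k = 1\<close> cc
      by (simp add: vec_norm2_def real_sqrt_mult)
  qed
  define b where "b = Max ((\<lambda>k. \<bar>f k\<bar>) ` {..<d})"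
  have b: "\<bar>f k\<bar> \<le> b" if "k < d" for k unfolding b_def using that by (intro Max_ge) auto
  have b0: "0 \<le> b" using b[OF d] by linarith
  have bdd: "bdd_above ((\<lambda>v. vec_norm2 (?S *\<^sub>v v)) ` ?V)"
    using bound[OF _ b b0] by (intro bdd_aboveI2)
  show ?thesis
  proof
    assume le: "op_norm ?S \<le> t"
    show "\<forall>k<d. \<bar>f k\<bar> \<le> t"
    proof (intro allI impI)
      fix k assume k: "k < d"
      have "vec_norm2 (?S *\<^sub>v col U k) \<le> op_norm ?S"
        unfolding op_norm_def by (rule cSUP_upper[OF col(1)[OF k] bdd])
      then show "\<bar>f k\<bar> \<le> t" using col(2)[OF k] le by simp
    qed
  next
    assume t: "\<forall>k<d. \<bar>f k\<bar> \<le> t"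
    then have "0 \<le> t" using d by (meson abs_ge_zero order_trans)
    then show "op_norm ?S \<le> t" unfolding op_norm_def
      using bound[of _ t] t col(1)[OF d] by (intro cSUP_least) auto
  qed
qed

lemma spec_mat_pow: "spec_mat d U f ^\<^sub>m k = spec_mat d U (\<lambda>i. f i ^ k)"
proof (induction k)
  case 0
  then show ?case using spec_mat_carrier[of f] by (simp add: spec_mat_one)
next
  case (Suc k)
  then show ?case by (simp add: spec_mat_mult mult.commute)
qed

end

section \<open>From the two distances to matrix entries\<close>

lemma PD_eq_spec_mat:
  assumes "A \<in> PD d"
  obtains U f where "orthonormal_mat d U" "A = spec_mat d U f" "\<And>k. k < d \<Longrightarrow> f k > 0"
  using symmetric_eq_spec_mat[OF PD_carrier PD_transpose, OF assms assms] spec_mat_PD_iff assms by metis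

text \<open>Let \<open>H\<close> and \<open>R\<close> be the square root of \<open>\<Theta>\<close>
  and its inverse, and diagonalise \<open>R A R\<close> with eigenvalues \<open>z\<close>. The
  distances see only \<open>ln z\<close>, while \<open>A - \<Theta> = H (R A R - 1) H\<close> sees
  only \<open>z - 1\<close>; this is the bridge from distances to entries.\<close>

lemma log_ratio_spec:
  assumes A: "A \<in> PD d" and \<Theta>: "\<Theta> = spec_mat d U f" and U: "orthonormal_mat d U"
    and f: "\<And>k. k < d \<Longrightarrow> 0 < f k \<and> f k \<le> b"
  obtains V z where "orthonormal_mat d V" "\<And>k. k < d \<Longrightarrow> z k > 0"
    "log_ratio A \<Theta> = spec_mat d V (\<lambda>k. ln (z k))"
    "A - \<Theta> = spec_mat d U (\<lambda>k. sqrt (f k)) * spec_mat d V (\<lambda>k. z k - 1) * spec_mat d U (\<lambda>k. sqrt (f k))"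
proof -
  define R where "R = spec_mat d U (\<lambda>k. f k powr (- 1 / 2))"
  define H where "H = spec_mat d U (\<lambda>k. sqrt (f k))"
  have R: "mat_fun (\<lambda>x. x powr (- 1 / 2)) \<Theta> = R" unfolding \<Theta> R_def by (rule mat_fun_spec_mat[OF U])
  have c: "R \<in> carrier_mat d d" "H \<in> carrier_mat d d" "A \<in> carrier_mat d d"
    using spec_mat_carrier[OF U] PD_carrier[OF A] by (auto simp: R_def H_def)
  have HR: "H * R = 1\<^sub>m d" "R * H = 1\<^sub>m d"
  proof -
    have "sqrt (f k) * f k powr (- 1 / 2) = 1" if "k < d" for k
    proof -
      have "f k powr (1 / 2) * f k powr (- 1 / 2) = f k powr (1 / 2 + - 1 / 2)" by (rule powr_add[symmetric])
      then show ?thesis using f[OF that] by (simp add: powr_half_sqrt)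
    qed
    then show "H * R = 1\<^sub>m d" "R * H = 1\<^sub>m d"
      unfolding H_def R_def spec_mat_mult[OF U] spec_mat_one[OF U, symmetric]
      by (auto intro!: spec_mat_cong[OF U] simp: mult.commute)
  qed
  have HH: "H * H = \<Theta>" unfolding H_def \<Theta> spec_mat_mult[OF U]
    using f by (intro spec_mat_cong[OF U]) (simp add: less_imp_le)
  have "det R \<noteq> 0" using HR(1) c det_mult[OF c(2,1)] by auto
  from PD_congruence[OF c(1) this A] have "R * A * R \<in> PD d"
    by (simp add: R_def spec_mat_transpose[OF U])
  then obtain V z where V: "orthonormal_mat d V" and RAR: "R * A * R = spec_mat d V z" and z: "\<And>k. k < d \<Longrightarrow> z k > 0"
    using PD_eq_spec_mat by blast
  have "log_ratio A \<Theta> = spec_mat d V (\<lambda>k. ln (z k))"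
    unfolding log_ratio_def R Let_def RAR by (rule mat_fun_spec_mat[OF V])
  moreover have "A - \<Theta> = H * spec_mat d V (\<lambda>k. z k - 1) * H"
  proof -
    have Vc: "spec_mat d V z \<in> carrier_mat d d" by (rule spec_mat_carrier[OF V])
    note a = assoc_mult_mat[of _ d d _ d _ d] mult_carrier_mat[of _ d d _ d]
    have "H * spec_mat d V z * H = (H * R) * A * (R * H)" unfolding RAR[symmetric] using c by (simp add: a)
    also have "\<dots> = A" unfolding HR using c by simp
    finally have 1: "H * spec_mat d V z * H = A" .
    have "H * spec_mat d V (\<lambda>k. z k - 1) * H = H * (spec_mat d V z - 1\<^sub>m d) * H"
      by (simp only: spec_mat_minus[OF V, symmetric] spec_mat_one[OF V])
    also have "\<dots> = H * spec_mat d V z * H - H * H"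
      using c Vc by (simp add: mult_minus_distrib_mat[of _ d d _ d] minus_mult_distrib_mat[of _ d d _ _ d] mult_carrier_mat[of _ d d _ d])
    finally show ?thesis unfolding 1 HH ..
  qed
  ultimately show ?thesis using that[OF V z] by (simp add: H_def)
qed

lemma abs_minus_one_le_ln:
  fixes z :: real
  assumes "z > 0" "\<bar>ln z\<bar> \<le> 1 / 2"
  shows "\<bar>z - 1\<bar> \<le> 2 * \<bar>ln z\<bar>"
proof -
  have "exp (ln z) \<le> 1 + 2 * \<bar>ln z\<bar>" using exp_bound_lemma[of "ln z"] assms(2) by simp
  moreover have "1 + ln z \<le> exp (ln z)" by (rule exp_ge_add_one_self)
  ultimately show ?thesis using assms(1) by (auto simp: abs_if split: if_splits)
qed

definition frob_sq :: "nat \<Rightarrow> real mat \<Rightarrow> real" where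
  "frob_sq d A = (\<Sum>i<d. \<Sum>j<d. (A $$ (i,j))\<^sup>2)"

lemma frob_sq_transpose: "A \<in> carrier_mat d d \<Longrightarrow> frob_sq d (transpose_mat A) = frob_sq d A"
  unfolding frob_sq_def by (subst sum.swap) simp

text \<open>The product acts on the columns of \<open>A\<close> separately and stretches each by at
  most the factor \<open>c\<close>.\<close>

lemma frob_sq_spec_mult_le:
  assumes U: "orthonormal_mat d U" and c: "\<And>k. k < d \<Longrightarrow> \<bar>f k\<bar> \<le> c" and A: "A \<in> carrier_mat d d"
  shows "frob_sq d (spec_mat d U f * A) \<le> c\<^sup>2 * frob_sq d A"
proof -
  let ?S = "spec_mat d U f"
  have S: "?S \<in> carrier_mat d d" by (rule spec_mat_carrier[OF U])
  have cols: "frob_sq d M = (\<Sum>j<d. col M j \<bullet> col M j)" if "M \<in> carrier_mat d d" for M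
    unfolding frob_sq_def using that
    by (subst sum.swap) (simp add: scalar_prod_def atLeast0LessThan power2_eq_square)
  have "frob_sq d (?S * A) = (\<Sum>j<d. (?S *\<^sub>v col A j) \<bullet> (?S *\<^sub>v col A j))"
    using cols[of "?S * A"] S A by (simp add: mult_carrier_mat[of _ d d _ d] col_mult2[of _ d d _ d])
  also have "\<dots> \<le> (\<Sum>j<d. c\<^sup>2 * (col A j \<bullet> col A j))"
    using A by (intro sum_mono norm_spec_mat_le[OF U _ c]) auto
  also have "\<dots> = c\<^sup>2 * frob_sq d A" by (simp add: cols[OF A] sum_distrib_left)
  finally show ?thesis .
qed

text \<open>The squares of \<open>ln z\<close> sum to at most \<open>2 * \<delta>\<^sup>2\<close>.
  Since \<open>\<delta> \<le> 1 / 4\<close>, each \<open>\<bar>ln z\<bar>\<close> is at most 1/2,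
  where \<open>\<bar>z - 1\<bar> \<le> 2 * \<bar>ln z\<bar>\<close>. Each of the two square roots of
  \<open>\<Theta>\<close> costs a factor 5/4 on the square, and
  \<open>8 * 25 / 16 \<le> 16\<close>.\<close>

lemma d_FR_entries:
  assumes A: "A \<in> PD d" and \<Theta>: "\<Theta> = spec_mat d U f" and U: "orthonormal_mat d U"
    and f: "\<And>k. k < d \<Longrightarrow> 0 < f k \<and> f k \<le> 5 / 4"
    and \<delta>: "d_FR A \<Theta> < \<delta>" "\<delta> \<le> 1 / 4"
  shows "frob_sq d (A - \<Theta>) \<le> 16 * \<delta>\<^sup>2"
proof -
  obtain V z where V: "orthonormal_mat d V" and z: "\<And>k. k < d \<Longrightarrow> z k > 0"
    and L: "log_ratio A \<Theta> = spec_mat d V (\<lambda>k. ln (z k))"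
    and D: "A - \<Theta> = spec_mat d U (\<lambda>k. sqrt (f k)) * spec_mat d V (\<lambda>k. z k - 1) * spec_mat d U (\<lambda>k. sqrt (f k))"
    using log_ratio_spec[OF A \<Theta> U f] by blast
  have dim: "dim_row (log_ratio A \<Theta>) = d" "dim_col (log_ratio A \<Theta>) = d"
    unfolding L using spec_mat_carrier[OF V] by auto
  have dFR: "d_FR A \<Theta> = 1 / sqrt 2 * sqrt (\<Sum>k<d. (ln (z k))\<^sup>2)"
    unfolding d_FR_def frob_norm_def dim unfolding L frob_norm_spec_mat[OF V] ..
  have "0 \<le> d_FR A \<Theta>" unfolding dFR by (intro mult_nonneg_nonneg real_sqrt_ge_zero sum_nonneg) auto
  then have "(d_FR A \<Theta>)\<^sup>2 \<le> \<delta>\<^sup>2" using \<delta> by (intro power_mono) auto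
  moreover have "(d_FR A \<Theta>)\<^sup>2 = (\<Sum>k<d. (ln (z k))\<^sup>2) / 2"
    unfolding dFR by (simp add: power_mult_distrib power_divide sum_nonneg)
  ultimately have S: "(\<Sum>k<d. (ln (z k))\<^sup>2) \<le> 2 * \<delta>\<^sup>2" by simp
  have \<delta>2: "\<delta>\<^sup>2 \<le> 1 / 16"
    using \<open>0 \<le> d_FR A \<Theta>\<close> \<delta> power_mono[of \<delta> "1/4" 2] by (simp add: power2_eq_square)
  have zk: "(z k - 1)\<^sup>2 \<le> 4 * (ln (z k))\<^sup>2" if k: "k < d" for k
  proof -
    have "(ln (z k))\<^sup>2 \<le> (\<Sum>k<d. (ln (z k))\<^sup>2)" using k by (intro member_le_sum) auto
    then have "(ln (z k))\<^sup>2 \<le> (1 / 2)\<^sup>2" using S \<delta>2 by (simp add: power2_eq_square)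
    then have "\<bar>ln (z k)\<bar> \<le> 1 / 2" by (simp add: abs_le_square_iff[symmetric])
    from abs_minus_one_le_ln[OF z[OF k] this]
    have "\<bar>z k - 1\<bar>\<^sup>2 \<le> (2 * \<bar>ln (z k)\<bar>)\<^sup>2" by (intro power_mono) auto
    then show ?thesis by (simp add: power_mult_distrib)
  qed
  let ?H = "spec_mat d U (\<lambda>k. sqrt (f k))" and ?Y = "spec_mat d V (\<lambda>k. z k - 1)"
  have c: "?H \<in> carrier_mat d d" "?Y \<in> carrier_mat d d" using spec_mat_carrier U V by auto
  have sf: "\<bar>sqrt (f k)\<bar> \<le> sqrt (5 / 4)" if "k < d" for k using f[OF that] by auto
  have "frob_sq d (A - \<Theta>) = frob_sq d (?H * (?Y * ?H))"
    unfolding D using c by (simp add: assoc_mult_mat[of _ d d _ d _ d])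
  also have "\<dots> \<le> (sqrt (5 / 4))\<^sup>2 * frob_sq d (?Y * ?H)"
    by (rule frob_sq_spec_mult_le[OF U sf]) (use c in \<open>auto simp: mult_carrier_mat[of _ d d _ d]\<close>)
  \<comment> \<open>Transposition moves the right factor to the left, where the columnwise bound
    applies to it.\<close>
  also have "frob_sq d (?Y * ?H) = frob_sq d (?H * ?Y)"
    using frob_sq_transpose[of "?Y * ?H" d] c
    by (simp add: transpose_mult[of _ d d _ d] mult_carrier_mat[of _ d d _ d] spec_mat_transpose[OF U] spec_mat_transpose[OF V])
  also have "(sqrt (5 / 4))\<^sup>2 * \<dots> \<le> (sqrt (5 / 4))\<^sup>2 * ((sqrt (5 / 4))\<^sup>2 * frob_sq d ?Y)"
    by (intro mult_left_mono frob_sq_spec_mult_le[OF U sf]) (use c in auto)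
  also have "frob_sq d ?Y = (\<Sum>k<d. (z k - 1)\<^sup>2)"
    unfolding frob_sq_def by (rule frob_norm_spec_mat[OF V])
  also have "\<dots> \<le> (\<Sum>k<d. 4 * (ln (z k))\<^sup>2)" by (intro sum_mono zk) auto
  also have "\<dots> \<le> 8 * \<delta>\<^sup>2" using S by (simp add: sum_distrib_left[symmetric])
  finally show ?thesis by (simp add: mult_left_mono) (smt (verit) zero_le_power2)
qed

text \<open>The first column is the image of the first unit vector, and the three factors of
  \<open>A - \<Theta>\<close> are bounded one after the other in operator norm. The constant 16 is
  the one of the Fisher-Rao case, so that one theorem can serve both distances.\<close>

lemma d_op_entries:
  assumes A: "A \<in> PD d" and \<Theta>: "\<Theta> = spec_mat d U f" and U: "orthonormal_mat d U"
    and f: "\<And>k. k < d \<Longrightarrow> 0 < f k \<and> f k \<le> 5 / 4" and d: "0 < d"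
    and \<delta>: "d_op A \<Theta> < \<delta>" "\<delta> \<le> 1 / 4"
  shows "(\<Sum>i<d. ((A - \<Theta>) $$ (i,0))\<^sup>2) \<le> 16 * \<delta>\<^sup>2"
proof -
  obtain V z where V: "orthonormal_mat d V" and z: "\<And>k. k < d \<Longrightarrow> z k > 0"
    and L: "log_ratio A \<Theta> = spec_mat d V (\<lambda>k. ln (z k))"
    and D: "A - \<Theta> = spec_mat d U (\<lambda>k. sqrt (f k)) * spec_mat d V (\<lambda>k. z k - 1) * spec_mat d U (\<lambda>k. sqrt (f k))"
    using log_ratio_spec[OF A \<Theta> U f] by blast
  have ln: "\<bar>ln (z k)\<bar> \<le> \<delta>" if "k < d" for k
    using \<delta>(1) op_norm_spec_mat_le_iff[OF V d, of "\<lambda>k. ln (z k)" \<delta>] that by (simp add: d_op_def L)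
  then have \<delta>0: "0 \<le> \<delta>" using d by (meson abs_ge_zero order_trans)
  have zk: "\<bar>z k - 1\<bar> \<le> 2 * \<delta>" if k: "k < d" for k
    using abs_minus_one_le_ln[OF z[OF k]] ln[OF k] \<delta> by linarith
  let ?H = "spec_mat d U (\<lambda>k. sqrt (f k))" and ?Y = "spec_mat d V (\<lambda>k. z k - 1)"
  have c: "?H \<in> carrier_mat d d" "?Y \<in> carrier_mat d d" using spec_mat_carrier U V by auto
  have sf: "\<bar>sqrt (f k)\<bar> \<le> sqrt (5 / 4)" if "k < d" for k using f[OF that] by auto
  define e :: "real vec" where "e = unit_vec d 0"
  have e: "e \<in> carrier_vec d" "e \<bullet> e = 1" using d by (auto simp: e_def)
  define u where "u = ?H *\<^sub>v e"
  define y where "y = ?Y *\<^sub>v u"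
  have uy: "u \<in> carrier_vec d" "y \<in> carrier_vec d" using c e by (auto simp: u_def y_def)
  have AC: "A - \<Theta> \<in> carrier_mat d d" unfolding D using c by auto
  have "(A - \<Theta>) *\<^sub>v e = ?H *\<^sub>v y"
    unfolding D y_def u_def using c e
    by (simp add: assoc_mult_mat_vec[of _ d d _ d] mult_carrier_mat[of _ d d _ d])
  moreover have "(\<Sum>i<d. ((A - \<Theta>) $$ (i,0))\<^sup>2) = ((A - \<Theta>) *\<^sub>v e) \<bullet> ((A - \<Theta>) *\<^sub>v e)"
  proof -
    have "(\<Sum>i<d. (M $$ (i,0))\<^sup>2) = (M *\<^sub>v e) \<bullet> (M *\<^sub>v e)" if "M \<in> carrier_mat d d" for M
      using that d by (subst self_scalar_prod_real(1)[of _ d]) (auto simp: e_def)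
    from this[OF AC] show ?thesis .
  qed
  ultimately have "(\<Sum>i<d. ((A - \<Theta>) $$ (i,0))\<^sup>2) = (?H *\<^sub>v y) \<bullet> (?H *\<^sub>v y)" by simp
  also have "\<dots> \<le> (sqrt (5 / 4))\<^sup>2 * (y \<bullet> y)" by (rule norm_spec_mat_le[OF U uy(2) sf])
  also have "\<dots> \<le> (sqrt (5 / 4))\<^sup>2 * ((2 * \<delta>)\<^sup>2 * (u \<bullet> u))"
    unfolding y_def by (intro mult_left_mono norm_spec_mat_le[OF V uy(1) zk]) auto
  also have "\<dots> \<le> (sqrt (5 / 4))\<^sup>2 * ((2 * \<delta>)\<^sup>2 * ((sqrt (5 / 4))\<^sup>2 * (e \<bullet> e)))"
    unfolding u_def by (intro mult_left_mono norm_spec_mat_le[OF U e(1) sf]) auto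
  also have "\<dots> \<le> 16 * \<delta>\<^sup>2" using e by (simp add: power_mult_distrib)
  finally show ?thesis .
qed

section \<open>Measurability of the distances\<close>

lemma measurable_pow_mat_entry:
  assumes A: "\<And>z. z \<in> space M \<Longrightarrow> A z \<in> carrier_mat d d"
    and m: "\<And>i j. i < d \<Longrightarrow> j < d \<Longrightarrow> (\<lambda>z. A z $$ (i,j) :: real) \<in> borel_measurable M"
    and ij: "i < d" "j < d"
  shows "(\<lambda>z. (A z ^\<^sub>m k) $$ (i,j)) \<in> borel_measurable M"
  using ij
proof (induction k arbitrary: i j)
  case 0
  have "(A z ^\<^sub>m 0) $$ (i,j) = (if i = j then 1 else 0)" if "z \<in> space M" for z
    using 0 A[OF that] by simp
  then show ?case by (subst measurable_cong) auto
next
  case (Suc k)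
  have "(A z ^\<^sub>m Suc k) $$ (i,j) = (\<Sum>l<d. (A z ^\<^sub>m k) $$ (i,l) * A z $$ (l,j))" if "z \<in> space M" for z
    using Suc.prems A[OF that] pow_carrier_mat[OF A[OF that], of k]
    by (simp add: scalar_prod_def atLeast0LessThan)
  moreover have "(\<lambda>z. \<Sum>l<d. (A z ^\<^sub>m k) $$ (i,l) * A z $$ (l,j)) \<in> borel_measurable M"
    by (intro borel_measurable_sum borel_measurable_times Suc.IH m) (use Suc.prems in auto)
  ultimately show ?case by (subst measurable_cong) auto
qed

text \<open>\<open>f\<close> is a pointwise limit of polynomials on the positive axis, so the entries of \<open>f(A)\<close> are
  limits of polynomials in the entries of \<open>A\<close>.\<close>

lemma measurable_mat_fun_entry:
  assumes A: "\<And>z. z \<in> space M \<Longrightarrow> A z \<in> PD d"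
    and m: "\<And>i j. i < d \<Longrightarrow> j < d \<Longrightarrow> (\<lambda>z. A z $$ (i,j) :: real) \<in> borel_measurable M"
    and f: "continuous_on {0<..} f" and ij: "i < d" "j < d"
  shows "(\<lambda>z. mat_fun f (A z) $$ (i,j)) \<in> borel_measurable M"
proof -
  \<comment> \<open>These compact intervals exhaust the positive axis, so any finite set of positive
    eigenvalues eventually lies inside, where the approximation error tends to zero.\<close>
  have "\<exists>a N. \<forall>t \<in> {1 / real (Suc n)..real (Suc n)}. \<bar>f t - (\<Sum>k\<le>N. a k * t ^ k)\<bar> < 1 / real (Suc n)" for n
  proof -
    have "{1 / real (Suc n)..real (Suc n)} \<subseteq> {0<..}"
      by (auto intro: less_le_trans[of 0 "1 / real (Suc n)"])
    then have "continuous_on {1 / real (Suc n)..real (Suc n)} f" by (rule continuous_on_subset[OF f])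
    then obtain g where "real_polynomial_function g"
      "\<And>t. t \<in> {1 / real (Suc n)..real (Suc n)} \<Longrightarrow> \<bar>f t - g t\<bar> < 1 / real (Suc n)"
      using Stone_Weierstrass_real_polynomial_function[of "{1 / real (Suc n)..real (Suc n)}" f "1 / real (Suc n)"]
      by auto
    then show ?thesis unfolding real_polynomial_function_iff_sum by blast
  qed
  then obtain a N where aN: "\<And>n t. t \<in> {1 / real (Suc n)..real (Suc n)} \<Longrightarrow>
      \<bar>f t - (\<Sum>k\<le>N n. a n k * t ^ k)\<bar> < 1 / real (Suc n)"
    by metis
  define p where "p n t = (\<Sum>k\<le>N n. a n k * t ^ k)" for n t
  have lim: "(\<lambda>n. p n t) \<longlonglongrightarrow> f t" if t: "t > 0" for t
  proof -
    have "(\<lambda>n. p n t - f t) \<longlonglongrightarrow> 0"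
    proof (rule Lim_null_comparison)
      obtain n0 where n0: "real n0 \<ge> max t (1 / t)" using real_arch_simple by blast
      show "\<forall>\<^sub>F n in sequentially. norm (p n t - f t) \<le> 1 / real (Suc n)"
      proof (rule eventually_sequentiallyI[of n0])
        fix n assume n: "n0 \<le> n"
        then have "real n0 \<le> real n" by simp
        then have "t \<le> real (Suc n)" "1 / t \<le> real (Suc n)" using n0 by auto
        then have "t \<in> {1 / real (Suc n)..real (Suc n)}" using t by (auto simp: field_simps)
        from aN[OF this] show "norm (p n t - f t) \<le> 1 / real (Suc n)"
          by (simp add: p_def abs_minus_commute)
      qed
      show "(\<lambda>n. 1 / real (Suc n)) \<longlonglongrightarrow> 0"
        using LIMSEQ_inverse_real_of_nat by (simp add: inverse_eq_divide)
    qed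
    then show ?thesis by (simp add: LIM_zero_iff)
  qed
  show ?thesis
  proof (rule borel_measurable_LIMSEQ_real)
    show "(\<lambda>z. \<Sum>k\<le>N n. a n k * (A z ^\<^sub>m k) $$ (i,j)) \<in> borel_measurable M" for n
      by (intro borel_measurable_sum borel_measurable_times borel_measurable_const
          measurable_pow_mat_entry[OF PD_carrier[OF A] m ij])
    fix z assume z: "z \<in> space M"
    obtain U e where U: "orthonormal_mat d U" and Az: "A z = spec_mat d U e" and e: "\<And>k. k < d \<Longrightarrow> e k > 0"
      using PD_eq_spec_mat[OF A[OF z]] by blast
    have "(\<Sum>k\<le>N n. a n k * (A z ^\<^sub>m k) $$ (i,j)) = (\<Sum>l<d. U $$ (i,l) * p n (e l) * U $$ (j,l))" for n
    proof -
      have "(\<Sum>k\<le>N n. a n k * (A z ^\<^sub>m k) $$ (i,j)) = (\<Sum>k\<le>N n. \<Sum>l<d. U $$ (i,l) * (a n k * e l ^ k) * U $$ (j,l))"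
        unfolding Az spec_mat_pow[OF U] using ij
        by (simp add: spec_mat_index[OF U] sum_distrib_left mult_ac)
      also have "\<dots> = (\<Sum>l<d. \<Sum>k\<le>N n. U $$ (i,l) * (a n k * e l ^ k) * U $$ (j,l))" by (rule sum.swap)
      finally show ?thesis by (simp add: p_def sum_distrib_left sum_distrib_right)
    qed
    moreover have "(\<lambda>n. \<Sum>l<d. U $$ (i,l) * p n (e l) * U $$ (j,l)) \<longlonglongrightarrow> (\<Sum>l<d. U $$ (i,l) * f (e l) * U $$ (j,l))"
      by (intro tendsto_sum tendsto_mult tendsto_const lim e) auto
    ultimately show "(\<lambda>n. \<Sum>k\<le>N n. a n k * (A z ^\<^sub>m k) $$ (i,j)) \<longlonglongrightarrow> mat_fun f (A z) $$ (i,j)"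
      unfolding Az mat_fun_spec_mat[OF U] using ij by (simp add: spec_mat_index[OF U])
  qed
qed

lemma log_ratio_congruence:
  assumes \<Theta>: "\<Theta> \<in> PD d"
  obtains R where "R \<in> carrier_mat d d" "\<And>A. A \<in> PD d \<Longrightarrow> R * A * R \<in> PD d"
    "\<And>A. log_ratio A \<Theta> = mat_fun ln (R * A * R)"
proof -
  obtain U f where U: "orthonormal_mat d U" and \<Theta>': "\<Theta> = spec_mat d U f" and f: "\<And>k. k < d \<Longrightarrow> f k > 0"
    using PD_eq_spec_mat[OF \<Theta>] by blast
  define R where "R = spec_mat d U (\<lambda>k. f k powr (- 1 / 2))"
  have R: "R \<in> PD d" unfolding R_def spec_mat_PD_iff[OF U] using f by fastforce
  have "det R \<noteq> 0" using PD_det_pos[OF R] by simp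
  from PD_congruence[OF PD_carrier[OF R] this] show ?thesis
    using that[of R] PD_carrier[OF R] PD_transpose[OF R]
    by (simp add: log_ratio_def Let_def \<Theta>' mat_fun_spec_mat[OF U] R_def)
qed

lemma continuous_on_ln_pos: "continuous_on {0<..} (ln :: real \<Rightarrow> real)"
  by (intro continuous_intros) auto

context
  fixes d :: nat and M :: "'a measure" and T :: "'a \<Rightarrow> real mat" and \<Theta> :: "real mat"
  assumes T: "\<And>z. z \<in> space M \<Longrightarrow> T z \<in> PD d"
    and m: "\<And>i j. i < d \<Longrightarrow> j < d \<Longrightarrow> (\<lambda>z. T z $$ (i,j)) \<in> borel_measurable M"
    and \<Theta>: "\<Theta> \<in> PD d"
begin

lemma log_ratio_spectral_measurable:
  obtains S where "\<And>z. z \<in> space M \<Longrightarrow> S z \<in> PD d" "\<And>z. log_ratio (T z) \<Theta> = mat_fun ln (S z)"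
    "\<And>g i j. continuous_on {0<..} g \<Longrightarrow> i < d \<Longrightarrow> j < d \<Longrightarrow> (\<lambda>z. mat_fun g (S z) $$ (i,j)) \<in> borel_measurable M"
proof -
  obtain R where R: "R \<in> carrier_mat d d" "\<And>A. A \<in> PD d \<Longrightarrow> R * A * R \<in> PD d"
    "\<And>A. log_ratio A \<Theta> = mat_fun ln (R * A * R)"
    using log_ratio_congruence[OF \<Theta>] by blast
  have S: "R * T z * R \<in> PD d" if "z \<in> space M" for z using R(2) T[OF that] .
  have "(\<lambda>z. (R * T z * R) $$ (i,j)) \<in> borel_measurable M" if ij: "i < d" "j < d" for i j
  proof -
    have "(R * T z * R) $$ (i,j) = (\<Sum>k<d. R $$ (i,k) * (\<Sum>l<d. T z $$ (k,l) * R $$ (l,j)))"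
      if "z \<in> space M" for z
      using R(1) ij PD_carrier[OF T[OF that]] by (simp add: scalar_prod_def atLeast0LessThan)
    moreover have "(\<lambda>z. \<Sum>k<d. R $$ (i,k) * (\<Sum>l<d. T z $$ (k,l) * R $$ (l,j))) \<in> borel_measurable M"
      by (intro borel_measurable_sum borel_measurable_times borel_measurable_const m) auto
    ultimately show ?thesis by (subst measurable_cong) auto
  qed
  then show ?thesis
    using that[of "\<lambda>z. R * T z * R"] S R(3) measurable_mat_fun_entry[of M "\<lambda>z. R * T z * R" d] by blast
qed

lemma measurable_d_FR: "(\<lambda>z. d_FR (T z) \<Theta>) \<in> borel_measurable M"
proof -
  obtain S where S: "\<And>z. z \<in> space M \<Longrightarrow> S z \<in> PD d" "\<And>z. log_ratio (T z) \<Theta> = mat_fun ln (S z)"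
    and g: "\<And>g i j. continuous_on {0<..} g \<Longrightarrow> i < d \<Longrightarrow> j < d \<Longrightarrow> (\<lambda>z. mat_fun g (S z) $$ (i,j)) \<in> borel_measurable M"
    using log_ratio_spectral_measurable by blast
  have "d_FR (T z) \<Theta> = 1 / sqrt 2 * sqrt (\<Sum>i<d. \<Sum>j<d. (mat_fun ln (S z) $$ (i,j))\<^sup>2)" if z: "z \<in> space M" for z
  proof -
    obtain U e where "orthonormal_mat d U" "S z = spec_mat d U e" using PD_eq_spec_mat[OF S(1)[OF z]] by blast
    then show ?thesis by (simp add: d_FR_def frob_norm_def S(2) mat_fun_spec_mat)
  qed
  moreover have "(\<lambda>z. 1 / sqrt 2 * sqrt (\<Sum>i<d. \<Sum>j<d. (mat_fun ln (S z) $$ (i,j))\<^sup>2)) \<in> borel_measurable M"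
    by (intro borel_measurable_times borel_measurable_const borel_measurable_sqrt borel_measurable_sum
        borel_measurable_power g continuous_on_ln_pos measurable_compose[OF _ borel_measurable_sqrt]) auto
  ultimately show ?thesis by (subst measurable_cong) auto
qed

text \<open>The supremum in \<open>op_norm\<close> is uncountable, so sublevel sets are described
  spectrally instead: \<open>d_op\<close> is at most \<open>t\<close> exactly when the continuous
  function \<open>max 0 (\<bar>ln x\<bar> - t)\<close> vanishes on the spectrum, that is, when all
  entries of its functional calculus are zero.\<close>

lemma measurable_d_op:
  assumes d: "0 < d"
  shows "(\<lambda>z. d_op (T z) \<Theta>) \<in> borel_measurable M"
proof -
  obtain S where S: "\<And>z. z \<in> space M \<Longrightarrow> S z \<in> PD d" "\<And>z. log_ratio (T z) \<Theta> = mat_fun ln (S z)"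
    and g: "\<And>g i j. continuous_on {0<..} g \<Longrightarrow> i < d \<Longrightarrow> j < d \<Longrightarrow> (\<lambda>z. mat_fun g (S z) $$ (i,j)) \<in> borel_measurable M"
    using log_ratio_spectral_measurable by blast
  have "{z \<in> space M. d_op (T z) \<Theta> \<le> t} \<in> sets M" for t
  proof (cases "t < 0")
    case True
    have "\<not> d_op (T z) \<Theta> \<le> t" if z: "z \<in> space M" for z
    proof -
      obtain U e where U: "orthonormal_mat d U" "S z = spec_mat d U e" using PD_eq_spec_mat[OF S(1)[OF z]] by blast
      show ?thesis
        using op_norm_spec_mat_le_iff[OF U(1) d, of "\<lambda>k. ln (e k)" t] d True
        by (auto simp: d_op_def S(2) U(2) mat_fun_spec_mat[OF U(1)] intro!: exI[of _ 0])
    qed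
    then have "{z \<in> space M. d_op (T z) \<Theta> \<le> t} = {}" by auto
    then show ?thesis by (simp only: sets.empty_sets)
  next
    case False
    define h where "h x = max 0 (\<bar>ln x\<bar> - t)" for x :: real
    have h: "continuous_on {0<..} h" unfolding h_def by (intro continuous_intros) auto
    have "d_op (T z) \<Theta> \<le> t \<longleftrightarrow> (\<forall>i\<in>{..<d}. \<forall>j\<in>{..<d}. mat_fun h (S z) $$ (i,j) = 0)" if z: "z \<in> space M" for z
    proof -
      obtain U e where U: "orthonormal_mat d U" "S z = spec_mat d U e" using PD_eq_spec_mat[OF S(1)[OF z]] by blast
      have "d_op (T z) \<Theta> \<le> t \<longleftrightarrow> (\<forall>k<d. \<bar>ln (e k)\<bar> \<le> t)"
        using op_norm_spec_mat_le_iff[OF U(1) d, of "\<lambda>k. ln (e k)" t]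
        by (simp add: d_op_def S(2) U(2) mat_fun_spec_mat[OF U(1)])
      also have "\<dots> \<longleftrightarrow> (\<forall>k<d. h (e k) = 0)" by (auto simp: h_def)
      finally show ?thesis
        using spec_mat_eq_0_iff[OF U(1), of "\<lambda>k. h (e k)"] by (simp add: Ball_def U(2) mat_fun_spec_mat[OF U(1)])
    qed
    then have "{z \<in> space M. d_op (T z) \<Theta> \<le> t}
        = {z \<in> space M. \<forall>i\<in>{..<d}. \<forall>j\<in>{..<d}. mat_fun h (S z) $$ (i,j) = 0}" by auto
    also have "\<dots> \<in> sets M"
      by (intro sets.sets_Collect_finite_All' sets.sets_Collect_finite_All borel_measurable_eq g h) auto
    finally show ?thesis .
  qed
  then show ?thesis unfolding borel_measurable_iff_le by auto
qed

end

section \<open>Testing many hypotheses\<close>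

lemma ennreal_half: "(1 / 2 :: ennreal) = ennreal (1 / 2)"
proof -
  have "ennreal 1 / ennreal 2 = ennreal (1 / 2)" by (rule divide_ennreal) auto
  then show ?thesis by simp
qed

text \<open>The likelihoods enter through \<open>f \<le> R f\<^sub>0 + g / (4 R)\<close> where \<open>g = f\<^sup>2 / f\<^sub>0\<close>, so that the first
  term sees only the bound on \<open>\<Sum> k\<close> and the second only the chi-square bound.\<close>

lemma average_success_le_half:
  fixes f g :: "'s \<Rightarrow> 'v \<Rightarrow> real" and f0 :: "'v \<Rightarrow> real" and k :: "'s \<Rightarrow> 'v \<Rightarrow> ennreal"
  assumes fin: "finite \<Sigma>" "\<Sigma> \<noteq> {}"
    and mf: "\<And>\<sigma>. \<sigma> \<in> \<Sigma> \<Longrightarrow> f \<sigma> \<in> borel_measurable M" "f0 \<in> borel_measurable M"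
      "\<And>\<sigma>. \<sigma> \<in> \<Sigma> \<Longrightarrow> g \<sigma> \<in> borel_measurable M" "\<And>\<sigma>. \<sigma> \<in> \<Sigma> \<Longrightarrow> k \<sigma> \<in> borel_measurable M"
    and nonneg: "\<And>\<sigma> v. \<sigma> \<in> \<Sigma> \<Longrightarrow> 0 \<le> f \<sigma> v" "\<And>v. 0 \<le> f0 v" "\<And>\<sigma> v. \<sigma> \<in> \<Sigma> \<Longrightarrow> 0 \<le> g \<sigma> v"
    and fg: "\<And>\<sigma> v. \<sigma> \<in> \<Sigma> \<Longrightarrow> (f \<sigma> v)\<^sup>2 = f0 v * g \<sigma> v"
    and f0: "(\<integral>\<^sup>+v. ennreal (f0 v) \<partial>M) \<le> 1"
    and g: "\<And>\<sigma>. \<sigma> \<in> \<Sigma> \<Longrightarrow> (\<integral>\<^sup>+v. ennreal (g \<sigma> v) \<partial>M) \<le> ennreal R"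
    and k: "AE v in M. \<forall>\<sigma>\<in>\<Sigma>. k \<sigma> v \<le> 1" "AE v in M. (\<Sum>\<sigma>\<in>\<Sigma>. k \<sigma> v) \<le> ennreal (\<beta> * real (card \<Sigma>))"
    and R: "R > 0" "0 \<le> \<beta>" "4 * R * \<beta> \<le> 1"
  shows "\<exists>\<sigma>\<in>\<Sigma>. (\<integral>\<^sup>+v. ennreal (f \<sigma> v) * k \<sigma> v \<partial>M) \<le> 1 / 2"
proof (rule ccontr)
  assume "\<not> ?thesis"
  then have gt: "(\<integral>\<^sup>+v. ennreal (f \<sigma> v) * k \<sigma> v \<partial>M) > 1 / 2" if "\<sigma> \<in> \<Sigma>" for \<sigma> using that by force
  let ?C = "real (card \<Sigma>)"
  have C: "?C > 0" using fin by (simp add: card_gt_0_iff)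
  \<comment> \<open>The inequality of arithmetic and geometric means: the product of the two
    summands is a quarter of the square of \<open>f\<close>.\<close>
  have le: "f \<sigma> v \<le> R * f0 v + g \<sigma> v / (4 * R)" if \<sigma>: "\<sigma> \<in> \<Sigma>" for \<sigma> v
  proof (rule power2_le_imp_le)
    have "(R * f0 v + g \<sigma> v / (4 * R))\<^sup>2 - f0 v * g \<sigma> v = (R * f0 v - g \<sigma> v / (4 * R))\<^sup>2"
      using R by (simp add: power2_eq_square field_simps)
    then show "(f \<sigma> v)\<^sup>2 \<le> (R * f0 v + g \<sigma> v / (4 * R))\<^sup>2"
      unfolding fg[OF \<sigma>] by (smt (verit) zero_le_power2)
    show "0 \<le> R * f0 v + g \<sigma> v / (4 * R)" using nonneg \<sigma> R by simp
  qed
  have term_le: "(\<integral>\<^sup>+v. ennreal (f \<sigma> v) * k \<sigma> v \<partial>M)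
     \<le> (\<integral>\<^sup>+v. ennreal (R * f0 v) * k \<sigma> v \<partial>M) + ennreal (1 / 4)" if \<sigma>: "\<sigma> \<in> \<Sigma>" for \<sigma>
  proof -
    have "(\<integral>\<^sup>+v. ennreal (f \<sigma> v) * k \<sigma> v \<partial>M) \<le> (\<integral>\<^sup>+v. ennreal (R * f0 v) * k \<sigma> v + ennreal (g \<sigma> v / (4 * R)) \<partial>M)"
    proof (rule nn_integral_mono_AE)
      from k(1) show "AE v in M. ennreal (f \<sigma> v) * k \<sigma> v \<le> ennreal (R * f0 v) * k \<sigma> v + ennreal (g \<sigma> v / (4 * R))"
      proof (rule AE_mp, intro AE_I2 impI)
        fix v assume "\<forall>\<sigma>\<in>\<Sigma>. k \<sigma> v \<le> 1"
        then have k1: "k \<sigma> v \<le> 1" using \<sigma> by simp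
        have "ennreal (f \<sigma> v) * k \<sigma> v \<le> ennreal (R * f0 v + g \<sigma> v / (4 * R)) * k \<sigma> v"
          using le[OF \<sigma>] by (intro mult_right_mono ennreal_leI) auto
        also have "\<dots> = ennreal (R * f0 v) * k \<sigma> v + ennreal (g \<sigma> v / (4 * R)) * k \<sigma> v"
          using nonneg \<sigma> R by (simp add: distrib_right)
        also have "\<dots> \<le> ennreal (R * f0 v) * k \<sigma> v + ennreal (g \<sigma> v / (4 * R)) * 1"
          by (intro add_left_mono mult_left_mono k1) auto
        finally show "ennreal (f \<sigma> v) * k \<sigma> v \<le> ennreal (R * f0 v) * k \<sigma> v + ennreal (g \<sigma> v / (4 * R))" by simp
      qed
    qed
    also have "\<dots> = (\<integral>\<^sup>+v. ennreal (R * f0 v) * k \<sigma> v \<partial>M) + (\<integral>\<^sup>+v. ennreal (g \<sigma> v / (4 * R)) \<partial>M)"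
      using mf \<sigma> by (intro nn_integral_add) auto
    also have "(\<integral>\<^sup>+v. ennreal (g \<sigma> v / (4 * R)) \<partial>M) = ennreal (1 / (4 * R)) * (\<integral>\<^sup>+v. ennreal (g \<sigma> v) \<partial>M)"
      using mf \<sigma> R nonneg by (subst nn_integral_cmult[symmetric]) (auto simp: ennreal_mult'[symmetric])
    also have "\<dots> \<le> ennreal (1 / (4 * R)) * ennreal R" by (intro mult_left_mono g \<sigma>) auto
    also have "\<dots> = ennreal (1 / 4)" using R by (simp add: ennreal_mult'[symmetric])
    finally show ?thesis by (simp add: add_left_mono)
  qed
  have "(\<Sum>\<sigma>\<in>\<Sigma>. \<integral>\<^sup>+v. ennreal (f \<sigma> v) * k \<sigma> v \<partial>M)
     \<le> (\<Sum>\<sigma>\<in>\<Sigma>. (\<integral>\<^sup>+v. ennreal (R * f0 v) * k \<sigma> v \<partial>M) + ennreal (1 / 4))"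
    by (intro sum_mono term_le)
  also have "\<dots> = (\<integral>\<^sup>+v. ennreal (R * f0 v) * (\<Sum>\<sigma>\<in>\<Sigma>. k \<sigma> v) \<partial>M) + ennreal (?C / 4)"
  proof -
    have "(\<Sum>\<sigma>\<in>\<Sigma>. \<integral>\<^sup>+v. ennreal (R * f0 v) * k \<sigma> v \<partial>M) = (\<integral>\<^sup>+v. (\<Sum>\<sigma>\<in>\<Sigma>. ennreal (R * f0 v) * k \<sigma> v) \<partial>M)"
      using mf by (intro nn_integral_sum[symmetric]) auto
    moreover have "(\<Sum>\<sigma>\<in>\<Sigma>. ennreal (1 / 4)) = ennreal (?C / 4)"
      by (simp only: sum_constant) (simp add: ennreal_of_nat_eq_real_of_nat ennreal_mult'[symmetric])
    ultimately show ?thesis by (simp add: sum.distrib sum_distrib_left)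
  qed
  also have "(\<integral>\<^sup>+v. ennreal (R * f0 v) * (\<Sum>\<sigma>\<in>\<Sigma>. k \<sigma> v) \<partial>M)
     \<le> (\<integral>\<^sup>+v. ennreal (R * (\<beta> * ?C)) * ennreal (f0 v) \<partial>M)"
  proof (rule nn_integral_mono_AE)
    from k(2) show "AE v in M. ennreal (R * f0 v) * (\<Sum>\<sigma>\<in>\<Sigma>. k \<sigma> v) \<le> ennreal (R * (\<beta> * ?C)) * ennreal (f0 v)"
    proof (rule AE_mp, intro AE_I2 impI)
      fix v assume "(\<Sum>\<sigma>\<in>\<Sigma>. k \<sigma> v) \<le> ennreal (\<beta> * ?C)"
      then have "ennreal (R * f0 v) * (\<Sum>\<sigma>\<in>\<Sigma>. k \<sigma> v) \<le> ennreal (R * f0 v) * ennreal (\<beta> * ?C)"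
        by (intro mult_left_mono) auto
      also have "\<dots> = ennreal (R * (\<beta> * ?C)) * ennreal (f0 v)"
        using R nonneg(2)[of v] by (simp add: ennreal_mult'[symmetric] mult_ac)
      finally show "ennreal (R * f0 v) * (\<Sum>\<sigma>\<in>\<Sigma>. k \<sigma> v) \<le> ennreal (R * (\<beta> * ?C)) * ennreal (f0 v)" .
    qed
  qed
  also have "\<dots> = ennreal (R * (\<beta> * ?C)) * (\<integral>\<^sup>+v. ennreal (f0 v) \<partial>M)"
    using mf by (intro nn_integral_cmult) auto
  also have "\<dots> \<le> ennreal (R * (\<beta> * ?C)) * 1" by (intro mult_left_mono f0) auto
  also have "\<dots> \<le> ennreal (?C / 4)"
  proof -
    have "R * (\<beta> * ?C) * 4 \<le> 1 * ?C" using mult_right_mono[OF R(3), of ?C] C by (simp add: mult_ac)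
    then show ?thesis by (simp add: ennreal_leI)
  qed
  finally have "(\<Sum>\<sigma>\<in>\<Sigma>. \<integral>\<^sup>+v. ennreal (f \<sigma> v) * k \<sigma> v \<partial>M) \<le> ennreal (?C / 4) + ennreal (?C / 4)"
    by (simp add: add_right_mono)
  then have le2: "(\<Sum>\<sigma>\<in>\<Sigma>. \<integral>\<^sup>+v. ennreal (f \<sigma> v) * k \<sigma> v \<partial>M) \<le> ennreal (?C / 2)"
    using C by (simp add: ennreal_plus[symmetric] del: ennreal_plus)
  define r where "r \<sigma> = enn2real (\<integral>\<^sup>+v. ennreal (f \<sigma> v) * k \<sigma> v \<partial>M)" for \<sigma>
  have r: "(\<integral>\<^sup>+v. ennreal (f \<sigma> v) * k \<sigma> v \<partial>M) = ennreal (r \<sigma>)" if "\<sigma> \<in> \<Sigma>" for \<sigma>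
  proof -
    have "(\<integral>\<^sup>+v. ennreal (f \<sigma> v) * k \<sigma> v \<partial>M) \<le> (\<Sum>\<sigma>\<in>\<Sigma>. \<integral>\<^sup>+v. ennreal (f \<sigma> v) * k \<sigma> v \<partial>M)"
      using that fin by (intro member_le_sum) auto
    also have "\<dots> < \<top>" using le2 by (rule le_less_trans) simp
    finally show ?thesis by (simp add: r_def)
  qed
  have r_gt: "r \<sigma> > 1 / 2" if "\<sigma> \<in> \<Sigma>" for \<sigma>
  proof -
    have "ennreal (1 / 2) < ennreal (r \<sigma>)" using gt[OF that] unfolding r[OF that] ennreal_half .
    then show ?thesis by (subst (asm) ennreal_less_iff) auto
  qed
  have "(\<Sum>\<sigma>\<in>\<Sigma>. \<integral>\<^sup>+v. ennreal (f \<sigma> v) * k \<sigma> v \<partial>M) = (\<Sum>\<sigma>\<in>\<Sigma>. ennreal (r \<sigma>))"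
    by (intro sum.cong r) auto
  also have "\<dots> = ennreal (\<Sum>\<sigma>\<in>\<Sigma>. r \<sigma>)" by (intro sum_ennreal) (simp add: r_def)
  finally have "(\<Sum>\<sigma>\<in>\<Sigma>. r \<sigma>) \<le> ?C / 2" using le2 C by (simp add: ennreal_le_iff)
  moreover have "(\<Sum>\<sigma>\<in>\<Sigma>. r \<sigma>) > (\<Sum>\<sigma>\<in>\<Sigma>. 1 / 2)" by (intro sum_strict_mono fin r_gt)
  ultimately show False by simp
qed

text \<open>At most six integers lie at distance less than 3 from \<open>u\<close>; every other term
  is at most \<open>exp (- 9)\<close>. For 1000 grid points the total is below 8.\<close>

lemma sum_exp_grid_le: "(\<Sum>k<q. exp (- (u - real k)\<^sup>2)) \<le> 6 + real q * exp (- 9)"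
proof -
  define B where "B = {k. k < q \<and> \<bar>u - real k\<bar> < 3}"
  have B: "finite B" "B \<subseteq> {..<q}" by (auto simp: B_def)
  have "card B \<le> card {\<lfloor>u\<rfloor> - 2..\<lfloor>u\<rfloor> + 3}"
  proof (rule card_inj_on_le[of int])
    show "int ` B \<subseteq> {\<lfloor>u\<rfloor> - 2..\<lfloor>u\<rfloor> + 3}" by (auto simp: B_def) linarith+
  qed auto
  then have cB: "real (card B) \<le> 6" by simp
  have "(\<Sum>k<q. exp (- (u - real k)\<^sup>2)) \<le> (\<Sum>k<q. (if k \<in> B then 1 else 0) + exp (- 9))"
  proof (rule sum_mono)
    fix k assume k: "k \<in> {..<q}"
    show "exp (- (u - real k)\<^sup>2) \<le> (if k \<in> B then 1 else 0) + exp (- 9)"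
    proof (cases "k \<in> B")
      case True
      have "exp (- (u - real k)\<^sup>2) \<le> 1" by simp
      then show ?thesis using True by (simp add: add_increasing2)
    next
      case False
      then have "3 \<le> \<bar>u - real k\<bar>" using k by (auto simp: B_def)
      from power_mono[OF this, of 2] have "9 \<le> (u - real k)\<^sup>2" by simp
      then show ?thesis using False by simp
    qed
  qed
  also have "\<dots> = real (card B) + real q * exp (- 9)"
    using B by (simp add: sum.distrib sum.If_cases Int_absorb1)
  finally show ?thesis using cB by simp
qed

text \<open>Chernoff bound: on the ball the weight \<open>w\<close> is at least
  \<open>exp (- m)\<close>, where \<open>m = card I\<close>, and its sum over the full grid
  factorises over the coordinates. With \<open>e \<le> 3\<close> the ball has at most
  \<open>(3 * 8)^m\<close> points, and \<open>8 * 24 = 192 \<le> 1000\<close>.\<close>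

lemma grid_small_ball:
  fixes t :: "'i \<Rightarrow> real"
  assumes I: "finite I" and s: "s > 0"
  shows "8 ^ card I * card {\<sigma> \<in> I \<rightarrow>\<^sub>E {..<1000::nat}. (\<Sum>i\<in>I. (t i - s * real (\<sigma> i))\<^sup>2) \<le> s\<^sup>2 * real (card I)}
    \<le> (1000::nat) ^ card I"
proof -
  let ?P = "I \<rightarrow>\<^sub>E {..<1000::nat}"
  let ?B = "{\<sigma> \<in> ?P. (\<Sum>i\<in>I. (t i - s * real (\<sigma> i))\<^sup>2) \<le> s\<^sup>2 * real (card I)}"
  define w where "w \<sigma> = (\<Prod>i\<in>I. exp (- (t i / s - real (\<sigma> i))\<^sup>2))" for \<sigma> :: "'i \<Rightarrow> nat"
  have finP: "finite ?P" using I by (intro finite_PiE) auto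
  have w: "1 \<le> exp 1 ^ card I * w \<sigma>" if \<sigma>: "\<sigma> \<in> ?B" for \<sigma>
  proof -
    have "(t i - s * real (\<sigma> i))\<^sup>2 = s\<^sup>2 * (t i / s - real (\<sigma> i))\<^sup>2" for i
      using s by (simp add: power_mult_distrib[symmetric] field_simps)
    then have "s\<^sup>2 * (\<Sum>i\<in>I. (t i / s - real (\<sigma> i))\<^sup>2) \<le> s\<^sup>2 * real (card I)"
      using \<sigma> by (simp add: sum_distrib_left)
    then have "(\<Sum>i\<in>I. (t i / s - real (\<sigma> i))\<^sup>2) \<le> real (card I)" using s by simp
    then have "exp 0 \<le> exp (real (card I) + (\<Sum>i\<in>I. - (t i / s - real (\<sigma> i))\<^sup>2))"
      by (simp add: sum_negf)
    then show ?thesis using I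
      by (simp only: exp_add exp_sum w_def) (simp add: exp_of_nat_mult[of _ 1, simplified, symmetric])
  qed
  have "real (card ?B) = (\<Sum>\<sigma>\<in>?B. 1)" by simp
  also have "\<dots> \<le> (\<Sum>\<sigma>\<in>?B. exp 1 ^ card I * w \<sigma>)" by (intro sum_mono w)
  also have "\<dots> \<le> (\<Sum>\<sigma>\<in>?P. exp 1 ^ card I * w \<sigma>)"
    using finP by (intro sum_mono2) (auto simp: w_def prod_nonneg)
  also have "\<dots> = exp 1 ^ card I * (\<Prod>i\<in>I. \<Sum>k<1000. exp (- (t i / s - real k)\<^sup>2))"
    unfolding w_def sum_distrib_left[symmetric] using I by (subst prod_sum_PiE) auto
  also have "\<dots> \<le> 3 ^ card I * (\<Prod>i\<in>I. 8)"
  proof (intro mult_mono prod_mono power_mono conjI)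
    fix i
    have "exp (- 9) \<le> (1 / 500 :: real)"
    proof -
      have "(2::real) ^ 9 \<le> exp 1 ^ 9" using exp_ge_add_one_self[of "1::real"] by (intro power_mono) auto
      also have "exp 1 ^ 9 = exp (9::real)" by (simp add: exp_of_nat_mult[of 9 1, simplified, symmetric])
      finally show ?thesis by (simp add: exp_minus inverse_eq_divide field_simps)
    qed
    then show "(\<Sum>k<1000. exp (- (t i / s - real k)\<^sup>2)) \<le> 8"
      using sum_exp_grid_le[of "t i / s" 1000] by simp
  qed (auto intro!: exp_le sum_nonneg prod_nonneg)
  also have "\<dots> = 24 ^ card I" by (simp add: power_mult_distrib[symmetric])
  finally have "real (8 ^ card I * card ?B) \<le> 8 ^ card I * 24 ^ card I" by simp
  also have "\<dots> = 192 ^ card I" by (simp add: power_mult_distrib[symmetric])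
  also have "\<dots> \<le> real (1000 ^ card I)" unfolding of_nat_power of_nat_numeral by (intro power_mono) auto
  finally show ?thesis unfolding of_nat_le_iff .
qed

section \<open>Chi-square bounds\<close>

lemma kronecker_one_right: "kronecker A (1\<^sub>m 1) = A"
  by (rule eq_matI) (auto simp: kronecker_index)

lemma kronecker_lincomb_right:
  assumes "B \<in> carrier_mat m k" "C \<in> carrier_mat m k"
  shows "kronecker A (a \<cdot>\<^sub>m B + b \<cdot>\<^sub>m C) = a \<cdot>\<^sub>m kronecker A B + b \<cdot>\<^sub>m kronecker A C"
  using assms div_mod_less
  by (intro eq_matI) (auto simp: kronecker_index algebra_simps)

lemma kronecker_lincomb_left:
  assumes "B \<in> carrier_mat m k" "C \<in> carrier_mat m k"
  shows "kronecker (a \<cdot>\<^sub>m B + b \<cdot>\<^sub>m C) A = a \<cdot>\<^sub>m kronecker B A + b \<cdot>\<^sub>m kronecker C A"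
  using assms div_mod_less
  by (intro eq_matI) (auto simp: kronecker_index algebra_simps)

text \<open>\<open>g\<close> is the squared density divided by the standard one. Its exponent is
  that of a Gaussian whose precision has \<open>2 \<Theta> - 1\<close> in place of
  \<open>\<Theta>\<close>; positivity of that matrix makes the divergence finite, and the
  normalising constants leave the determinant ratio. The parameters \<open>p\<close> and
  \<open>r\<close> let the statement cover both the data themselves and the latent matrix
  \<open>V\<close>.\<close>

lemma gaussian_chi_square:
  assumes \<Theta>: "\<Theta> \<in> PD d" and \<Psi>: "\<Psi> \<in> PD d" "\<Psi> = 2 \<cdot>\<^sub>m \<Theta> + (- 1) \<cdot>\<^sub>m 1\<^sub>m d" and K: "K = p * (d * r)"
  defines "P \<equiv> kronecker (1\<^sub>m p) (kronecker \<Theta> (1\<^sub>m r))"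
  obtains g where "g \<in> borel_measurable (lborel_pi K)" "\<And>x. 0 \<le> g x"
    "\<And>x. (gdens K P x)\<^sup>2 = gdens K (1\<^sub>m K) x * g x"
    "(\<integral>\<^sup>+x. ennreal (g x) \<partial>lborel_pi K) = ennreal ((det \<Theta> / sqrt (det \<Psi>)) ^ (p * r))"
proof -
  define P2 where "P2 = kronecker (1\<^sub>m p) (kronecker \<Psi> (1\<^sub>m r))"
  have KP: "kronecker \<Theta> (1\<^sub>m r) \<in> PD (d * r)" "kronecker \<Psi> (1\<^sub>m r) \<in> PD (d * r)"
    by (intro kronecker_PD \<Theta> \<Psi> PD_one)+
  have P: "P \<in> PD K" "P2 \<in> PD K" unfolding P_def P2_def K by (intro kronecker_PD KP PD_one)+
  have det: "det P = det \<Theta> ^ (p * r)" "det P2 = det \<Psi> ^ (p * r)"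
    unfolding P_def P2_def kronecker_PD(2)[OF PD_one KP(1)] kronecker_PD(2)[OF PD_one KP(2)]
      kronecker_PD(2)[OF \<Theta> PD_one] kronecker_PD(2)[OF \<Psi>(1) PD_one]
    by (simp_all add: power_mult[symmetric] mult.commute)
  have dpos: "det \<Theta> > 0" "det \<Psi> > 0" "det P > 0" "det P2 > 0"
    using PD_det_pos \<Theta> \<Psi>(1) P by auto
  have "P2 = 2 \<cdot>\<^sub>m P + (- 1) \<cdot>\<^sub>m 1\<^sub>m K"
    unfolding P2_def P_def \<Psi>(2) using PD_carrier[OF \<Theta>] kronecker_carrier[OF PD_carrier[OF \<Theta>] one_carrier_mat, of r]
    by (simp add: kronecker_lincomb_left[of _ d d] kronecker_lincomb_right[of _ "d * r" "d * r"] kronecker_one K)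
  then have q: "qform K P2 x = 2 * qform K P x - qform K (1\<^sub>m K) x" for x
    using PD_carrier[OF P(1)]
    by (simp add: qform_sum algebra_simps sum.distrib sum_distrib_left sum_subtractf)
  define c where "c = det P / sqrt (det P2)"
  define g where "g x = c * gdens K P2 x" for x
  have c0: "c \<ge> 0" using dpos by (simp add: c_def)
  have c: "c = (det \<Theta> / sqrt (det \<Psi>)) ^ (p * r)"
    unfolding c_def det by (simp add: real_sqrt_power power_divide)
  have [measurable]: "P2 \<in> carrier_mat K K" using PD_carrier[OF P(2)] .
  have "(gdens K P x)\<^sup>2 = gdens K (1\<^sub>m K) x * g x" for x
  proof -
    have "(gdens K P x)\<^sup>2 = det P / (2 * pi) ^ K * exp (- qform K P x)"
      using dpos unfolding gdens_def power_mult_distrib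
      by (simp add: exp_double[symmetric] power_divide)
    also have "exp (- qform K P x) = exp (- qform K (1\<^sub>m K) x / 2) * exp (- qform K P2 x / 2)"
      unfolding exp_add[symmetric] q by (simp add: field_simps)
    also have "det P / (2 * pi) ^ K = sqrt (1 / (2 * pi) ^ K) * (c * sqrt (det P2 / (2 * pi) ^ K))"
    proof -
      have "sqrt (1 / (2 * pi) ^ K) * sqrt (1 / (2 * pi) ^ K) = 1 / (2 * pi) ^ K" by simp
      moreover have "sqrt (det P2 / (2 * pi) ^ K) = sqrt (det P2) * sqrt (1 / (2 * pi) ^ K)"
        by (simp add: real_sqrt_mult[symmetric])
      moreover have "c * sqrt (det P2) = det P" using dpos by (simp add: c_def)
      ultimately have "sqrt (1 / (2 * pi) ^ K) * (c * sqrt (det P2 / (2 * pi) ^ K)) = det P * (1 / (2 * pi) ^ K)"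
        by (simp only: mult_ac) (simp only: mult.assoc[symmetric])
      then show ?thesis by simp
    qed
    finally show ?thesis by (simp add: g_def gdens_def mult_ac)
  qed
  moreover have "(\<integral>\<^sup>+x. ennreal (g x) \<partial>lborel_pi K) = ennreal c"
  proof -
    have "(\<integral>\<^sup>+x. ennreal (g x) \<partial>lborel_pi K) = (\<integral>\<^sup>+x. ennreal c * ennreal (gdens K P2 x) \<partial>lborel_pi K)"
      using c0 by (simp add: g_def ennreal_mult')
    also have "\<dots> = ennreal c" by (subst nn_integral_cmult) (auto simp: nn_integral_gdens[OF P(2)])
    finally show ?thesis .
  qed
  moreover have "g \<in> borel_measurable (lborel_pi K)" unfolding g_def by measurable
  moreover have "0 \<le> g x" for x using c0 gdens_nonneg[OF P(2)] by (simp add: g_def)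
  ultimately show ?thesis using that c by simp
qed

text \<open>The contribution of one eigenvalue when the precision is \<open>1 + \<mu>\<close>, as
  for the data, or \<open>1 / (1 + \<mu>)\<close>, as for \<open>V\<close>. The squares are
  \<open>1 + \<mu>\<^sup>2 / (1 + 2 * \<mu>)\<close> and \<open>1 / (1 - \<mu>\<^sup>2)\<close>:
  there is no linear term, so the divergence is governed by the sum of the squares of
  \<open>\<mu>\<close>.\<close>

lemma chi_square_factor_le:
  fixes \<mu> :: real
  assumes "\<bar>\<mu>\<bar> \<le> 1 / 4"
  shows "(1 + \<mu>) / sqrt (1 + 2 * \<mu>) \<le> exp (\<mu>\<^sup>2)"
    "(1 / (1 + \<mu>)) / sqrt (2 * (1 / (1 + \<mu>)) - 1) \<le> exp (\<mu>\<^sup>2)"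
proof -
  have \<mu>: "- 1 / 4 \<le> \<mu>" "\<mu> \<le> 1 / 4" using assms by auto
  have m2: "\<mu>\<^sup>2 \<le> 1 / 16" using power_mono[OF assms, of 2] by (simp add: power2_eq_square)
  have e: "1 + 2 * \<mu>\<^sup>2 \<le> (exp (\<mu>\<^sup>2))\<^sup>2"
    using exp_ge_add_one_self[of "2 * \<mu>\<^sup>2"] by (simp add: exp_double)
  show "(1 + \<mu>) / sqrt (1 + 2 * \<mu>) \<le> exp (\<mu>\<^sup>2)"
  proof (rule power2_le_imp_le)
    have "(1 + \<mu>)\<^sup>2 \<le> (1 + 2 * \<mu>\<^sup>2) * (1 + 2 * \<mu>)"
    proof -
      have "(1 + 2 * \<mu>\<^sup>2) * (1 + 2 * \<mu>) - (1 + \<mu>)\<^sup>2 = \<mu>\<^sup>2 * (1 + 4 * \<mu>)"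
        by (simp add: power2_eq_square algebra_simps)
      also have "\<dots> \<ge> 0" using \<mu> by (intro mult_nonneg_nonneg) auto
      finally show ?thesis by simp
    qed
    then have "(1 + \<mu>)\<^sup>2 / (1 + 2 * \<mu>) \<le> 1 + 2 * \<mu>\<^sup>2" using \<mu> by (simp add: divide_le_eq)
    then show "((1 + \<mu>) / sqrt (1 + 2 * \<mu>))\<^sup>2 \<le> (exp (\<mu>\<^sup>2))\<^sup>2" using e \<mu> by (simp add: power_divide)
  qed simp
  show "(1 / (1 + \<mu>)) / sqrt (2 * (1 / (1 + \<mu>)) - 1) \<le> exp (\<mu>\<^sup>2)"
  proof (rule power2_le_imp_le)
    have pos: "1 - \<mu>\<^sup>2 > 0" "1 + \<mu> > 0" "1 - \<mu> > 0" using m2 \<mu> by auto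
    have eq: "2 * (1 / (1 + \<mu>)) - 1 = (1 - \<mu>) / (1 + \<mu>)" using pos by (simp add: field_simps)
    have "((1 / (1 + \<mu>)) / sqrt (2 * (1 / (1 + \<mu>)) - 1))\<^sup>2 = (1 / (1 + \<mu>))\<^sup>2 / ((1 - \<mu>) / (1 + \<mu>))"
      unfolding eq power_divide[of "1 / (1 + \<mu>)"] using pos by (subst real_sqrt_pow2) auto
    also have "\<dots> = 1 / ((1 + \<mu>) * (1 - \<mu>))" using pos by (simp add: power2_eq_square)
    also have "(1 + \<mu>) * (1 - \<mu>) = 1 - \<mu>\<^sup>2" by (simp add: power2_eq_square algebra_simps)
    also have "1 / (1 - \<mu>\<^sup>2) \<le> 1 + 2 * \<mu>\<^sup>2"
    proof -
      have "(1 + 2 * \<mu>\<^sup>2) * (1 - \<mu>\<^sup>2) - 1 = \<mu>\<^sup>2 * (1 - 2 * \<mu>\<^sup>2)" by (simp add: algebra_simps)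
      also have "\<dots> \<ge> 0" using m2 by (intro mult_nonneg_nonneg) auto
      finally show ?thesis using pos by (simp add: divide_le_eq)
    qed
    finally show "((1 / (1 + \<mu>)) / sqrt (2 * (1 / (1 + \<mu>)) - 1))\<^sup>2 \<le> (exp (\<mu>\<^sup>2))\<^sup>2" using e by simp
  qed simp
qed

section \<open>The family of hypotheses\<close>

text \<open>\<open>I\<close> holds positions on or above the diagonal, and \<open>min\<close>,
  \<open>max\<close> reflect them below it. Each free entry thus is one independent grid coordinate
  of spacing \<open>s\<close>.\<close>

definition perturbation :: "nat \<Rightarrow> (nat \<times> nat) set \<Rightarrow> real \<Rightarrow> (nat \<times> nat \<Rightarrow> nat) \<Rightarrow> real mat" where
  "perturbation d I s \<sigma> = mat d d (\<lambda>(i,j).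
     if (min i j, max i j) \<in> I then s * real (\<sigma> (min i j, max i j)) else 0)"

text \<open>The Frobenius norm controls everything: each free entry occurs at most twice and its
  square is at most \<open>1000\<^sup>2 * s\<^sup>2\<close>. The condition on \<open>s\<close> makes
  the sum of squared eigenvalues at most 1/16, hence each eigenvalue at most 1/4 in absolute
  value.\<close>

lemma perturbation_spec:
  assumes I: "I \<subseteq> {(i,j). i \<le> j \<and> j < d}" and \<sigma>: "\<sigma> \<in> I \<rightarrow>\<^sub>E {..<1000}"
    and s: "32 * 1000\<^sup>2 * real (card I) * s\<^sup>2 \<le> 1"
  obtains U \<mu> where "orthonormal_mat d U" "perturbation d I s \<sigma> = spec_mat d U \<mu>"
    "\<And>k. k < d \<Longrightarrow> \<bar>\<mu> k\<bar> \<le> 1 / 4" "(\<Sum>k<d. (\<mu> k)\<^sup>2) \<le> 2 * 1000\<^sup>2 * real (card I) * s\<^sup>2"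
proof -
  let ?E = "perturbation d I s \<sigma>" and ?c = "1000\<^sup>2 * s\<^sup>2"
  have E: "?E \<in> carrier_mat d d" by (simp add: perturbation_def)
  have "transpose_mat ?E = ?E"
    by (rule eq_matI) (auto simp: perturbation_def min.commute max.commute)
  then obtain U \<mu> where U: "orthonormal_mat d U" and EU: "?E = spec_mat d U \<mu>"
    using symmetric_eq_spec_mat[OF E] by blast
  have Isub: "I \<subseteq> {..<d} \<times> {..<d}" using I by auto
  then have fin: "finite I" by (rule finite_subset) simp
  have count: "(\<Sum>i<d. \<Sum>j<d. if (i,j) \<in> I then ?c else 0) = real (card I) * ?c"
  proof -
    have "(\<Sum>i<d. \<Sum>j<d. if (i,j) \<in> I then ?c else 0) = (\<Sum>p\<in>{..<d} \<times> {..<d}. if p \<in> I then ?c else 0)"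
      by (simp add: sum.cartesian_product split_beta')
    also have "\<dots> = (\<Sum>p\<in>({..<d} \<times> {..<d}) \<inter> I. ?c)" by (rule sum.inter_restrict[symmetric]) simp
    also have "({..<d} \<times> {..<d}) \<inter> I = I" using Isub by auto
    finally show ?thesis by simp
  qed
  have "(\<Sum>k<d. (\<mu> k)\<^sup>2) = (\<Sum>i<d. \<Sum>j<d. (?E $$ (i,j))\<^sup>2)"
    unfolding EU by (rule frob_norm_spec_mat[OF U, symmetric])
  also have "\<dots> \<le> (\<Sum>i<d. \<Sum>j<d. (if (i,j) \<in> I then ?c else 0) + (if (j,i) \<in> I then ?c else 0))"
  proof (intro sum_mono)
    fix i j assume ij: "i \<in> {..<d}" "j \<in> {..<d}"
    have le: "(s * real (\<sigma> p))\<^sup>2 \<le> ?c" if "p \<in> I" for p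
    proof -
      have "\<sigma> p < 1000" using \<sigma> that by (auto dest: PiE_mem)
      then have "(real (\<sigma> p))\<^sup>2 \<le> 1000\<^sup>2" by (intro power_mono) auto
      then have "(real (\<sigma> p))\<^sup>2 * s\<^sup>2 \<le> ?c" by (intro mult_right_mono) auto
      then show ?thesis by (simp add: power_mult_distrib mult.commute)
    qed
    have "(min i j, max i j) = (i,j) \<or> (min i j, max i j) = (j,i)" by (auto simp: min_def max_def)
    then show "(?E $$ (i,j))\<^sup>2 \<le> (if (i,j) \<in> I then ?c else 0) + (if (j,i) \<in> I then ?c else 0)"
    proof
      assume eq: "(min i j, max i j) = (i,j)"
      then have "?E $$ (i,j) = (if (i,j) \<in> I then s * real (\<sigma> (i,j)) else 0)" using ij by (simp only: perturbation_def index_mat lessThan_iff split eq)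
      then have "(?E $$ (i,j))\<^sup>2 \<le> (if (i,j) \<in> I then ?c else 0)" using le[of "(i,j)"] by auto
      also have "\<dots> \<le> \<dots> + (if (j,i) \<in> I then ?c else 0)" by simp
      finally show ?thesis .
    next
      assume eq: "(min i j, max i j) = (j,i)"
      then have "?E $$ (i,j) = (if (j,i) \<in> I then s * real (\<sigma> (j,i)) else 0)" using ij by (simp only: perturbation_def index_mat lessThan_iff split eq)
      then have "(?E $$ (i,j))\<^sup>2 \<le> (if (j,i) \<in> I then ?c else 0)" using le[of "(j,i)"] by auto
      also have "\<dots> \<le> (if (i,j) \<in> I then ?c else 0) + \<dots>" by simp
      finally show ?thesis .
    qed
  qed
  also have "\<dots> = 2 * (real (card I) * ?c)"
    unfolding sum.distrib count using sum.swap[of "\<lambda>i j. if (j,i) \<in> I then ?c else 0" "{..<d}" "{..<d}"] count by simp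
  finally have S: "(\<Sum>k<d. (\<mu> k)\<^sup>2) \<le> 2 * 1000\<^sup>2 * real (card I) * s\<^sup>2" by (simp add: mult_ac)
  have "\<bar>\<mu> k\<bar> \<le> 1 / 4" if k: "k < d" for k
  proof -
    have "(\<mu> k)\<^sup>2 \<le> (\<Sum>k<d. (\<mu> k)\<^sup>2)" using k by (intro member_le_sum) auto
    also have "\<dots> \<le> (1 / 4)\<^sup>2" using S s by (simp add: power2_eq_square)
    finally show ?thesis by (simp add: abs_le_square_iff[symmetric])
  qed
  then show ?thesis using that U EU S by blast
qed

lemma op_ball_one_plus:
  assumes U: "orthonormal_mat d U" and \<mu>: "\<And>k. k < d \<Longrightarrow> \<bar>\<mu> k\<bar> \<le> 1 / 4" and d: "0 < d"
  shows "1\<^sub>m d + spec_mat d U \<mu> \<in> op_ball d" "1\<^sub>m d + spec_mat d U \<mu> = spec_mat d U (\<lambda>k. 1 + \<mu> k)"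
    "\<And>k. k < d \<Longrightarrow> 0 < 1 + \<mu> k \<and> 1 + \<mu> k \<le> 5 / 4"
proof -
  show eq: "1\<^sub>m d + spec_mat d U \<mu> = spec_mat d U (\<lambda>k. 1 + \<mu> k)"
    unfolding spec_mat_one[OF U, symmetric] by (rule spec_mat_add[OF U])
  show pos: "0 < 1 + \<mu> k \<and> 1 + \<mu> k \<le> 5 / 4" if "k < d" for k using \<mu>[OF that] by auto
  have "spec_mat d U (\<lambda>k. 1 + \<mu> k) - 1\<^sub>m d = spec_mat d U \<mu>"
    unfolding spec_mat_one[OF U, symmetric] spec_mat_minus[OF U] by simp
  moreover have "op_norm (spec_mat d U \<mu>) \<le> 1 / 4"
    using \<mu> op_norm_spec_mat_le_iff[OF U d, of \<mu> "1 / 4"] by blast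
  ultimately show "1\<^sub>m d + spec_mat d U \<mu> \<in> op_ball d"
    unfolding eq op_ball_def using pos by (auto simp: spec_mat_PD_iff[OF U])
qed

text \<open>The eigenvalue factors multiply to an exponential with exponent at most
  \<open>m / 16\<close>, and \<open>exp (1 / 16)\<close> is below 2.\<close>

lemma det_ratio_le:
  assumes U: "orthonormal_mat d U" and S: "real c * (\<Sum>k<d. (\<mu> k)\<^sup>2) \<le> real m / 16"
    and \<phi>: "\<And>k. k < d \<Longrightarrow> 0 < \<phi> k \<and> 0 < \<psi> k \<and> \<phi> k / sqrt (\<psi> k) \<le> exp ((\<mu> k)\<^sup>2)"
  shows "(det (spec_mat d U \<phi>) / sqrt (det (spec_mat d U \<psi>))) ^ c \<le> 2 ^ m"
proof -
  have sq: "sqrt (\<Prod>k<d. \<psi> k) = (\<Prod>k<d. sqrt (\<psi> k))" by (induction d) (auto simp: real_sqrt_mult)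
  have "det (spec_mat d U \<phi>) / sqrt (det (spec_mat d U \<psi>)) = (\<Prod>k<d. \<phi> k / sqrt (\<psi> k))"
    unfolding det_spec_mat[OF U] sq by (simp add: prod_dividef)
  also have "\<dots> \<le> (\<Prod>k<d. exp ((\<mu> k)\<^sup>2))" using \<phi> by (intro prod_mono) (auto simp: less_imp_le)
  also have "\<dots> = exp (\<Sum>k<d. (\<mu> k)\<^sup>2)" by (simp add: exp_sum)
  finally have "(det (spec_mat d U \<phi>) / sqrt (det (spec_mat d U \<psi>))) ^ c \<le> exp (\<Sum>k<d. (\<mu> k)\<^sup>2) ^ c"
    using \<phi> by (intro power_mono) (auto simp: det_spec_mat[OF U] less_imp_le intro!: divide_nonneg_nonneg prod_nonneg)
  also have "\<dots> = exp (real c * (\<Sum>k<d. (\<mu> k)\<^sup>2))" by (simp add: exp_of_nat_mult)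
  also have "\<dots> \<le> exp (real m * (1 / 16))" using S by simp
  also have "\<dots> = exp (1 / 16) ^ m" by (rule exp_of_nat_mult)
  also have "\<dots> \<le> 2 ^ m" using real_exp_bound_lemma[of "1 / 16"] by (intro power_mono) auto
  finally show ?thesis .
qed

section \<open>Observations through a channel\<close>

text \<open>The observation is drawn from \<open>\<kappa> v\<close>, where the latent Gaussian \<open>v\<close> alone depends on the
  hypothesis.\<close>

lemma channel_error_ge_half:
  fixes \<kappa> :: "(nat \<Rightarrow> real) \<Rightarrow> 'x measure" and Sp :: "'x measure"
  assumes fin: "finite \<Sigma>" "\<Sigma> \<noteq> {}" and K: "K = p * (d * r)"
    and \<Phi>: "\<And>\<sigma>. \<sigma> \<in> \<Sigma> \<Longrightarrow> \<Phi> \<sigma> \<in> PD d" "\<And>\<sigma>. \<sigma> \<in> \<Sigma> \<Longrightarrow> 2 \<cdot>\<^sub>m \<Phi> \<sigma> + (- 1) \<cdot>\<^sub>m 1\<^sub>m d \<in> PD d"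
      "\<And>\<sigma>. \<sigma> \<in> \<Sigma> \<Longrightarrow> (det (\<Phi> \<sigma>) / sqrt (det (2 \<cdot>\<^sub>m \<Phi> \<sigma> + (- 1) \<cdot>\<^sub>m 1\<^sub>m d))) ^ (p * r) \<le> R"
    and \<kappa>: "\<And>v. sets (\<kappa> v) = sets Sp" "AE v in lborel_pi K. emeasure (\<kappa> v) (space Sp) = 1"
      "\<And>S. S \<in> sets Sp \<Longrightarrow> (\<lambda>v. emeasure (\<kappa> v) S) \<in> borel_measurable (lborel_pi K)"
    and D: "\<And>\<sigma>. \<sigma> \<in> \<Sigma> \<Longrightarrow> D \<sigma> \<in> sets Sp"
      "\<And>X. X \<in> space Sp \<Longrightarrow> real (card {\<sigma> \<in> \<Sigma>. X \<in> D \<sigma>}) \<le> \<beta> * real (card \<Sigma>)"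
    and R: "R > 0" "0 \<le> \<beta>" "4 * R * \<beta> \<le> 1"
  shows "\<exists>\<sigma>\<in>\<Sigma>. 1 / 2 \<le> (\<integral>\<^sup>+v. ennreal (gdens K (kronecker (1\<^sub>m p) (kronecker (\<Phi> \<sigma>) (1\<^sub>m r))) v) *
    emeasure (\<kappa> v) (space Sp - D \<sigma>) \<partial>lborel_pi K)"
proof -
  define P where "P \<sigma> = kronecker (1\<^sub>m p) (kronecker (\<Phi> \<sigma>) (1\<^sub>m r))" for \<sigma>
  have P: "P \<sigma> \<in> PD K" if "\<sigma> \<in> \<Sigma>" for \<sigma>
    unfolding P_def K by (intro kronecker_PD PD_one \<Phi>(1) that)
  have mP: "gdens K (P \<sigma>) \<in> borel_measurable (lborel_pi K)" if "\<sigma> \<in> \<Sigma>" for \<sigma>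
    by (rule measurable_gdens_lborel_pi[OF PD_carrier[OF P[OF that]]])
  have space_\<kappa>: "space (\<kappa> v) = space Sp" for v using \<kappa>(1) by (rule sets_eq_imp_space_eq)
  have "\<exists>g. g \<in> borel_measurable (lborel_pi K) \<and> (\<forall>x. 0 \<le> g x) \<and>
      (\<forall>x. (gdens K (P \<sigma>) x)\<^sup>2 = gdens K (1\<^sub>m K) x * g x) \<and>
      (\<integral>\<^sup>+x. ennreal (g x) \<partial>lborel_pi K) \<le> ennreal R" if \<sigma>: "\<sigma> \<in> \<Sigma>" for \<sigma>
  proof -
    obtain g where g: "g \<in> borel_measurable (lborel_pi K)" "\<And>x. 0 \<le> g x"
      "\<And>x. (gdens K (P \<sigma>) x)\<^sup>2 = gdens K (1\<^sub>m K) x * g x"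
      "(\<integral>\<^sup>+x. ennreal (g x) \<partial>lborel_pi K)
         = ennreal ((det (\<Phi> \<sigma>) / sqrt (det (2 \<cdot>\<^sub>m \<Phi> \<sigma> + (- 1) \<cdot>\<^sub>m 1\<^sub>m d))) ^ (p * r))"
      using gaussian_chi_square[OF \<Phi>(1)[OF \<sigma>] \<Phi>(2)[OF \<sigma>] refl K] unfolding P_def by metis
    then show ?thesis using ennreal_leI[OF \<Phi>(3)[OF \<sigma>]] by (intro exI[of _ g]) auto
  qed
  then obtain g where g: "\<And>\<sigma>. \<sigma> \<in> \<Sigma> \<Longrightarrow> g \<sigma> \<in> borel_measurable (lborel_pi K)"
    "\<And>\<sigma> x. \<sigma> \<in> \<Sigma> \<Longrightarrow> 0 \<le> g \<sigma> x" "\<And>\<sigma> x. \<sigma> \<in> \<Sigma> \<Longrightarrow> (gdens K (P \<sigma>) x)\<^sup>2 = gdens K (1\<^sub>m K) x * g \<sigma> x"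
    "\<And>\<sigma>. \<sigma> \<in> \<Sigma> \<Longrightarrow> (\<integral>\<^sup>+x. ennreal (g \<sigma> x) \<partial>lborel_pi K) \<le> ennreal R"
    by metis
  \<comment> \<open>No single observation lies in more than a fraction \<open>\<beta>\<close> of the
    success sets; integrating this count over \<open>\<kappa> v\<close> bounds the sum of the
    success probabilities.\<close>
  have k_sum: "(\<Sum>\<sigma>\<in>\<Sigma>. emeasure (\<kappa> v) (D \<sigma>)) \<le> ennreal (\<beta> * real (card \<Sigma>))"
    if v: "emeasure (\<kappa> v) (space Sp) = 1" for v
  proof -
    have "(\<Sum>\<sigma>\<in>\<Sigma>. emeasure (\<kappa> v) (D \<sigma>)) = (\<Sum>\<sigma>\<in>\<Sigma>. \<integral>\<^sup>+X. indicator (D \<sigma>) X \<partial>\<kappa> v)"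
      using D(1) \<kappa>(1) by (intro sum.cong refl) auto
    also have "\<dots> = (\<integral>\<^sup>+X. (\<Sum>\<sigma>\<in>\<Sigma>. indicator (D \<sigma>) X) \<partial>\<kappa> v)"
      by (intro nn_integral_sum[symmetric] borel_measurable_indicator) (simp add: D(1) \<kappa>(1))
    also have "\<dots> \<le> (\<integral>\<^sup>+X. ennreal (\<beta> * real (card \<Sigma>)) \<partial>\<kappa> v)"
    proof (rule nn_integral_mono)
      fix X assume "X \<in> space (\<kappa> v)"
      then have X: "X \<in> space Sp" by (simp add: space_\<kappa>)
      have "(\<Sum>\<sigma>\<in>\<Sigma>. indicator (D \<sigma>) X :: ennreal) = (\<Sum>\<sigma>\<in>{\<sigma> \<in> \<Sigma>. X \<in> D \<sigma>}. 1)"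
        using fin by (intro sum.mono_neutral_cong_right) auto
      also have "\<dots> = ennreal (real (card {\<sigma> \<in> \<Sigma>. X \<in> D \<sigma>}))"
        by (simp add: ennreal_of_nat_eq_real_of_nat)
      also have "\<dots> \<le> ennreal (\<beta> * real (card \<Sigma>))" by (rule ennreal_leI[OF D(2)[OF X]])
      finally show "(\<Sum>\<sigma>\<in>\<Sigma>. indicator (D \<sigma>) X) \<le> ennreal (\<beta> * real (card \<Sigma>))" .
    qed
    also have "\<dots> = ennreal (\<beta> * real (card \<Sigma>))" using v by (simp add: space_\<kappa>)
    finally show ?thesis .
  qed
  have "\<exists>\<sigma>\<in>\<Sigma>. (\<integral>\<^sup>+v. ennreal (gdens K (P \<sigma>) v) * emeasure (\<kappa> v) (D \<sigma>) \<partial>lborel_pi K) \<le> 1 / 2"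
  proof (rule average_success_le_half[where ?f0.0 = "gdens K (1\<^sub>m K)" and g = g and R = R and \<beta> = \<beta>])
    show "AE v in lborel_pi K. \<forall>\<sigma>\<in>\<Sigma>. emeasure (\<kappa> v) (D \<sigma>) \<le> 1"
      using \<kappa>(2)
    proof (rule AE_mp, intro AE_I2 impI ballI)
      fix v \<sigma> assume "emeasure (\<kappa> v) (space Sp) = 1" "\<sigma> \<in> \<Sigma>"
      then show "emeasure (\<kappa> v) (D \<sigma>) \<le> 1"
        using emeasure_space[of "\<kappa> v" "D \<sigma>"] by (simp add: space_\<kappa>)
    qed
    show "AE v in lborel_pi K. (\<Sum>\<sigma>\<in>\<Sigma>. emeasure (\<kappa> v) (D \<sigma>)) \<le> ennreal (\<beta> * real (card \<Sigma>))"
      using \<kappa>(2) by (rule AE_mp) (auto intro!: AE_I2 k_sum)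
    show "(\<integral>\<^sup>+v. ennreal (gdens K (1\<^sub>m K) v) \<partial>lborel_pi K) \<le> 1"
      by (simp add: nn_integral_gdens[OF PD_one])
    show "gdens K (1\<^sub>m K) \<in> borel_measurable (lborel_pi K)" by measurable
  qed (use fin g \<kappa>(3) D(1) mP R gdens_nonneg P PD_one in auto)
  then obtain \<sigma> where \<sigma>: "\<sigma> \<in> \<Sigma>"
    and le: "(\<integral>\<^sup>+v. ennreal (gdens K (P \<sigma>) v) * emeasure (\<kappa> v) (D \<sigma>) \<partial>lborel_pi K) \<le> 1 / 2" by blast
  have halves: "(1 / 2 :: ennreal) + 1 / 2 = 1"
    unfolding ennreal_half by (subst ennreal_plus[symmetric]) auto
  have S: "space Sp - D \<sigma> \<in> sets Sp" using D(1)[OF \<sigma>] by auto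
  have mf: "(\<lambda>v. ennreal (gdens K (P \<sigma>) v)) \<in> borel_measurable (lborel_pi K)"
    using mP[OF \<sigma>] by simp
  \<comment> \<open>Success and failure probabilities add up to one, so success at most 1/2 leaves
    failure at least 1/2.\<close>
  have "1 = (\<integral>\<^sup>+v. ennreal (gdens K (P \<sigma>) v) \<partial>lborel_pi K)" by (simp add: nn_integral_gdens[OF P[OF \<sigma>]])
  also have "\<dots> = (\<integral>\<^sup>+v. ennreal (gdens K (P \<sigma>) v) * emeasure (\<kappa> v) (D \<sigma>) +
      ennreal (gdens K (P \<sigma>) v) * emeasure (\<kappa> v) (space Sp - D \<sigma>) \<partial>lborel_pi K)"
  proof (rule nn_integral_cong_AE)
    show "AE v in lborel_pi K. ennreal (gdens K (P \<sigma>) v) = ennreal (gdens K (P \<sigma>) v) * emeasure (\<kappa> v) (D \<sigma>) +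
      ennreal (gdens K (P \<sigma>) v) * emeasure (\<kappa> v) (space Sp - D \<sigma>)"
      using \<kappa>(2)
    proof (rule AE_mp, intro AE_I2 impI)
      fix v assume 1: "emeasure (\<kappa> v) (space Sp) = 1"
      have "emeasure (\<kappa> v) (D \<sigma>) + emeasure (\<kappa> v) (space Sp - D \<sigma>) = emeasure (\<kappa> v) (D \<sigma> \<union> (space Sp - D \<sigma>))"
        using D(1)[OF \<sigma>] S by (intro plus_emeasure) (auto simp: \<kappa>(1))
      also have "D \<sigma> \<union> (space Sp - D \<sigma>) = space Sp" using sets.sets_into_space[OF D(1)[OF \<sigma>]] by auto
      finally show "ennreal (gdens K (P \<sigma>) v) = ennreal (gdens K (P \<sigma>) v) * emeasure (\<kappa> v) (D \<sigma>) +
        ennreal (gdens K (P \<sigma>) v) * emeasure (\<kappa> v) (space Sp - D \<sigma>)"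
        using 1 by (simp add: distrib_left[symmetric])
    qed
  qed
  also have "\<dots> = (\<integral>\<^sup>+v. ennreal (gdens K (P \<sigma>) v) * emeasure (\<kappa> v) (D \<sigma>) \<partial>lborel_pi K) +
      (\<integral>\<^sup>+v. ennreal (gdens K (P \<sigma>) v) * emeasure (\<kappa> v) (space Sp - D \<sigma>) \<partial>lborel_pi K)"
    using mf \<kappa>(3)[OF D(1)[OF \<sigma>]] \<kappa>(3)[OF S] by (intro nn_integral_add borel_measurable_times_ennreal)
  also have "\<dots> \<le> 1 / 2 + (\<integral>\<^sup>+v. ennreal (gdens K (P \<sigma>) v) * emeasure (\<kappa> v) (space Sp - D \<sigma>) \<partial>lborel_pi K)"
    by (intro add_right_mono le)
  finally have "1 / 2 + 1 / 2 \<le> 1 / 2 + (\<integral>\<^sup>+v. ennreal (gdens K (P \<sigma>) v) * emeasure (\<kappa> v) (space Sp - D \<sigma>) \<partial>lborel_pi K)"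
    by (simp only: halves)
  then show ?thesis using \<sigma> unfolding P_def[symmetric]
    by (intro bexI[of _ \<sigma>]) (auto simp: ennreal_add_left_cancel_le ennreal_half)
qed

text \<open>For \<open>\<Theta>2 = 1\<close> the latent vector is the flattened data, so the channel
  is a point mass.\<close>

lemma direct_channel:
  assumes \<Theta>: "\<Theta> \<in> PD d1" and S: "S \<in> sets (sample_space n d1 d2)"
    and c: "\<And>\<Theta>2. \<Theta>2 \<in> PD d2 \<Longrightarrow> emeasure (sample_law n d1 d2 \<Theta> \<Theta>2) S \<le> c"
  shows "(\<integral>\<^sup>+v. ennreal (gdens (n * (d1 * d2)) (kronecker (1\<^sub>m n) (kronecker \<Theta> (1\<^sub>m d2))) v) *
    emeasure (return (sample_space n d1 d2) (unflat n (d1 * d2) v)) S \<partial>lborel_pi (n * (d1 * d2))) \<le> c"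
  using c[OF PD_one] unfolding emeasure_sample_law[OF \<Theta> PD_one S]
  by (simp add: emeasure_return[OF S] mult.commute)

text \<open>A bound valid for every \<open>\<Theta>2\<close> survives averaging over
  \<open>\<Theta>2 = W W^T\<close>. The equality of the two mixture densities rewrites that average
  as the probability of \<open>S\<close> when the data are produced from \<open>V\<close>, so
  \<open>c\<close> bounds the latter as well.\<close>

lemma mixture_channel:
  assumes \<Theta>: "\<Theta> \<in> PD d1" and S: "S \<in> sets (sample_space n d1 d2)" and n: "0 < n * d1"
    and c: "\<And>\<Theta>2. \<Theta>2 \<in> PD d2 \<Longrightarrow> emeasure (sample_law n d1 d2 \<Theta> \<Theta>2) S \<le> c"
  defines "N \<equiv> n * d1"
  shows "(\<integral>\<^sup>+v. ennreal (gdens (N * N) (kronecker (1\<^sub>m N) (inv_mat (kronecker (1\<^sub>m n) \<Theta>))) v) *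
    (\<integral>\<^sup>+x. indicator S (unflat n (d1 * d2) x) * ennreal (left_kernel N d2 v x) \<partial>lborel_pi (N * d2)) \<partial>lborel_pi (N * N)) \<le> c"
proof -
  define B where "B = kronecker (1\<^sub>m n) \<Theta>"
  define F where "F x = (indicator S (unflat n (d1 * d2) x) :: ennreal)" for x
  have B: "B \<in> PD N" unfolding B_def N_def by (intro kronecker_PD PD_one \<Theta>)
  have ND: "N * d2 = n * (d1 * d2)" by (simp add: N_def mult.assoc)
  have S': "S \<in> sets (\<Pi>\<^sub>M k\<in>{..<n}. lborel_pi (d1 * d2))" using S by (simp add: sets_sample_law)
  have F: "F \<in> borel_measurable (lborel_pi (N * d2))"
    unfolding F_def ND by (rule measurable_compose[OF measurable_unflat borel_measurable_indicator[OF S']])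
  have g1: "(\<lambda>w. ennreal (gdens (d2 * d2) (1\<^sub>m (d2 * d2)) w)) \<in> borel_measurable (lborel_pi (d2 * d2))" by measurable
  have KI: "kronecker (1\<^sub>m N) (inv_mat B) \<in> PD (N * N)" by (intro kronecker_PD PD_one PD_inv_mat B)
  have gv: "(\<lambda>v. ennreal (gdens (N * N) (kronecker (1\<^sub>m N) (inv_mat B)) v)) \<in> borel_measurable (lborel_pi (N * N))"
    using PD_carrier[OF KI] by measurable
  have "(\<integral>\<^sup>+v. ennreal (gdens (N * N) (kronecker (1\<^sub>m N) (inv_mat B)) v) *
      (\<integral>\<^sup>+x. F x * ennreal (left_kernel N d2 v x) \<partial>lborel_pi (N * d2)) \<partial>lborel_pi (N * N))
    = (\<integral>\<^sup>+x. F x * (\<integral>\<^sup>+v. ennreal (gdens (N * N) (kronecker (1\<^sub>m N) (inv_mat B)) v) *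
        ennreal (left_kernel N d2 v x) \<partial>lborel_pi (N * N)) \<partial>lborel_pi (N * d2))"
    by (rule nn_integral_mixture(1)[OF gv measurable_left_kernel F])
  also have "\<dots> = (\<integral>\<^sup>+x. F x * (\<integral>\<^sup>+w. ennreal (gdens (d2 * d2) (1\<^sub>m (d2 * d2)) w) *
        ennreal (right_kernel N d2 B w x) \<partial>lborel_pi (d2 * d2)) \<partial>lborel_pi (N * d2))"
    by (intro nn_integral_cong arg_cong[where f="\<lambda>y. _ * y"] mixture_densities_eq[OF B, symmetric])
  also have "\<dots> = (\<integral>\<^sup>+w. ennreal (gdens (d2 * d2) (1\<^sub>m (d2 * d2)) w) *
        (\<integral>\<^sup>+x. F x * ennreal (right_kernel N d2 B w x) \<partial>lborel_pi (N * d2)) \<partial>lborel_pi (d2 * d2))"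
    by (rule nn_integral_mixture(1)[OF g1 measurable_right_kernel[OF PD_carrier[OF B]] F, symmetric])
  also have "\<dots> \<le> (\<integral>\<^sup>+w. ennreal (gdens (d2 * d2) (1\<^sub>m (d2 * d2)) w) * c \<partial>lborel_pi (d2 * d2))"
  proof (intro nn_integral_mono mult_left_mono)
    fix w
    show "(\<integral>\<^sup>+x. F x * ennreal (right_kernel N d2 B w x) \<partial>lborel_pi (N * d2)) \<le> c"
    proof (cases "det (sqmat d2 w) = 0")
      case True
      \<comment> \<open>At a singular \<open>W\<close> the kernel vanishes because the exponent
        \<open>N\<close> of the determinant is positive.\<close>
      then show ?thesis using n by (simp add: right_kernel_def N_def power_0_left)
    next
      case False
      note W = sqmat_gram_PD(1)[OF False]
      have "kronecker B (sqmat d2 w * transpose_mat (sqmat d2 w))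
        = kronecker (1\<^sub>m n) (kronecker \<Theta> (sqmat d2 w * transpose_mat (sqmat d2 w)))"
        unfolding B_def by (rule kronecker_assoc)
      then have "(\<integral>\<^sup>+x. F x * ennreal (right_kernel N d2 B w x) \<partial>lborel_pi (N * d2))
        = emeasure (sample_law n d1 d2 \<Theta> (sqmat d2 w * transpose_mat (sqmat d2 w))) S"
        unfolding emeasure_sample_law[OF \<Theta> W S] right_kernel_eq_gdens[OF B False] F_def ND by simp
      then show ?thesis using c[OF W] by simp
    qed
  qed simp
  also have "\<dots> = c" using g1 by (simp add: nn_integral_multc nn_integral_gdens[OF PD_one])
  finally show ?thesis unfolding F_def B_def .
qed

section \<open>The minimax bounds\<close>

lemma estimator_PD: "estimator n d1 d2 T \<Longrightarrow> X \<in> space (sample_space n d1 d2) \<Longrightarrow> T X \<in> PD d1"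
  and estimator_measurable: "estimator n d1 d2 T \<Longrightarrow> i < d1 \<Longrightarrow> j < d1 \<Longrightarrow>
    (\<lambda>X. T X $$ (i,j)) \<in> borel_measurable (sample_space n d1 d2)"
  by (auto simp: estimator_def)

section \<open>Worst-case error probability and risk\<close>

lemma measure_le_worst_prob:
  assumes "\<Theta>1 \<in> op_ball d1" "\<Theta>2 \<in> PD d2"
  shows "measure (sample_law n d1 d2 \<Theta>1 \<Theta>2) {X \<in> space (sample_space n d1 d2). \<rho> (T X) \<Theta>1 \<ge> \<delta>}
    \<le> worst_prob \<rho> n d1 d2 T \<delta>"
proof -
  let ?m = "\<lambda>(\<Theta>1, \<Theta>2). measure (sample_law n d1 d2 \<Theta>1 \<Theta>2)
    {X \<in> space (sample_law n d1 d2 \<Theta>1 \<Theta>2). \<rho> (T X) \<Theta>1 \<ge> \<delta>}"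
  have "?m z \<le> 1" if "z \<in> op_ball d1 \<times> PD d2" for z
    using that prob_space.prob_le_1[OF prob_space_sample_law] by (auto simp: op_ball_def)
  then have "bdd_above (?m ` (op_ball d1 \<times> PD d2))" by (intro bdd_aboveI2)
  from cSUP_upper[OF _ this, of "(\<Theta>1, \<Theta>2)"] assms
  show ?thesis by (simp add: worst_prob_def space_sample_law)
qed

lemma one_in_op_ball: "0 < d \<Longrightarrow> 1\<^sub>m d \<in> op_ball d"
  using op_ball_one_plus(1,2)[of d "1\<^sub>m d" "\<lambda>_. 0"] by (simp add: orthonormal_mat_def spec_mat_one)

lemma worst_prob_le:
  assumes "0 < d1" and "\<And>\<Theta>1 \<Theta>2. \<Theta>1 \<in> op_ball d1 \<Longrightarrow> \<Theta>2 \<in> PD d2 \<Longrightarrow>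
    measure (sample_law n d1 d2 \<Theta>1 \<Theta>2) {X \<in> space (sample_space n d1 d2). \<rho> (T X) \<Theta>1 \<ge> \<delta>} \<le> c"
  shows "worst_prob \<rho> n d1 d2 T \<delta> \<le> c"
  unfolding worst_prob_def
proof (rule cSUP_least)
  show "op_ball d1 \<times> PD d2 \<noteq> {}" using one_in_op_ball[OF assms(1)] PD_one[of d2] by blast
qed (use assms(2) in \<open>auto simp: space_sample_law\<close>)

text \<open>The measurability assumption guards against the convention that \<open>measure\<close>
  is 0 off the sigma-algebra, under which a larger event could receive a smaller value.\<close>

lemma worst_prob_antimono:
  assumes d1: "0 < d1" and \<delta>: "\<delta> \<le> \<delta>'"
    and m: "\<And>\<Theta>. \<Theta> \<in> PD d1 \<Longrightarrow> (\<lambda>X. \<rho> (T X) \<Theta>) \<in> borel_measurable (sample_space n d1 d2)"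
  shows "worst_prob \<rho> n d1 d2 T \<delta>' \<le> worst_prob \<rho> n d1 d2 T \<delta>"
proof (rule worst_prob_le[OF d1])
  fix \<Theta>1 \<Theta>2 assume \<Theta>: "\<Theta>1 \<in> op_ball d1" "\<Theta>2 \<in> PD d2"
  then have P: "\<Theta>1 \<in> PD d1" by (simp add: op_ball_def)
  note [measurable] = m[OF P]
  interpret prob_space "sample_law n d1 d2 \<Theta>1 \<Theta>2" by (rule prob_space_sample_law[OF P \<Theta>(2)])
  have "{X \<in> space (sample_space n d1 d2). \<rho> (T X) \<Theta>1 \<ge> \<delta>} \<in> sets (sample_space n d1 d2)" by measurable
  then have "measure (sample_law n d1 d2 \<Theta>1 \<Theta>2) {X \<in> space (sample_space n d1 d2). \<rho> (T X) \<Theta>1 \<ge> \<delta>'}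
    \<le> measure (sample_law n d1 d2 \<Theta>1 \<Theta>2) {X \<in> space (sample_space n d1 d2). \<rho> (T X) \<Theta>1 \<ge> \<delta>}"
    using \<delta> by (intro finite_measure_mono) (auto simp: sets_sample_law)
  also have "\<dots> \<le> worst_prob \<rho> n d1 d2 T \<delta>" by (rule measure_le_worst_prob[OF \<Theta>])
  finally show "measure (sample_law n d1 d2 \<Theta>1 \<Theta>2) {X \<in> space (sample_space n d1 d2). \<rho> (T X) \<Theta>1 \<ge> \<delta>'}
    \<le> worst_prob \<rho> n d1 d2 T \<delta>" .
qed

text \<open>Markov's inequality for the squared distance, applied at every parameter: a finite worst
  risk \<open>w\<close> bounds every error probability by \<open>w / \<delta>\<^sup>2\<close>, hence
  also their supremum.\<close>

lemma worst_risk_ge: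
  assumes d1: "0 < d1" and \<delta>: "0 < \<delta>" and wp: "1 / 2 \<le> worst_prob \<rho> n d1 d2 T \<delta>"
    and m: "\<And>\<Theta>. \<Theta> \<in> PD d1 \<Longrightarrow> (\<lambda>X. \<rho> (T X) \<Theta>) \<in> borel_measurable (sample_space n d1 d2)"
  shows "ennreal (\<delta>\<^sup>2 / 2) \<le> worst_risk \<rho> n d1 d2 T"
proof (cases "worst_risk \<rho> n d1 d2 T = \<top>")
  case False
  define w where "w = enn2real (worst_risk \<rho> n d1 d2 T)"
  have w: "worst_risk \<rho> n d1 d2 T = ennreal w" "0 \<le> w"
    using False by (auto simp: w_def less_top)
  have "worst_prob \<rho> n d1 d2 T \<delta> \<le> w / \<delta>\<^sup>2"
  proof (rule worst_prob_le[OF d1])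
    fix \<Theta>1 \<Theta>2 assume \<Theta>: "\<Theta>1 \<in> op_ball d1" "\<Theta>2 \<in> PD d2"
    then have P: "\<Theta>1 \<in> PD d1" by (simp add: op_ball_def)
    let ?L = "sample_law n d1 d2 \<Theta>1 \<Theta>2"
    let ?S = "{X \<in> space (sample_space n d1 d2). \<rho> (T X) \<Theta>1 \<ge> \<delta>}"
    note [measurable] = m[OF P]
    interpret prob_space ?L by (rule prob_space_sample_law[OF P \<Theta>(2)])
    have "?S \<in> sets (sample_space n d1 d2)" by measurable
    then have S: "?S \<in> sets ?L" by (simp add: sets_sample_law)
    have "ennreal (\<delta>\<^sup>2 * measure ?L ?S) = (\<integral>\<^sup>+X. ennreal (\<delta>\<^sup>2) * indicator ?S X \<partial>?L)"
      using S by (subst nn_integral_cmult_indicator) (auto simp: emeasure_eq_measure ennreal_mult')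
    also have "\<dots> \<le> (\<integral>\<^sup>+X. ennreal ((\<rho> (T X) \<Theta>1)\<^sup>2) \<partial>?L)"
      using \<delta> by (intro nn_integral_mono) (auto simp: indicator_def intro!: ennreal_leI power_mono)
    also have "\<dots> \<le> worst_risk \<rho> n d1 d2 T"
      unfolding worst_risk_def using \<Theta> by (intro SUP_upper2[of "(\<Theta>1, \<Theta>2)"]) auto
    finally have "\<delta>\<^sup>2 * measure ?L ?S \<le> w" using w by (simp add: ennreal_le_iff)
    then show "measure ?L ?S \<le> w / \<delta>\<^sup>2" using \<delta> by (simp add: field_simps)
  qed
  then have "1 / 2 \<le> w / \<delta>\<^sup>2" using wp by linarith
  then have "\<delta>\<^sup>2 / 2 \<le> w" using \<delta> by (simp add: field_simps)
  then show ?thesis unfolding w by (rule ennreal_leI)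
qed simp

text \<open>Realises the left kernel as a measure on samples, so that drawing the data from the
  latent matrix is a channel in the sense of \<open>channel_error_ge_half\<close>.\<close>

lemma emeasure_distr_left_kernel:
  assumes S: "S \<in> sets (sample_space n d1 d2)" and ND: "N * d2 = n * (d1 * d2)"
  shows "emeasure (distr (density (lborel_pi (N * d2)) (\<lambda>x. ennreal (left_kernel N d2 v x)))
      (sample_space n d1 d2) (unflat n (d1 * d2))) S
    = (\<integral>\<^sup>+x. indicator S (unflat n (d1 * d2) x) * ennreal (left_kernel N d2 v x) \<partial>lborel_pi (N * d2))"
proof -
  let ?u = "unflat n (d1 * d2)"
  have u: "?u \<in> measurable (lborel_pi (N * d2)) (sample_space n d1 d2)"
    using measurable_unflat[of n "d1 * d2"]
    unfolding ND measurable_cong_sets[OF refl sets_sample_law(2)] .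
  have k: "(\<lambda>x. ennreal (left_kernel N d2 v x)) \<in> borel_measurable (lborel_pi (N * d2))"
  proof -
    have "kronecker (sqmat N v * transpose_mat (sqmat N v)) (1\<^sub>m d2) \<in> carrier_mat (N * d2) (N * d2)"
      by (rule kronecker_carrier) auto
    then show ?thesis unfolding left_kernel_def by measurable
  qed
  have pre: "?u -` S \<inter> space (lborel_pi (N * d2)) \<in> sets (lborel_pi (N * d2))"
    by (rule measurable_sets[OF u S])
  have "emeasure (distr (density (lborel_pi (N * d2)) (\<lambda>x. ennreal (left_kernel N d2 v x))) (sample_space n d1 d2) ?u) S
    = emeasure (density (lborel_pi (N * d2)) (\<lambda>x. ennreal (left_kernel N d2 v x))) (?u -` S \<inter> space (lborel_pi (N * d2)))"
    using u S by (subst emeasure_distr) auto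
  also have "\<dots> = (\<integral>\<^sup>+x. ennreal (left_kernel N d2 v x) * indicator (?u -` S \<inter> space (lborel_pi (N * d2))) x \<partial>lborel_pi (N * d2))"
    by (rule emeasure_density[OF k pre])
  also have "\<dots> = (\<integral>\<^sup>+x. indicator S (?u x) * ennreal (left_kernel N d2 v x) \<partial>lborel_pi (N * d2))"
    by (intro nn_integral_cong) (auto simp: indicator_def mult.commute)
  finally show ?thesis .
qed

text \<open>Apart from measurability, the distance enters only through \<open>entries\<close>:
  closeness in \<open>\<rho>\<close> forces the entries at \<open>I\<close> to be close in the
  Euclidean sense. The admissible \<open>\<delta>\<^sup>2\<close> grows with \<open>card I\<close>,
  which is how the orders \<open>d1^2\<close> and \<open>d1\<close> of the two rates arise.\<close>

theorem worst_prob_ge_half: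
  fixes \<rho> :: "real mat \<Rightarrow> real mat \<Rightarrow> real"
  assumes est: "estimator n d1 d2 T" and d1: "1 \<le> d1" and d2: "1 \<le> d2" and n: "1 \<le> n"
    and I: "I \<subseteq> {(i,j). i \<le> j \<and> j < d1}" "I \<noteq> {}"
    and meas: "\<And>\<Theta>. \<Theta> \<in> PD d1 \<Longrightarrow> (\<lambda>X. \<rho> (T X) \<Theta>) \<in> borel_measurable (sample_space n d1 d2)"
    and entries: "\<And>A U f. A \<in> PD d1 \<Longrightarrow> orthonormal_mat d1 U \<Longrightarrow> (\<And>k. k < d1 \<Longrightarrow> 0 < f k \<and> f k \<le> 5 / 4) \<Longrightarrow>
       \<rho> A (spec_mat d1 U f) < \<delta> \<Longrightarrow> (\<Sum>p\<in>I. ((A - spec_mat d1 U f) $$ p)\<^sup>2) \<le> 16 * \<delta>\<^sup>2"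
    and \<delta>: "512 * 1000\<^sup>2 * \<delta>\<^sup>2 \<le> min 1 (real (card I) / (real n * min (real n * real d1) (real d2)))"
  shows "1 / 2 \<le> worst_prob \<rho> n d1 d2 T \<delta>"
proof -
  define m where "m = card I"
  define M where "M = min (n * d1) d2"
  define N where "N = n * d1"
  \<comment> \<open>The effective number of \<open>d1\<close>-dimensional Gaussian samples:
    \<open>n * d2\<close> in the direct channel, \<open>n * N\<close> in the mixture
    channel.\<close>
  define x where "x = real n * real M"
  have M_real: "min (real n * real d1) (real d2) = real M" by (simp add: M_def of_nat_min)
  have Isub: "I \<subseteq> {..<d1} \<times> {..<d1}" using I by auto
  then have finI: "finite I" by (rule finite_subset) simp
  have m: "m \<ge> 1" using I finI by (simp add: m_def Suc_le_eq card_gt_0_iff)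
  have x: "x > 0" using n d1 d2 by (simp add: x_def M_def)
  \<comment> \<open>The bound \<open>1 / m\<close> keeps all hypotheses within the ball, the bound
    \<open>1 / x\<close> keeps the chi-square exponent below \<open>m / 16\<close>. The factor 32 is
    16 times the 2 by which off-diagonal entries are counted.\<close>
  define s where "s = sqrt (min (1 / real m) (1 / x) / (32 * 1000\<^sup>2))"
  have s2: "32 * 1000\<^sup>2 * s\<^sup>2 = min (1 / real m) (1 / x)" using m x by (simp add: s_def)
  have s: "s > 0" using m x by (simp add: s_def)
  have s_m: "32 * 1000\<^sup>2 * real (card I) * s\<^sup>2 \<le> 1"
  proof -
    have "real m * (32 * 1000\<^sup>2 * s\<^sup>2) \<le> real m * (1 / real m)" unfolding s2 by (intro mult_left_mono) auto
    then show ?thesis using m by (simp add: m_def mult_ac)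
  qed
  have s_x: "x * (2 * 1000\<^sup>2 * real (card I) * s\<^sup>2) \<le> real m / 16"
  proof -
    have "(x * real m) * (32 * 1000\<^sup>2 * s\<^sup>2) \<le> (x * real m) * (1 / x)"
      unfolding s2 using x by (intro mult_left_mono) auto
    then show ?thesis using x by (simp add: m_def mult_ac)
  qed
  \<comment> \<open>Matches the radius supplied by \<open>entries\<close> to the one in
    \<open>grid_small_ball\<close>; the constant 512 is \<open>16 * 32\<close>.\<close>
  have s_\<delta>: "16 * \<delta>\<^sup>2 \<le> s\<^sup>2 * real (card I)"
  proof -
    have "min 1 (real m / x) = real m * min (1 / real m) (1 / x)"
      using m by (subst min_mult_distrib_left) auto
    also have "\<dots> = 32 * 1000\<^sup>2 * (s\<^sup>2 * real m)" unfolding s2[symmetric] by simp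
    finally have "512 * 1000\<^sup>2 * \<delta>\<^sup>2 \<le> 32 * 1000\<^sup>2 * (s\<^sup>2 * real m)"
      using \<delta> unfolding M_real x_def[symmetric] m_def[symmetric] by simp
    then show ?thesis by (simp add: m_def mult.commute)
  qed
  define \<Sigma> where "\<Sigma> = I \<rightarrow>\<^sub>E {..<1000::nat}"
  have \<Sigma>: "finite \<Sigma>" "\<Sigma> \<noteq> {}" "card \<Sigma> = 1000 ^ m"
    using finI by (auto simp: \<Sigma>_def m_def card_PiE finite_PiE PiE_eq_empty_iff lessThan_empty_iff)
  define \<Theta> where "\<Theta> \<sigma> = 1\<^sub>m d1 + perturbation d1 I s \<sigma>" for \<sigma>
  have "\<exists>U \<mu>. orthonormal_mat d1 U \<and> perturbation d1 I s \<sigma> = spec_mat d1 U \<mu> \<and> (\<forall>k<d1. \<bar>\<mu> k\<bar> \<le> 1 / 4) \<and>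
      (\<Sum>k<d1. (\<mu> k)\<^sup>2) \<le> 2 * 1000\<^sup>2 * real (card I) * s\<^sup>2" if "\<sigma> \<in> \<Sigma>" for \<sigma>
    using perturbation_spec[OF I(1) _ s_m, of \<sigma>] that unfolding \<Sigma>_def by metis
  then obtain U \<mu> where U: "\<And>\<sigma>. \<sigma> \<in> \<Sigma> \<Longrightarrow> orthonormal_mat d1 (U \<sigma>)"
    and pert: "\<And>\<sigma>. \<sigma> \<in> \<Sigma> \<Longrightarrow> perturbation d1 I s \<sigma> = spec_mat d1 (U \<sigma>) (\<mu> \<sigma>)"
    and \<mu>: "\<And>\<sigma> k. \<sigma> \<in> \<Sigma> \<Longrightarrow> k < d1 \<Longrightarrow> \<bar>\<mu> \<sigma> k\<bar> \<le> 1 / 4"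
    and \<mu>_sum: "\<And>\<sigma>. \<sigma> \<in> \<Sigma> \<Longrightarrow> (\<Sum>k<d1. (\<mu> \<sigma> k)\<^sup>2) \<le> 2 * 1000\<^sup>2 * real (card I) * s\<^sup>2"
    by metis
  have d1': "0 < d1" using d1 by simp
  have \<Theta>_ball: "\<Theta> \<sigma> \<in> op_ball d1" and \<Theta>_spec: "\<Theta> \<sigma> = spec_mat d1 (U \<sigma>) (\<lambda>k. 1 + \<mu> \<sigma> k)"
    and \<Theta>_bounds: "\<And>k. k < d1 \<Longrightarrow> 0 < 1 + \<mu> \<sigma> k \<and> 1 + \<mu> \<sigma> k \<le> 5 / 4" if "\<sigma> \<in> \<Sigma>" for \<sigma>
    using op_ball_one_plus[OF U[OF that], of "\<mu> \<sigma>", OF \<mu>[OF that] d1'] unfolding \<Theta>_def pert[OF that] by auto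
  have \<Theta>_PD: "\<Theta> \<sigma> \<in> PD d1" if "\<sigma> \<in> \<Sigma>" for \<sigma> using \<Theta>_ball[OF that] by (simp add: op_ball_def)
  define Sp where "Sp = sample_space n d1 d2"
  define D where "D \<sigma> = {X \<in> space Sp. \<rho> (T X) (\<Theta> \<sigma>) < \<delta>}" for \<sigma>
  have D_sets: "D \<sigma> \<in> sets Sp" if "\<sigma> \<in> \<Sigma>" for \<sigma>
    unfolding D_def Sp_def using meas[OF \<Theta>_PD[OF that]] by measurable
  have D_compl: "space Sp - D \<sigma> = {X \<in> space (sample_space n d1 d2). \<rho> (T X) (\<Theta> \<sigma>) \<ge> \<delta>}" for \<sigma>
    by (auto simp: D_def Sp_def)
  have D_card: "real (card {\<sigma> \<in> \<Sigma>. X \<in> D \<sigma>}) \<le> (1 / 8) ^ m * real (card \<Sigma>)" if X: "X \<in> space Sp" for X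
  proof -
    \<comment> \<open>The estimate in grid coordinates, that is, its offset from the identity
      matrix.\<close>
    define t where "t p = T X $$ p - (if fst p = snd p then 1 else 0)" for p
    define B where "B = {\<sigma> \<in> I \<rightarrow>\<^sub>E {..<1000::nat}. (\<Sum>i\<in>I. (t i - s * real (\<sigma> i))\<^sup>2) \<le> s\<^sup>2 * real (card I)}"
    have A: "T X \<in> PD d1" using estimator_PD[OF est] X by (simp add: Sp_def)
    have "{\<sigma> \<in> \<Sigma>. X \<in> D \<sigma>} \<subseteq> B"
    proof
      fix \<sigma> assume "\<sigma> \<in> {\<sigma> \<in> \<Sigma>. X \<in> D \<sigma>}"
      then have \<sigma>: "\<sigma> \<in> \<Sigma>" and lt: "\<rho> (T X) (\<Theta> \<sigma>) < \<delta>" by (auto simp: D_def)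
      have "(\<Sum>p\<in>I. ((T X - \<Theta> \<sigma>) $$ p)\<^sup>2) \<le> 16 * \<delta>\<^sup>2"
        unfolding \<Theta>_spec[OF \<sigma>]
        by (rule entries[OF A U[OF \<sigma>] _ lt[unfolded \<Theta>_spec[OF \<sigma>]]]) (rule \<Theta>_bounds[OF \<sigma>])
      moreover have "(T X - \<Theta> \<sigma>) $$ p = t p - s * real (\<sigma> p)" if p: "p \<in> I" for p
      proof -
        obtain i j where ij: "p = (i,j)" by (cases p)
        then have "i \<le> j" "j < d1" "i < d1" using I p by auto
        then show ?thesis using p PD_carrier[OF A]
          by (auto simp: ij \<Theta>_def perturbation_def t_def min_def max_def)
      qed
      ultimately have "(\<Sum>p\<in>I. (t p - s * real (\<sigma> p))\<^sup>2) \<le> 16 * \<delta>\<^sup>2" by simp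
      then show "\<sigma> \<in> B" using \<sigma> s_\<delta> by (auto simp: B_def \<Sigma>_def)
    qed
    moreover have "finite B" using \<Sigma>(1) by (simp add: B_def \<Sigma>_def)
    ultimately have "card {\<sigma> \<in> \<Sigma>. X \<in> D \<sigma>} \<le> card B" by (intro card_mono)
    then have "8 ^ m * card {\<sigma> \<in> \<Sigma>. X \<in> D \<sigma>} \<le> 8 ^ m * card B" by simp
    also have "\<dots> \<le> card \<Sigma>" using grid_small_ball[OF finI s, of t] by (simp add: B_def \<Sigma>(3) m_def)
    finally have "real (8 ^ m * card {\<sigma> \<in> \<Sigma>. X \<in> D \<sigma>}) \<le> real (card \<Sigma>)" by (rule of_nat_mono)
    then show ?thesis by (simp add: power_divide field_simps)
  qed
  \<comment> \<open>The product is \<open>4 * (1 / 4) ^ m\<close>, so a single free entry is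
    enough.\<close>
  have R: "(2::real) ^ m > 0" "(0::real) \<le> (1 / 8) ^ m" "4 * 2 ^ m * (1 / 8 :: real) ^ m \<le> 1"
  proof -
    have "(1 / 4 :: real) ^ m \<le> (1 / 4) ^ 1" using m by (intro power_decreasing) auto
    moreover have "2 ^ m * (1 / 8 :: real) ^ m = (1 / 4) ^ m" by (simp add: power_mult_distrib[symmetric])
    ultimately show "4 * 2 ^ m * (1 / 8 :: real) ^ m \<le> 1" by (simp add: mult.assoc)
  qed auto
  \<comment> \<open>One bound for the failure probability at all \<open>\<Theta>2\<close>, and
    therefore under every prior on \<open>\<Theta>2\<close>.\<close>
  define c where "c = ennreal (worst_prob \<rho> n d1 d2 T \<delta>)"
  have c: "emeasure (sample_law n d1 d2 (\<Theta> \<sigma>) \<Theta>2) (space Sp - D \<sigma>) \<le> c" if \<sigma>: "\<sigma> \<in> \<Sigma>" and \<Theta>2: "\<Theta>2 \<in> PD d2" for \<sigma> \<Theta>2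
  proof -
    interpret prob_space "sample_law n d1 d2 (\<Theta> \<sigma>) \<Theta>2" by (rule prob_space_sample_law[OF \<Theta>_PD[OF \<sigma>] \<Theta>2])
    show ?thesis unfolding c_def emeasure_eq_measure D_compl
      by (intro ennreal_leI measure_le_worst_prob \<Theta>_ball \<sigma> \<Theta>2)
  qed
  have lincomb: "2 \<cdot>\<^sub>m spec_mat d1 (U \<sigma>) f + (- 1) \<cdot>\<^sub>m 1\<^sub>m d1 = spec_mat d1 (U \<sigma>) (\<lambda>k. 2 * f k - 1)" if "\<sigma> \<in> \<Sigma>" for \<sigma> f
    using spec_mat_lincomb[OF U[OF that], of 2 f "-1" "\<lambda>_. 1"] by (simp add: spec_mat_one[OF U[OF that]])
  have budget: "real r * (\<Sum>k<d1. (\<mu> \<sigma> k)\<^sup>2) \<le> real m / 16" if \<sigma>: "\<sigma> \<in> \<Sigma>" and r: "real r = x" for \<sigma> r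
  proof -
    have "real r * (\<Sum>k<d1. (\<mu> \<sigma> k)\<^sup>2) \<le> x * (2 * 1000\<^sup>2 * real (card I) * s\<^sup>2)"
      unfolding r using x \<mu>_sum[OF \<sigma>] by (intro mult_left_mono) auto
    then show ?thesis using s_x by linarith
  qed
  have "1 / 2 \<le> c"
  proof (cases "d2 \<le> n * d1")
    case True
    let ?\<kappa> = "\<lambda>v. return Sp (unflat n (d1 * d2) v)"
    have u: "unflat n (d1 * d2) \<in> measurable (lborel_pi (n * (d1 * d2))) Sp"
      unfolding Sp_def using measurable_unflat[of n "d1 * d2"]
      unfolding measurable_cong_sets[OF refl sets_sample_law(2)] .
    have "\<exists>\<sigma>\<in>\<Sigma>. 1 / 2 \<le> (\<integral>\<^sup>+v. ennreal (gdens (n * (d1 * d2)) (kronecker (1\<^sub>m n) (kronecker (\<Theta> \<sigma>) (1\<^sub>m d2))) v) *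
        emeasure (?\<kappa> v) (space Sp - D \<sigma>) \<partial>lborel_pi (n * (d1 * d2)))"
    proof (rule channel_error_ge_half[OF \<Sigma>(1,2) refl \<Theta>_PD _ _ _ _ _ D_sets D_card R])
      fix \<sigma> assume \<sigma>: "\<sigma> \<in> \<Sigma>"
      show "2 \<cdot>\<^sub>m \<Theta> \<sigma> + (- 1) \<cdot>\<^sub>m 1\<^sub>m d1 \<in> PD d1"
        unfolding \<Theta>_spec[OF \<sigma>] lincomb[OF \<sigma>] spec_mat_PD_iff[OF U[OF \<sigma>]] using \<mu>[OF \<sigma>] by fastforce
      show "(det (\<Theta> \<sigma>) / sqrt (det (2 \<cdot>\<^sub>m \<Theta> \<sigma> + (- 1) \<cdot>\<^sub>m 1\<^sub>m d1))) ^ (n * d2) \<le> 2 ^ m"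
        unfolding \<Theta>_spec[OF \<sigma>] lincomb[OF \<sigma>]
      proof (rule det_ratio_le[OF U[OF \<sigma>] budget[OF \<sigma>]])
        show "real (n * d2) = x" using True by (simp add: x_def M_def)
        fix k assume k: "k < d1"
        have "- 1 / 4 \<le> \<mu> \<sigma> k" using \<mu>[OF \<sigma> k] by auto
        then show "0 < 1 + \<mu> \<sigma> k \<and> 0 < 2 * (1 + \<mu> \<sigma> k) - 1 \<and>
            (1 + \<mu> \<sigma> k) / sqrt (2 * (1 + \<mu> \<sigma> k) - 1) \<le> exp ((\<mu> \<sigma> k)\<^sup>2)"
          using chi_square_factor_le(1)[OF \<mu>[OF \<sigma> k]] by (simp add: algebra_simps)
      qed
    next
      show "AE v in lborel_pi (n * (d1 * d2)). emeasure (?\<kappa> v) (space Sp) = 1"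
        using measurable_space[OF u] by (intro AE_I2) (simp add: emeasure_return)
      fix S assume S: "S \<in> sets Sp"
      show "(\<lambda>v. emeasure (?\<kappa> v) S) \<in> borel_measurable (lborel_pi (n * (d1 * d2)))"
        unfolding emeasure_return[OF S] by (rule measurable_compose[OF u borel_measurable_indicator[OF S]])
    qed simp_all
    then obtain \<sigma> where \<sigma>: "\<sigma> \<in> \<Sigma>" and half: "1 / 2 \<le> (\<integral>\<^sup>+v. ennreal (gdens (n * (d1 * d2)) (kronecker (1\<^sub>m n) (kronecker (\<Theta> \<sigma>) (1\<^sub>m d2))) v) *
        emeasure (?\<kappa> v) (space Sp - D \<sigma>) \<partial>lborel_pi (n * (d1 * d2)))" by blast
    have "space Sp - D \<sigma> \<in> sets (sample_space n d1 d2)" using D_sets[OF \<sigma>] unfolding Sp_def by auto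
    note half
    also note direct_channel[OF \<Theta>_PD[OF \<sigma>] \<open>space Sp - D \<sigma> \<in> _\<close> c[OF \<sigma>], folded Sp_def]
    finally show ?thesis .
  next
    case False
    have ND: "N * d2 = n * (d1 * d2)" by (simp add: N_def mult.assoc)
    \<comment> \<open>Each column of the square matrix of size \<open>N = n * d1\<close> consists of
      \<open>n\<close> vectors of length \<open>d1\<close>, so there are \<open>N * n\<close> of
      them, each with precision \<open>inv_mat (\<Theta> \<sigma>)\<close>.\<close>
    have NN: "N * N = (N * n) * (d1 * 1)" by (simp add: N_def)
    let ?k = "\<lambda>v S. \<integral>\<^sup>+x. indicator S (unflat n (d1 * d2) x) * ennreal (left_kernel N d2 v x) \<partial>lborel_pi (N * d2)"
    let ?\<kappa> = "\<lambda>v. distr (density (lborel_pi (N * d2)) (\<lambda>x. ennreal (left_kernel N d2 v x))) Sp (unflat n (d1 * d2))"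
    have \<kappa>: "emeasure (?\<kappa> v) S = ?k v S" if "S \<in> sets Sp" for v S
      using emeasure_distr_left_kernel[OF that[unfolded Sp_def] ND] unfolding Sp_def .
    have inv: "inv_mat (\<Theta> \<sigma>) = spec_mat d1 (U \<sigma>) (\<lambda>k. 1 / (1 + \<mu> \<sigma> k))" if \<sigma>: "\<sigma> \<in> \<Sigma>" for \<sigma>
    proof (rule inv_mat_eqI)
      show "\<Theta> \<sigma> * spec_mat d1 (U \<sigma>) (\<lambda>k. 1 / (1 + \<mu> \<sigma> k)) = 1\<^sub>m d1"
        unfolding \<Theta>_spec[OF \<sigma>] spec_mat_mult[OF U[OF \<sigma>]] spec_mat_one[OF U[OF \<sigma>], symmetric]
        using \<Theta>_bounds[OF \<sigma>] by (intro spec_mat_cong[OF U[OF \<sigma>]]) fastforce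
    qed (use PD_carrier[OF \<Theta>_PD[OF \<sigma>]] spec_mat_carrier[OF U[OF \<sigma>]] in auto)
    have "\<exists>\<sigma>\<in>\<Sigma>. 1 / 2 \<le> (\<integral>\<^sup>+v. ennreal (gdens (N * N) (kronecker (1\<^sub>m (N * n)) (kronecker (inv_mat (\<Theta> \<sigma>)) (1\<^sub>m 1))) v) *
        emeasure (?\<kappa> v) (space Sp - D \<sigma>) \<partial>lborel_pi (N * N))"
    proof (rule channel_error_ge_half[OF \<Sigma>(1,2) NN PD_inv_mat(1)[OF \<Theta>_PD] _ _ _ _ _ D_sets D_card R])
      fix \<sigma> assume \<sigma>: "\<sigma> \<in> \<Sigma>"
      have pos: "0 < 2 * (1 / (1 + \<mu> \<sigma> k)) - 1" if k: "k < d1" for k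
        using \<Theta>_bounds[OF \<sigma> k] by (simp add: field_simps)
      show "2 \<cdot>\<^sub>m inv_mat (\<Theta> \<sigma>) + (- 1) \<cdot>\<^sub>m 1\<^sub>m d1 \<in> PD d1"
        unfolding inv[OF \<sigma>] lincomb[OF \<sigma>] spec_mat_PD_iff[OF U[OF \<sigma>]] using pos by blast
      show "(det (inv_mat (\<Theta> \<sigma>)) / sqrt (det (2 \<cdot>\<^sub>m inv_mat (\<Theta> \<sigma>) + (- 1) \<cdot>\<^sub>m 1\<^sub>m d1))) ^ (N * n * 1) \<le> 2 ^ m"
        unfolding inv[OF \<sigma>] lincomb[OF \<sigma>]
      proof (rule det_ratio_le[OF U[OF \<sigma>] budget[OF \<sigma>]])
        show "real (N * n * 1) = x" using False by (simp add: x_def M_def N_def)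
        fix k assume k: "k < d1"
        show "0 < 1 / (1 + \<mu> \<sigma> k) \<and> 0 < 2 * (1 / (1 + \<mu> \<sigma> k)) - 1 \<and>
            1 / (1 + \<mu> \<sigma> k) / sqrt (2 * (1 / (1 + \<mu> \<sigma> k)) - 1) \<le> exp ((\<mu> \<sigma> k)\<^sup>2)"
          using chi_square_factor_le(2)[OF \<mu>[OF \<sigma> k]] pos[OF k] \<Theta>_bounds[OF \<sigma> k] by simp
      qed
    next
      have "?k v (space Sp) = (\<integral>\<^sup>+x. ennreal (left_kernel N d2 v x) \<partial>lborel_pi (N * d2))" for v
      proof (rule nn_integral_cong)
        fix x assume "x \<in> space (lborel_pi (N * d2))"
        then have "unflat n (d1 * d2) x \<in> space Sp"
          using measurable_space[OF measurable_unflat[of n "d1 * d2"]] unfolding ND Sp_def space_sample_law by blast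
        then show "indicator (space Sp) (unflat n (d1 * d2) x) * ennreal (left_kernel N d2 v x) = ennreal (left_kernel N d2 v x)"
          by simp
      qed
      then show "AE v in lborel_pi (N * N). emeasure (?\<kappa> v) (space Sp) = 1"
        unfolding \<kappa>[OF sets.top] using nn_integral_left_kernel[of N d2] by simp
      fix S assume S: "S \<in> sets Sp"
      then have S': "S \<in> sets (\<Pi>\<^sub>M k\<in>{..<n}. lborel_pi (d1 * d2))" by (simp add: sets_sample_law Sp_def)
      have F: "(\<lambda>x. indicator S (unflat n (d1 * d2) x) :: ennreal) \<in> borel_measurable (lborel_pi (N * d2))"
        unfolding ND by (rule measurable_compose[OF measurable_unflat borel_measurable_indicator[OF S']])
      have "(\<lambda>_. 1 :: ennreal) \<in> borel_measurable (lborel_pi (N * N))" by simp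
      from nn_integral_mixture(3)[OF this measurable_left_kernel F]
      show "(\<lambda>v. emeasure (?\<kappa> v) S) \<in> borel_measurable (lborel_pi (N * N))"
        unfolding \<kappa>[OF S] .
    qed simp_all
    then obtain \<sigma> where \<sigma>: "\<sigma> \<in> \<Sigma>" and half: "1 / 2 \<le> (\<integral>\<^sup>+v. ennreal (gdens (N * N) (kronecker (1\<^sub>m (N * n)) (kronecker (inv_mat (\<Theta> \<sigma>)) (1\<^sub>m 1))) v) *
        emeasure (?\<kappa> v) (space Sp - D \<sigma>) \<partial>lborel_pi (N * N))" by blast
    have S: "space Sp - D \<sigma> \<in> sets Sp" using D_sets[OF \<sigma>] by auto
    then have S': "space Sp - D \<sigma> \<in> sets (sample_space n d1 d2)" unfolding Sp_def .
    note I\<Theta> = PD_inv_mat[OF \<Theta>_PD[OF \<sigma>]]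
    have "inv_mat (kronecker (1\<^sub>m n) (\<Theta> \<sigma>)) = kronecker (1\<^sub>m n) (inv_mat (\<Theta> \<sigma>))"
      using PD_carrier[OF \<Theta>_PD[OF \<sigma>]] PD_carrier[OF I\<Theta>(1)] I\<Theta>(2)
      by (intro inv_mat_eqI[of _ "n * d1"])
         (auto simp: kronecker_mult[of _ n n _ d1 d1 _ n _ d1] kronecker_one intro!: kronecker_carrier)
    then have "kronecker (1\<^sub>m N) (inv_mat (kronecker (1\<^sub>m n) (\<Theta> \<sigma>))) = kronecker (1\<^sub>m (N * n)) (kronecker (inv_mat (\<Theta> \<sigma>)) (1\<^sub>m 1))"
      by (simp only: kronecker_assoc[symmetric] kronecker_one kronecker_one_right)
    with half have "1 / 2 \<le> (\<integral>\<^sup>+v. ennreal (gdens (N * N) (kronecker (1\<^sub>m N) (inv_mat (kronecker (1\<^sub>m n) (\<Theta> \<sigma>)))) v) *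
        ?k v (space Sp - D \<sigma>) \<partial>lborel_pi (N * N))" unfolding \<kappa>[OF S] by simp
    also have "\<dots> \<le> c"
      unfolding N_def by (rule mixture_channel[OF \<Theta>_PD[OF \<sigma>] S' _ c[OF \<sigma>]]) (use n d1 in auto)
    finally show ?thesis .
  qed
  then have "ennreal (1 / 2) \<le> ennreal (worst_prob \<rho> n d1 d2 T \<delta>)" unfolding c_def ennreal_half .
  then show ?thesis unfolding ennreal_le_iff2 by auto
qed

text \<open>The hypotheses perturb all entries of the identity for the Fisher-Rao distance, but only the
  first row and column for the Thompson distance, where a single column already bounds the operator
  norm from below.\<close>

lemma worst_prob_d_FR:
  assumes est: "estimator n d1 d2 T" and d: "1 \<le> d1" "d1 \<le> d2" "1 \<le> n" and \<delta>: "0 < \<delta>"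
    "\<delta>\<^sup>2 = 1 / (1024 * 1000\<^sup>2) * min 1 ((real d1)\<^sup>2 / (real n * min (real n * real d1) (real d2)))"
  shows "1 / 2 \<le> worst_prob d_FR n d1 d2 T \<delta>"
proof (rule worst_prob_ge_half[OF est, where I = "{(i,j). i \<le> j \<and> j < d1}"])
  let ?I = "{(i,j). i \<le> j \<and> j < d1}"
  let ?x = "real n * min (real n * real d1) (real d2)"
  have sub: "?I \<subseteq> {..<d1} \<times> {..<d1}" by auto
  then have fin: "finite ?I" by (rule finite_subset) simp
  show "?I \<noteq> {}" using d by (auto intro!: exI[of _ 0])
  have small: "\<delta> \<le> 1 / 4"
  proof (rule power2_le_imp_le)
    have "\<delta>\<^sup>2 \<le> 1 / (1024 * 1000\<^sup>2) * 1" unfolding \<delta>(2) by (intro mult_left_mono) auto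
    then show "\<delta>\<^sup>2 \<le> (1 / 4)\<^sup>2" by (simp add: power2_eq_square)
  qed simp
  show "512 * 1000\<^sup>2 * \<delta>\<^sup>2 \<le> min 1 (real (card ?I) / ?x)"
  proof -
    \<comment> \<open>The triangle and its reflection cover the square, so \<open>I\<close> has at
      least \<open>d1^2 / 2\<close> elements. This costs the factor 2 between 512 and 1024.\<close>
    have "{..<d1} \<times> {..<d1} = ?I \<union> prod.swap ` ?I"
      by (auto simp: image_iff)
    then have "d1 * d1 \<le> card ?I + card (prod.swap ` ?I)"
      using card_Un_le[of ?I "prod.swap ` ?I"] card_cartesian_product[of "{..<d1}" "{..<d1}"] by simp
    also have "card (prod.swap ` ?I) \<le> card ?I" by (rule card_image_le[OF fin])
    finally have "d1 * d1 \<le> 2 * card ?I" by simp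
    then have "real (d1 * d1) \<le> real (2 * card ?I)" by (rule of_nat_mono)
    then have "(real d1)\<^sup>2 \<le> 2 * real (card ?I)" by (simp add: power2_eq_square)
    then have "(real d1)\<^sup>2 / ?x \<le> 2 * real (card ?I) / ?x" by (intro divide_right_mono) auto
    then have "min 1 ((real d1)\<^sup>2 / ?x) \<le> 2 * min 1 (real (card ?I) / ?x)" by (auto simp: min_def)
    moreover have "512 * 1000\<^sup>2 * (1 / (1024 * 1000\<^sup>2) * y) \<le> z" if "y \<le> 2 * z" for y z :: real
      using that by simp
    ultimately show ?thesis unfolding \<delta>(2) by blast
  qed
  show "(\<lambda>X. d_FR (T X) \<Theta>) \<in> borel_measurable (sample_space n d1 d2)" if "\<Theta> \<in> PD d1" for \<Theta>
    by (rule measurable_d_FR[OF estimator_PD[OF est] estimator_measurable[OF est] that])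
  fix A U f assume A: "A \<in> PD d1" "orthonormal_mat d1 U" "\<And>k. k < d1 \<Longrightarrow> 0 < f k \<and> f k \<le> 5 / 4"
    "d_FR A (spec_mat d1 U f) < \<delta>"
  have "(\<Sum>p\<in>?I. ((A - spec_mat d1 U f) $$ p)\<^sup>2) \<le> (\<Sum>p\<in>{..<d1} \<times> {..<d1}. ((A - spec_mat d1 U f) $$ p)\<^sup>2)"
    using sub by (intro sum_mono2) auto
  also have "\<dots> = frob_sq d1 (A - spec_mat d1 U f)"
    by (simp add: frob_sq_def sum.cartesian_product split_beta')
  also have "\<dots> \<le> 16 * \<delta>\<^sup>2" by (rule d_FR_entries[OF A(1) refl A(2,3,4) small])
  finally show "(\<Sum>p\<in>?I. ((A - spec_mat d1 U f) $$ p)\<^sup>2) \<le> 16 * \<delta>\<^sup>2" .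
qed (use d in auto)

lemma worst_prob_d_op:
  assumes est: "estimator n d1 d2 T" and d: "1 \<le> d1" "d1 \<le> d2" "1 \<le> n" and \<delta>: "0 < \<delta>"
    "\<delta>\<^sup>2 = 1 / (1024 * 1000\<^sup>2) * min 1 (real d1 / (real n * min (real n * real d1) (real d2)))"
  shows "1 / 2 \<le> worst_prob d_op n d1 d2 T \<delta>"
proof (rule worst_prob_ge_half[OF est, where I = "Pair 0 ` {..<d1}"])
  let ?I = "Pair 0 ` {..<d1} :: (nat \<times> nat) set"
  let ?x = "real n * min (real n * real d1) (real d2)"
  have d1: "0 < d1" using d by simp
  show "?I \<noteq> {}" using d by (auto simp: lessThan_empty_iff)
  have small: "\<delta> \<le> 1 / 4"
  proof (rule power2_le_imp_le)
    have "\<delta>\<^sup>2 \<le> 1 / (1024 * 1000\<^sup>2) * 1" unfolding \<delta>(2) by (intro mult_left_mono) auto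
    then show "\<delta>\<^sup>2 \<le> (1 / 4)\<^sup>2" by (simp add: power2_eq_square)
  qed simp
  show "512 * 1000\<^sup>2 * \<delta>\<^sup>2 \<le> min 1 (real (card ?I) / ?x)"
  proof -
    have "card ?I = d1" by (subst card_image) (auto simp: inj_on_def)
    moreover have "0 \<le> min 1 (real d1 / ?x)" by simp
    moreover have "512 * 1000\<^sup>2 * (1 / (1024 * 1000\<^sup>2) * y) \<le> y" if "0 \<le> y" for y :: real
      using that by simp
    ultimately show ?thesis unfolding \<delta>(2) by (simp only:)
  qed
  show "(\<lambda>X. d_op (T X) \<Theta>) \<in> borel_measurable (sample_space n d1 d2)" if "\<Theta> \<in> PD d1" for \<Theta>
    by (rule measurable_d_op[OF estimator_PD[OF est] estimator_measurable[OF est] that d1])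
  fix A U f assume A: "A \<in> PD d1" "orthonormal_mat d1 U" "\<And>k. k < d1 \<Longrightarrow> 0 < f k \<and> f k \<le> 5 / 4"
    "d_op A (spec_mat d1 U f) < \<delta>"
  have "spec_mat d1 U f \<in> PD d1" using A(3) by (simp add: spec_mat_PD_iff[OF A(2)])
  note sym = PD_symmetric_entry[OF A(1)] PD_symmetric_entry[OF this]
  have "(\<Sum>p\<in>?I. ((A - spec_mat d1 U f) $$ p)\<^sup>2) = (\<Sum>j<d1. ((A - spec_mat d1 U f) $$ (0,j))\<^sup>2)"
    by (subst sum.reindex) (auto simp: inj_on_def)
  \<comment> \<open>The free entries form a row, whereas the operator norm was used on a column;
    symmetry identifies the two.\<close>
  also have "\<dots> = (\<Sum>j<d1. ((A - spec_mat d1 U f) $$ (j,0))\<^sup>2)"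
    using d1 PD_carrier[OF A(1)] spec_mat_carrier[OF A(2), of f] sym(1)[of 0] sym(2)[of 0]
    by (intro sum.cong) auto
  also have "\<dots> \<le> 16 * \<delta>\<^sup>2" by (rule d_op_entries[OF A(1) refl A(2,3) d1 A(4) small])
  finally show "(\<Sum>p\<in>?I. ((A - spec_mat d1 U f) $$ p)\<^sup>2) \<le> 16 * \<delta>\<^sup>2" .
qed (use d in auto)

lemma bounds_from_worst_prob:
  assumes est: "estimator n d1 d2 T" and d1: "1 \<le> d1" and \<beta>: "0 < \<beta>"
    and m: "\<And>\<Theta>. \<Theta> \<in> PD d1 \<Longrightarrow> (\<lambda>X. \<rho> (T X) \<Theta>) \<in> borel_measurable (sample_space n d1 d2)"
    and wp: "\<And>\<delta>. 0 < \<delta> \<Longrightarrow> \<delta>\<^sup>2 = \<beta> \<Longrightarrow> 1 / 2 \<le> worst_prob \<rho> n d1 d2 T \<delta>"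
  shows "\<delta>\<^sup>2 = \<beta> \<Longrightarrow> 1 / 2 \<le> worst_prob \<rho> n d1 d2 T \<delta>" "ennreal (\<beta> / 2) \<le> worst_risk \<rho> n d1 d2 T"
proof -
  have d1': "0 < d1" using d1 by simp
  show "1 / 2 \<le> worst_prob \<rho> n d1 d2 T \<delta>" if \<delta>: "\<delta>\<^sup>2 = \<beta>"
  proof -
    have "\<delta> \<noteq> 0" using \<delta> \<beta> by auto
    then have "1 / 2 \<le> worst_prob \<rho> n d1 d2 T \<bar>\<delta>\<bar>" using \<delta> by (intro wp) auto
    also have "\<dots> \<le> worst_prob \<rho> n d1 d2 T \<delta>" by (intro worst_prob_antimono[OF d1' _ m]) auto
    finally show ?thesis .
  qed
  have "(sqrt \<beta>)\<^sup>2 = \<beta>" using \<beta> by simp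
  then show "ennreal (\<beta> / 2) \<le> worst_risk \<rho> n d1 d2 T"
    using worst_risk_ge[OF d1' _ wp m, of "sqrt \<beta>"] \<beta> by simp
qed

theorem theorem4p2:
  shows "(\<exists>c::real. c > 0 \<and>
      (\<forall>(d1::nat) (d2::nat) (n::nat) T. 1 \<le> d1 \<and> d1 \<le> d2 \<and> 1 \<le> n \<and> estimator n d1 d2 T \<longrightarrow>
        (\<forall>\<delta>::real. \<delta>\<^sup>2 = c * min 1 ((real d1)\<^sup>2 / (real n * min (real n * real d1) (real d2))) \<longrightarrow>
           worst_prob d_FR n d1 d2 T \<delta> \<ge> 1 / 2) \<and>
        (\<forall>\<delta>::real. \<delta>\<^sup>2 = c * min 1 (real d1 / (real n * min (real n * real d1) (real d2))) \<longrightarrow>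
           worst_prob d_op n d1 d2 T \<delta> \<ge> 1 / 2))) \<and>
    (\<exists>c'::real. c' > 0 \<and>
      (\<forall>(d1::nat) (d2::nat) (n::nat) T. 1 \<le> d1 \<and> d1 \<le> d2 \<and> 1 \<le> n \<and> estimator n d1 d2 T \<longrightarrow>
        worst_risk d_FR n d1 d2 T
          \<ge> ennreal (c' * min ((real d1)\<^sup>2 / (real n * min (real n * real d1) (real d2))) 1) \<and>
        worst_risk d_op n d1 d2 T
          \<ge> ennreal (c' * min (real d1 / (real n * min (real n * real d1) (real d2))) 1)))"
proof -
  \<comment> \<open>The constant dictated by the Fisher-Rao case; the Thompson case, where
    \<open>I\<close> has exactly \<open>d1\<close> elements, would allow twice as much.\<close>
  define c :: real where "c = 1 / (1024 * 1000\<^sup>2)"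
  have c: "c > 0" by (simp add: c_def)
  have main: "(\<forall>\<delta>. \<delta>\<^sup>2 = c * min 1 ((real d1)\<^sup>2 / (real n * min (real n * real d1) (real d2))) \<longrightarrow>
        1 / 2 \<le> worst_prob d_FR n d1 d2 T \<delta>) \<and>
      (\<forall>\<delta>. \<delta>\<^sup>2 = c * min 1 (real d1 / (real n * min (real n * real d1) (real d2))) \<longrightarrow>
        1 / 2 \<le> worst_prob d_op n d1 d2 T \<delta>) \<and>
      ennreal (c * min 1 ((real d1)\<^sup>2 / (real n * min (real n * real d1) (real d2))) / 2) \<le> worst_risk d_FR n d1 d2 T \<and>
      ennreal (c * min 1 (real d1 / (real n * min (real n * real d1) (real d2))) / 2) \<le> worst_risk d_op n d1 d2 T"
    if est: "estimator n d1 d2 T" and d: "1 \<le> d1" "d1 \<le> d2" "1 \<le> n" for d1 d2 n T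
  proof -
    let ?x = "real n * min (real n * real d1) (real d2)"
    have x: "?x > 0" using d by simp
    have pos: "0 < c * min 1 ((real d1)\<^sup>2 / ?x)" "0 < c * min 1 (real d1 / ?x)"
      using x d c by (auto intro!: mult_pos_pos)
    have d1: "0 < d1" using d by simp
    note FR = bounds_from_worst_prob[OF est d(1) pos(1)
      measurable_d_FR[OF estimator_PD[OF est] estimator_measurable[OF est]] worst_prob_d_FR[OF est d, folded c_def]]
    note op = bounds_from_worst_prob[OF est d(1) pos(2)
      measurable_d_op[OF estimator_PD[OF est] estimator_measurable[OF est] _ d1] worst_prob_d_op[OF est d, folded c_def]]
    show ?thesis using FR op by blast
  qed
  show ?thesis
  proof (intro conjI)
    show "\<exists>c>0. \<forall>d1 d2 n T. 1 \<le> d1 \<and> d1 \<le> d2 \<and> 1 \<le> n \<and> estimator n d1 d2 T \<longrightarrow>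
        (\<forall>\<delta>. \<delta>\<^sup>2 = c * min 1 ((real d1)\<^sup>2 / (real n * min (real n * real d1) (real d2))) \<longrightarrow>
           worst_prob d_FR n d1 d2 T \<delta> \<ge> 1 / 2) \<and>
        (\<forall>\<delta>. \<delta>\<^sup>2 = c * min 1 (real d1 / (real n * min (real n * real d1) (real d2))) \<longrightarrow>
           worst_prob d_op n d1 d2 T \<delta> \<ge> 1 / 2)"
      using main c by blast
    have "c / 2 * min a 1 = c * min 1 a / 2" for a by (simp add: min.commute)
    then show "\<exists>c'>0. \<forall>d1 d2 n T. 1 \<le> d1 \<and> d1 \<le> d2 \<and> 1 \<le> n \<and> estimator n d1 d2 T \<longrightarrow>
        worst_risk d_FR n d1 d2 T
          \<ge> ennreal (c' * min ((real d1)\<^sup>2 / (real n * min (real n * real d1) (real d2))) 1) \<and>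
        worst_risk d_op n d1 d2 T
          \<ge> ennreal (c' * min (real d1 / (real n * min (real n * real d1) (real d2))) 1)"
      using main c by (intro exI[of _ "c / 2"]) simp
  qed
qed

end
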